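(* For every type $\sigma$ and all closed terms $M,N$ of $\Lambda_\oplus^{!}$ with $\vdash M:\sigma$ and $\vdash N:\sigma$, one has $\delta^c_{!,\sigma}(M,N)\le\delta^t_\sigma(M,N)$.
   Context: Work in the language $\Lambda_\oplus^{!}$: terms $M ::= x \mid MM \mid \lambda x.M \mid \lambda !x.M \mid\ !M \mid M\oplus M$, values $V::=\lambda x.M\mid\lambda!x.M\mid\ !M$. Closed terms are evaluated via evaluation contexts $E::=[\cdot]\mid EV\mid ME$ and one-step reduction to sequences $M\oplus N\to M,N$, $(\lambda x.M)V\to M\{V/x\}$, $(\lambda!x.M)(!N)\to M\{N/x\}$ (closed under evaluation contexts); approximation semantics: $V\Rightarrow\{V^1\}$, $M\Rightarrow\emptyset$, and if $M\to N_1,\dots,N_n$ with $N_i\Rightarrow\mathcal D_i$ then $M\Rightarrow\sum_i\frac1n\mathcal D_i$; $[\![M]\!]$ is the supremum of all such $\mathcal D$ and $\mathrm{Obs}(M)=\sum_V[\![M]\!](V)$. Types: $\sigma::=\alpha\mid\mu\alpha.(\sigma\multimap\sigma)\mid\mu\alpha.!\sigma\mid\sigma\multimap\sigma\mid\ !\sigma$ modulo $=_T$ generated by $\mu$-unfolding ($\mu\alpha.(\sigma\multimap\tau)=_T(\sigma\multimap\tau)[\mu\alpha.(\sigma\multimap\tau)/\alpha]$, $\mu\alpha.!\sigma=_T\ !(\sigma[\mu\alpha.!\sigma/\alpha])$) and uniqueness of fixed points. Typing rules, with environments $!\Gamma$ (declarations $!x:!\sigma$) and $\Delta$ (declarations $x:\sigma$):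 $!\Gamma,!x:!\sigma\vdash x:\sigma$; $!\Gamma,x:\sigma\vdash x:\sigma$; from $!\Gamma,x:\sigma,\Delta\vdash M:\tau$ get $!\Gamma,\Delta\vdash\lambda x.M:\sigma\multimap\tau$; from $!\Gamma,!x:!\sigma,\Delta\vdash M:\tau$ get $!\Gamma,\Delta\vdash\lambda!x.M:\ !\sigma\multimap\tau$; from $!\Gamma,\Delta\vdash M:\sigma\multimap\tau$, $!\Gamma,\Theta\vdash N:\sigma$ get $!\Gamma,\Delta,\Theta\vdash MN:\tau$; from $!\Gamma\vdash M:\sigma$ get $!\Gamma\vdash\ !M:\ !\sigma$; from $!\Gamma,\Delta\vdash M:\sigma$ and $!\Gamma,\Delta\vdash N:\sigma$ get $!\Gamma,\Delta\vdash M\oplus N:\sigma$. Context distance: $\delta^c_{!,\sigma}(M,N)=\sup|\mathrm{Obs}(C\{M/h\})-\mathrm{Obs}(C\{N/h\})|$ over all types $\tau$ and terms $C$ of $\Lambda_\oplus^{!}$ with $h:\sigma\vdash C:\tau$ ($h$ a distinguished linear variable). Tuple distance. Sequence notation: $\mathbf a_X$ is the subsequence with indices in $X$, $\mathbf a;b$ appends $b$. Tuples $K=(\mathbf M,\mathbf V)$ (sequence of closed terms, sequence of closed values); tuple types $A=(\boldsymbol\sigma,\boldsymbol\tau)$; $\vdash K:A$ componentwise. Applicative typing judgments $\kappa=(I,J,\boldsymbol\sigma,\boldsymbol\tau,N,\gamma)$ with $\boldsymbol\sigma$ an $n$-sequence, $\boldsymbol\tau$ an $m$-sequence, $I\subseteq\{1..n\}$,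 $J\subseteq\{1..m\}$, $!\mathbf x_I:!\boldsymbol\sigma_I,\mathbf y_J:\boldsymbol\tau_J\vdash N:\gamma$; $N[K]$ substitutes $x_i:=M_i$ ($i\in I$), $y_j:=W_j$ ($j\in J$); $\mathscr J^{\mathcal V}$ = those with $N$ some $y_j$ or of the form $\lambda z.P$, $\lambda!z.P$, $!P$. Actions on a tuple $K=(\mathbf M,\mathbf W)$ of type $A=(\boldsymbol\sigma,\boldsymbol\tau)$: $?i$ (enabled if $i\le m$, $\tau_i=\ !\gamma$; then $W_i=\ !N$): to $(\mathbf M;N,\mathbf W_{\{1..m\}\setminus\{i\}})$ of type $(\boldsymbol\sigma;\gamma,\boldsymbol\tau_{\{1..m\}\setminus\{i\}})$ with probability 1; $!i$ (enabled if $i\le n$): to $(\mathbf M,\mathbf W;V)$ of type $(\boldsymbol\sigma,\boldsymbol\tau;\sigma_i)$ with probability $[\![M_i]\!](V)$; $@(\kappa,i)$ with $\kappa=(I,J,\boldsymbol\sigma,\boldsymbol\tau,N,\gamma)\in\mathscr J^{\mathcal V}$ (enabled if $\tau_i=\gamma\multimap\eta$, $i\notin J$): to $(\mathbf M,\mathbf W_{\{1..m\}\setminus(J\cup\{i\})};V)$ of type $(\boldsymbol\sigma,\boldsymbol\tau_{\{1..m\}\setminus(J\cup\{i\})};\eta)$ with probability $[\![W_i(N[K])]\!](V)$. The WLTS $\mathscr L_\oplus^{!}$ has states $(\mathcal D,A)$, $\mathcal D$ a subdistribution over closed tuples of type $A$, weight $w(\mathcal D,A)=\sum\mathcal D$,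 and deterministic transitions $(\mathcal D,A)\xrightarrow{A}(\mathcal D,A)$ for each tuple type $A$ and $(\mathcal D,A)\xrightarrow{a}(\sum_K\mathcal D(K)P(K,a),B)$ for each action $a$ enabled for $A$ ($P(K,a)$ the successor distribution, $B$ the resulting type). An $\varepsilon$-bisimulation is a reflexive symmetric relation $R$ on states such that $t\mathrel Rs$ implies: every $t\xrightarrow{a}u$ is matched by some $s\xrightarrow{a}v$ with $u\mathrel Rv$, and $|w(t)-w(s)|\le\varepsilon$; $R^\varepsilon$ is the largest, and $\delta^t(t,s)=\inf\{\varepsilon\in[0,1]:t\mathrel{R^\varepsilon}s\}$. For a closed $M$ with $\vdash M:\sigma$, let $\langle M\rangle_\sigma=(\mathcal D_M,([\,],[\sigma]))$ where $\mathcal D_M$ assigns probability $[\![M]\!](V)$ to the tuple $([\,],[V])$; and $\delta^t_\sigma(M,N)=\delta^t(\langle M\rangle_\sigma,\langle N\rangle_\sigma)$. *)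

theory Defs
  imports "HOL-Probability.SPMF"
begin

section \<open>Terms and their evaluation\<close>

text \<open>
  Terms are in de Bruijn form, so syntactic equality is alpha-equivalence and the sums over values
  below range over alpha-classes. \<open>Lam\<close> is the linear abstraction \<open>\<lambda>x. M\<close>, \<open>LamB\<close> the nonlinear
  abstraction \<open>\<lambda>!x. M\<close>, \<open>Bang\<close> the operator \<open>!M\<close>.
\<close>

datatype tm =
    Var nat
  | App tm tm
  | Lam tm
  | LamB tm
  | Bang tm
  | Choice tm tm (infixr \<open>\<oplus>\<close> 65)

primrec ren :: "(nat \<Rightarrow> nat) \<Rightarrow> tm \<Rightarrow> tm" where
  "ren f (Var k) = Var (f k)"
| "ren f (App M N) = App (ren f M) (ren f N)"
| "ren f (Lam M) = Lam (ren (case_nat 0 (\<lambda>k. Suc (f k))) M)"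
| "ren f (LamB M) = LamB (ren (case_nat 0 (\<lambda>k. Suc (f k))) M)"
| "ren f (Bang M) = Bang (ren f M)"
| "ren f (M \<oplus> N) = ren f M \<oplus> ren f N"

definition up :: "(nat \<Rightarrow> tm) \<Rightarrow> nat \<Rightarrow> tm" where
  "up s = case_nat (Var 0) (\<lambda>k. ren Suc (s k))"

primrec subst :: "(nat \<Rightarrow> tm) \<Rightarrow> tm \<Rightarrow> tm" where
  "subst s (Var k) = s k"
| "subst s (App M N) = App (subst s M) (subst s N)"
| "subst s (Lam M) = Lam (subst (up s) M)"
| "subst s (LamB M) = LamB (subst (up s) M)"
| "subst s (Bang M) = Bang (subst s M)"
| "subst s (M \<oplus> N) = subst s M \<oplus> subst s N"

text \<open>\<open>M{N/x}\<close>, where \<open>x\<close> is the outermost free variable (index 0) of \<open>M\<close>.\<close>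

definition subst0 :: "tm \<Rightarrow> tm \<Rightarrow> tm" where
  "subst0 M N = subst (case_nat N Var) M"

fun is_val :: "tm \<Rightarrow> bool" where
  "is_val (Lam M) = True"
| "is_val (LamB M) = True"
| "is_val (Bang M) = True"
| "is_val _ = False"

text \<open>
  One-step reduction to sequences. The last two rules close under the evaluation contexts
  \<open>E ::= [] | E V | M E\<close>.
\<close>

inductive step :: "tm \<Rightarrow> tm list \<Rightarrow> bool" where
  step_choice: "step (M \<oplus> N) [M, N]"
| step_beta: "is_val V \<Longrightarrow> step (App (Lam M) V) [subst0 M V]"
| step_betaB: "step (App (LamB M) (Bang N)) [subst0 M N]"
| step_fun: "step M Ms \<Longrightarrow> is_val V \<Longrightarrow> step (App M V) (map (\<lambda>M'. App M' V) Ms)"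
| step_arg: "step N Ns \<Longrightarrow> step (App M N) (map (App M) Ns)"

text \<open>
  Approximation semantics; subdistributions are elements of type \<open>spmf\<close>. In the last rule the
  result is the uniform mixture \<open>\<Sum>\<^sub>i 1/n \<cdot> D\<^sub>i\<close> (one-step reducts always satisfy \<open>n \<ge> 1\<close>).
\<close>

inductive approx :: "tm \<Rightarrow> tm spmf \<Rightarrow> bool" where
  approx_val: "is_val V \<Longrightarrow> approx V (return_spmf V)"
| approx_empty: "approx M (return_pmf None)"
| approx_step: "step M Ns \<Longrightarrow> length Ds = length Ns \<Longrightarrow> (\<And>i. i < length Ns \<Longrightarrow> approx (Ns ! i) (Ds ! i))
    \<Longrightarrow> approx M (bind_pmf (pmf_of_set {..<length Ns}) (\<lambda>i. Ds ! i))"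

text \<open>
  \<open>lub_spmf\<close> takes pointwise suprema. The set of approximants is directed but not a chain; that the
  result nevertheless is the pointwise supremum is shown in \<open>spmf_sem\<close> below.
\<close>

definition sem :: "tm \<Rightarrow> tm spmf" where
  "sem M = lub_spmf {D. approx M D}"

definition Obs :: "tm \<Rightarrow> real" where
  "Obs M = weight_spmf (sem M)"

lemma step_not_val: "step M Ns \<Longrightarrow> \<not> is_val M"
  by (induction rule: step.induct) auto

lemma step_det: "step M Ns \<Longrightarrow> step M Ns' \<Longrightarrow> Ns = Ns'"
proof (induction arbitrary: Ns' rule: step.induct)
  case (step_choice M N) then show ?case by cases auto
next
  case (step_beta V M)
  from step_beta(2) show ?case by cases (use step_beta(1) in \<open>auto dest: step_not_val\<close>)
next
  case (step_betaB M N)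
  from step_betaB show ?case by cases (auto dest: step_not_val)
next
  case (step_fun M Ms V)
  from step_fun(4) show ?case by cases (insert step_fun.hyps, auto dest: step_not_val dest!: step_fun.IH)
next
  case (step_arg N Ns M)
  from step_arg(3) show ?case by cases (insert step_arg.hyps step_not_val[OF step_arg.hyps], auto dest: step_not_val dest!: step_arg.IH)
qed

lemma step_nonempty: "step M Ns \<Longrightarrow> Ns \<noteq> []"
  by (induction rule: step.induct) auto

text \<open>Fuel-bounded evaluation; it yields a chain cofinal in the set of approximants.\<close>

primrec evl :: "nat \<Rightarrow> tm \<Rightarrow> tm spmf" where
  "evl 0 M = return_pmf None"
| "evl (Suc n) M = (if is_val M then return_spmf M
     else if \<exists>Ns. step M Ns then (let Ns = (THE Ns. step M Ns) in
       bind_pmf (pmf_of_set {..<length Ns}) (\<lambda>i. evl n (Ns ! i)))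
     else return_pmf None)"

lemma the_step: "step M Ns \<Longrightarrow> (THE Ns. step M Ns) = Ns"
  using step_det by blast

lemma evl_step: "step M Ns \<Longrightarrow> evl (Suc n) M = bind_pmf (pmf_of_set {..<length Ns}) (\<lambda>i. evl n (Ns ! i))"
  using step_not_val by (auto simp: the_step Let_def)

lemma approx_evl: "approx M (evl n M)"
proof (induction n arbitrary: M)
  case 0 then show ?case by (simp add: approx_empty)
next
  case (Suc n)
  show ?case
  proof (cases "\<exists>Ns. step M Ns")
    case True
    then obtain Ns where s: "step M Ns" ..
    have "approx M (bind_pmf (pmf_of_set {..<length Ns}) (\<lambda>i. map (evl n) Ns ! i))"
      by (rule approx_step[OF s]) (auto intro: Suc)
    also have "bind_pmf (pmf_of_set {..<length Ns}) (\<lambda>i. map (evl n) Ns ! i) = evl (Suc n) M"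
      unfolding evl_step[OF s] using step_nonempty[OF s]
      by (intro bind_pmf_cong) (auto simp: lessThan_empty_iff)
    finally show ?thesis .
  qed (auto intro: approx.intros)
qed

lemma mix_mono:
  assumes "step M Ns" "\<And>i. i < length Ns \<Longrightarrow> ord_spmf (=) (f i) (g i)"
  shows "ord_spmf (=) (bind_pmf (pmf_of_set {..<length Ns}) f) (bind_pmf (pmf_of_set {..<length Ns}) g)"
  using assms step_nonempty[OF assms(1)]
  by (intro rel_pmf_bindI[where R="\<lambda>x y. x = y \<and> x < length Ns"] rel_pmf_reflI)
     (auto simp: lessThan_empty_iff)

lemma evl_mono1: "ord_spmf (=) (evl n M) (evl (Suc n) M)"
proof (induction n arbitrary: M)
  case (Suc n)
  show ?case
  proof (cases "\<exists>Ns. step M Ns")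
    case True
    then obtain Ns where s: "step M Ns" ..
    show ?thesis unfolding evl_step[OF s] by (rule mix_mono[OF s]) (rule Suc)
  qed auto
qed simp

lemma evl_mono: "m \<le> n \<Longrightarrow> ord_spmf (=) (evl m M) (evl n M)"
proof (induction n rule: nat_induct_at_least)
  case base show ?case by simp
next
  case (Suc n) show ?case by (rule spmf.leq_trans[OF Suc.IH evl_mono1])
qed

lemma approx_le_evl: "approx M D \<Longrightarrow> \<exists>n. ord_spmf (=) D (evl n M)"
proof (induction rule: approx.induct)
  case (approx_val V) then show ?case by (intro exI[of _ 1]) simp
next
  case (approx_step M Ns Ds)
  then obtain n where n: "\<And>i. i < length Ns \<Longrightarrow> ord_spmf (=) (Ds ! i) (evl (n i) (Ns ! i))" by metis
  define m where "m = Max (n ` {..<length Ns})"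
  have "ord_spmf (=) (Ds ! i) (evl m (Ns ! i))" if "i < length Ns" for i
    using that by (intro spmf.leq_trans[OF n evl_mono]) (auto simp: m_def)
  then show ?case
    by (intro exI[of _ "Suc m"]) (simp only: evl_step[OF approx_step(1)] mix_mono[OF approx_step(1)])
qed simp

lemma sem_evl: "sem M = lub_spmf (range (\<lambda>n. evl n M))"
proof -
  have "(SUP D\<in>{D. approx M D}. ennreal (spmf D V)) = (SUP D\<in>range (\<lambda>n. evl n M). ennreal (spmf D V))" for V
  proof (rule antisym)
    show "(SUP D\<in>{D. approx M D}. ennreal (spmf D V)) \<le> (SUP D\<in>range (\<lambda>n. evl n M). ennreal (spmf D V))"
    proof (rule SUP_least)
      fix D assume "D \<in> {D. approx M D}"
      then obtain n where "ord_spmf (=) D (evl n M)" using approx_le_evl by blast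
      then have "spmf D V \<le> spmf (evl n M) V" by (rule ord_spmf_eq_leD)
      then show "ennreal (spmf D V) \<le> (SUP D\<in>range (\<lambda>n. evl n M). ennreal (spmf D V))"
        by (intro SUP_upper2[of "evl n M"]) auto
    qed
  qed (rule SUP_subset_mono, auto intro: approx_evl)
  then show ?thesis unfolding sem_def lub_spmf_def by simp
qed

lemma evl_chain: "Complete_Partial_Order.chain (ord_spmf (=)) (range (\<lambda>n. evl n M))"
  by (rule chainI) (use evl_mono nat_le_linear in blast)

lemma spmf_sem: "spmf (sem M) V = (SUP D\<in>{D. approx M D}. spmf D V)"
proof -
  have "spmf (sem M) V = (SUP D\<in>range (\<lambda>n. evl n M). spmf D V)"
    unfolding sem_evl by (rule spmf_lub_spmf[OF evl_chain]) simp
  also have "\<dots> = (SUP D\<in>{D. approx M D}. spmf D V)"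
  proof (rule antisym)
    show "(SUP D\<in>range (\<lambda>n. evl n M). spmf D V) \<le> (SUP D\<in>{D. approx M D}. spmf D V)"
      by (rule cSUP_subset_mono) (auto intro: approx_evl bdd_aboveI[of _ 1] pmf_le_1)
    show "(SUP D\<in>{D. approx M D}. spmf D V) \<le> (SUP D\<in>range (\<lambda>n. evl n M). spmf D V)"
    proof (rule cSUP_least)
      fix D assume "D \<in> {D. approx M D}"
      then obtain n where "ord_spmf (=) D (evl n M)" using approx_le_evl by blast
      then have "spmf D V \<le> spmf (evl n M) V" by (rule ord_spmf_eq_leD)
      then show "spmf D V \<le> (SUP D\<in>range (\<lambda>n. evl n M). spmf D V)"
        by (intro cSUP_upper2[where x="evl n M"]) (auto intro: bdd_aboveI[of _ 1] pmf_le_1)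
    qed (auto intro: approx_empty)
  qed
  finally show ?thesis .
qed

section \<open>Types\<close>

text \<open>
  Type expressions, again in de Bruijn form: \<open>MuArr \<sigma> \<tau>\<close> is \<open>\<mu>\<alpha>. (\<sigma> \<multimap> \<tau>)\<close> and \<open>MuExp \<sigma>\<close> is \<open>\<mu>\<alpha>. !\<sigma>\<close>,
  both binding index 0 in their arguments.
\<close>

datatype rty =
    RVar nat
  | MuArr rty rty
  | MuExp rty
  | RArr rty rty
  | RExp rty

primrec rren :: "(nat \<Rightarrow> nat) \<Rightarrow> rty \<Rightarrow> rty" where
  "rren f (RVar k) = RVar (f k)"
| "rren f (MuArr a b) =
     MuArr (rren (case_nat 0 (\<lambda>k. Suc (f k))) a) (rren (case_nat 0 (\<lambda>k. Suc (f k))) b)"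
| "rren f (MuExp a) = MuExp (rren (case_nat 0 (\<lambda>k. Suc (f k))) a)"
| "rren f (RArr a b) = RArr (rren f a) (rren f b)"
| "rren f (RExp a) = RExp (rren f a)"

definition rup :: "(nat \<Rightarrow> rty) \<Rightarrow> nat \<Rightarrow> rty" where
  "rup s = case_nat (RVar 0) (\<lambda>k. rren Suc (s k))"

primrec rsubst :: "(nat \<Rightarrow> rty) \<Rightarrow> rty \<Rightarrow> rty" where
  "rsubst s (RVar k) = s k"
| "rsubst s (MuArr a b) = MuArr (rsubst (rup s) a) (rsubst (rup s) b)"
| "rsubst s (MuExp a) = MuExp (rsubst (rup s) a)"
| "rsubst s (RArr a b) = RArr (rsubst s a) (rsubst s b)"
| "rsubst s (RExp a) = RExp (rsubst s a)"

definition rsubst0 :: "rty \<Rightarrow> rty \<Rightarrow> rty" where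
  "rsubst0 a c = rsubst (case_nat c RVar) a"

text \<open>
  The congruence generated by unfolding and by uniqueness of fixed points; guardedness of the
  fixed-point equations is built into the shape \<open>\<sigma> \<multimap> \<tau>\<close> or \<open>!\<sigma>\<close> of their right-hand sides.
\<close>

inductive type_eq :: "rty \<Rightarrow> rty \<Rightarrow> bool" (infix \<open>=\<^sub>T\<close> 50) where
  teq_refl: "a =\<^sub>T a"
| teq_sym: "a =\<^sub>T b \<Longrightarrow> b =\<^sub>T a"
| teq_trans: "a =\<^sub>T b \<Longrightarrow> b =\<^sub>T c \<Longrightarrow> a =\<^sub>T c"
| teq_MuArr: "a =\<^sub>T a' \<Longrightarrow> b =\<^sub>T b' \<Longrightarrow> MuArr a b =\<^sub>T MuArr a' b'"
| teq_MuExp: "a =\<^sub>T a' \<Longrightarrow> MuExp a =\<^sub>T MuExp a'"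
| teq_RArr: "a =\<^sub>T a' \<Longrightarrow> b =\<^sub>T b' \<Longrightarrow> RArr a b =\<^sub>T RArr a' b'"
| teq_RExp: "a =\<^sub>T a' \<Longrightarrow> RExp a =\<^sub>T RExp a'"
| teq_unfold_Arr: "MuArr a b =\<^sub>T rsubst0 (RArr a b) (MuArr a b)"
| teq_unfold_Exp: "MuExp a =\<^sub>T rsubst0 (RExp a) (MuExp a)"
| teq_unique_Arr: "c =\<^sub>T rsubst0 (RArr a b) c \<Longrightarrow> d =\<^sub>T rsubst0 (RArr a b) d \<Longrightarrow> c =\<^sub>T d"
| teq_unique_Exp: "c =\<^sub>T rsubst0 (RExp a) c \<Longrightarrow> d =\<^sub>T rsubst0 (RExp a) d \<Longrightarrow> c =\<^sub>T d"

quotient_type ty = rty / type_eq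
  by (rule equivpI) (auto intro: reflpI sympI transpI teq_refl teq_sym teq_trans)

lift_definition Arr :: "ty \<Rightarrow> ty \<Rightarrow> ty" (infixr \<open>\<multimap>\<close> 60) is RArr
  by (rule teq_RArr)

lift_definition Exp :: "ty \<Rightarrow> ty" is RExp
  by (rule teq_RExp)

text \<open>
  \<open>has_type \<Gamma> \<Delta> M \<sigma>\<close> is the judgement \<open>!\<Gamma>, \<Delta> \<turnstile> M : \<sigma>\<close>, where \<open>\<Gamma> k = Some \<sigma>\<close> declares
  \<open>!x : !\<sigma>\<close> and \<open>\<Delta> k = Some \<sigma>\<close> declares \<open>x : \<sigma>\<close>, for the variable \<open>x\<close> with index \<open>k\<close>.
  The side conditions force \<open>\<Gamma>\<close> and \<open>\<Delta>\<close> to be disjoint in every derivable judgement.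
\<close>

inductive has_type :: "(nat \<rightharpoonup> ty) \<Rightarrow> (nat \<rightharpoonup> ty) \<Rightarrow> tm \<Rightarrow> ty \<Rightarrow> bool" where
  T_varB: "\<Gamma> k = Some \<sigma> \<Longrightarrow> has_type \<Gamma> Map.empty (Var k) \<sigma>"
| T_var: "\<Gamma> k = None \<Longrightarrow> has_type \<Gamma> [k \<mapsto> \<sigma>] (Var k) \<sigma>"
| T_Lam: "has_type (case_nat None \<Gamma>) (case_nat (Some \<sigma>) \<Delta>) M \<tau> \<Longrightarrow> has_type \<Gamma> \<Delta> (Lam M) (\<sigma> \<multimap> \<tau>)"
| T_LamB: "has_type (case_nat (Some \<sigma>) \<Gamma>) (case_nat None \<Delta>) M \<tau> \<Longrightarrow> has_type \<Gamma> \<Delta> (LamB M) (Exp \<sigma> \<multimap> \<tau>)"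
| T_App: "has_type \<Gamma> \<Delta> M (\<sigma> \<multimap> \<tau>) \<Longrightarrow> has_type \<Gamma> \<Theta> N \<sigma> \<Longrightarrow> dom \<Delta> \<inter> dom \<Theta> = {} \<Longrightarrow>
    has_type \<Gamma> (\<Delta> ++ \<Theta>) (App M N) \<tau>"
| T_Bang: "has_type \<Gamma> Map.empty M \<sigma> \<Longrightarrow> has_type \<Gamma> Map.empty (Bang M) (Exp \<sigma>)"
| T_Choice: "has_type \<Gamma> \<Delta> M \<sigma> \<Longrightarrow> has_type \<Gamma> \<Delta> N \<sigma> \<Longrightarrow> has_type \<Gamma> \<Delta> (M \<oplus> N) \<sigma>"

abbreviation closed_type :: "tm \<Rightarrow> ty \<Rightarrow> bool" (\<open>\<turnstile> _ : _\<close> [60, 60] 50) where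
  "\<turnstile> M : \<sigma> \<equiv> has_type Map.empty Map.empty M \<sigma>"

section \<open>The context distance\<close>

text \<open>The distinguished linear variable \<open>h\<close> is index 0.\<close>

definition ctx_dist :: "ty \<Rightarrow> tm \<Rightarrow> tm \<Rightarrow> real" where
  "ctx_dist \<sigma> M N =
     Sup {\<bar>Obs (subst0 C M) - Obs (subst0 C N)\<bar> | C \<tau>. has_type Map.empty [0 \<mapsto> \<sigma>] C \<tau>}"

section \<open>The tuple distance\<close>

text \<open>Components of tuples are numbered from 0; subsequences are given by \<open>nths\<close>.\<close>

type_synonym tuple = "tm list \<times> tm list"
type_synonym tuple_ty = "ty list \<times> ty list"

definition tuple_type :: "tuple \<Rightarrow> tuple_ty \<Rightarrow> bool" where
  "tuple_type K A \<longleftrightarrow> list_all2 closed_type (fst K) (fst A) \<and> list_all2 closed_type (snd K) (snd A)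
     \<and> (\<forall>V\<in>set (snd K). is_val V)"

text \<open>
  \<open>(I, J, \<sigma>s, \<tau>s, N, \<gamma>)\<close>; in \<open>N\<close>, the variable \<open>x\<^sub>i\<close> has index \<open>i\<close> and \<open>y\<^sub>j\<close> has index
  \<open>length \<sigma>s + j\<close>.
\<close>

type_synonym ajudg = "nat set \<times> nat set \<times> ty list \<times> ty list \<times> tm \<times> ty"

fun is_ajudg :: "ajudg \<Rightarrow> bool" where
  "is_ajudg (I, J, \<sigma>s, \<tau>s, N, \<gamma>) \<longleftrightarrow>
     I \<subseteq> {..<length \<sigma>s} \<and> J \<subseteq> {..<length \<tau>s} \<and>
     has_type (\<lambda>k. if k \<in> I then Some (\<sigma>s ! k) else None)
       (\<lambda>k. if length \<sigma>s \<le> k \<and> k - length \<sigma>s \<in> J then Some (\<tau>s ! (k - length \<sigma>s)) else None)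
       N \<gamma>"

fun is_val_ajudg :: "ajudg \<Rightarrow> bool" where
  "is_val_ajudg (I, J, \<sigma>s, \<tau>s, N, \<gamma>) \<longleftrightarrow>
     is_ajudg (I, J, \<sigma>s, \<tau>s, N, \<gamma>) \<and> ((\<exists>j\<in>J. N = Var (length \<sigma>s + j)) \<or> is_val N)"

fun inst :: "ajudg \<Rightarrow> tuple \<Rightarrow> tm" where
  "inst (I, J, \<sigma>s, \<tau>s, N, \<gamma>) (Ms, Ws) =
     subst (\<lambda>k. if k \<in> I then Ms ! k
                else if length \<sigma>s \<le> k \<and> k - length \<sigma>s \<in> J then Ws ! (k - length \<sigma>s)
                else Var k) N"

text \<open>The actions \<open>?i\<close>, \<open>!i\<close> and \<open>@(\<kappa>, i)\<close>.\<close>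

datatype action = AQuery nat | ABang nat | AApp ajudg nat

text \<open>\<open>act_type A a B\<close>: action \<open>a\<close> is enabled for tuples of type \<open>A\<close> and leads to type \<open>B\<close>.\<close>

inductive act_type :: "tuple_ty \<Rightarrow> action \<Rightarrow> tuple_ty \<Rightarrow> bool" where
  "i < length \<tau>s \<Longrightarrow> \<tau>s ! i = Exp \<gamma> \<Longrightarrow>
    act_type (\<sigma>s, \<tau>s) (AQuery i) (\<sigma>s @ [\<gamma>], nths \<tau>s (- {i}))"
| "i < length \<sigma>s \<Longrightarrow> act_type (\<sigma>s, \<tau>s) (ABang i) (\<sigma>s, \<tau>s @ [\<sigma>s ! i])"
| "is_val_ajudg (I, J, \<sigma>s, \<tau>s, N, \<gamma>) \<Longrightarrow> i < length \<tau>s \<Longrightarrow> \<tau>s ! i = \<gamma> \<multimap> \<eta> \<Longrightarrow> i \<notin> J \<Longrightarrow>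
    act_type (\<sigma>s, \<tau>s) (AApp (I, J, \<sigma>s, \<tau>s, N, \<gamma>) i) (\<sigma>s, nths \<tau>s (- (J \<union> {i})) @ [\<eta>])"

text \<open>
  The successor distribution \<open>P(K, a)\<close>; a closed value \<open>W\<^sub>i\<close> of type \<open>!\<gamma>\<close> is some
  \<open>!N\<close>, so only the first alternative of the case distinction arises when \<open>?i\<close> is enabled.
\<close>

fun act_succ :: "tuple \<Rightarrow> action \<Rightarrow> tuple spmf" where
  "act_succ (Ms, Ws) (AQuery i) =
     (case Ws ! i of Bang N \<Rightarrow> return_spmf (Ms @ [N], nths Ws (- {i})) | _ \<Rightarrow> return_pmf None)"
| "act_succ (Ms, Ws) (ABang i) = map_spmf (\<lambda>V. (Ms, Ws @ [V])) (sem (Ms ! i))"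
| "act_succ (Ms, Ws) (AApp (I, J, \<sigma>s, \<tau>s, N, \<gamma>) i) =
     map_spmf (\<lambda>V. (Ms, nths Ws (- (J \<union> {i})) @ [V]))
       (sem (App (Ws ! i) (inst (I, J, \<sigma>s, \<tau>s, N, \<gamma>) (Ms, Ws))))"

type_synonym state = "tuple spmf \<times> tuple_ty"

definition states :: "state set" where
  "states = {(D, A). \<forall>K\<in>set_spmf D. tuple_type K A}"

definition weight :: "state \<Rightarrow> real" where
  "weight t = weight_spmf (fst t)"

datatype label = LType tuple_ty | LAct action

inductive wtrans :: "state \<Rightarrow> label \<Rightarrow> state \<Rightarrow> bool" where
  trans_type: "wtrans (D, A) (LType A) (D, A)"
| trans_act: "act_type A a B \<Longrightarrow> wtrans (D, A) (LAct a) (bind_spmf D (\<lambda>K. act_succ K a), B)"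

definition eps_bisim :: "real \<Rightarrow> state rel \<Rightarrow> bool" where
  "eps_bisim \<epsilon> R \<longleftrightarrow> R \<subseteq> states \<times> states \<and> refl_on states R \<and> sym R \<and>
     (\<forall>t s. (t, s) \<in> R \<longrightarrow>
        (\<forall>a u. wtrans t a u \<longrightarrow> (\<exists>v. wtrans s a v \<and> (u, v) \<in> R)) \<and>
        \<bar>weight t - weight s\<bar> \<le> \<epsilon>)"

text \<open>The largest \<open>\<epsilon>\<close>-bisimulation is the union of all of them.\<close>

definition eps_bisimilarity :: "real \<Rightarrow> state rel" where
  "eps_bisimilarity \<epsilon> = \<Union> {R. eps_bisim \<epsilon> R}"

definition state_dist :: "state \<Rightarrow> state \<Rightarrow> real" where
  "state_dist t s = Inf {\<epsilon>. 0 \<le> \<epsilon> \<and> \<epsilon> \<le> 1 \<and> (t, s) \<in> eps_bisimilarity \<epsilon>}"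

definition tm_state :: "ty \<Rightarrow> tm \<Rightarrow> state" where
  "tm_state \<sigma> M = (map_spmf (\<lambda>V. ([], [V])) (sem M), ([], [\<sigma>]))"

definition tuple_dist :: "ty \<Rightarrow> tm \<Rightarrow> tm \<Rightarrow> real" where
  "tuple_dist \<sigma> M N = state_dist (tm_state \<sigma> M) (tm_state \<sigma> N)"

end

theory Submission
  imports Defs
begin

text \<open>
  Replace \<open>M\<close> and \<open>N\<close> in a context by a tuple of pieces that the context still refers to by
  variables, and run the open context. A step of the context either leaves the tuple alone or is
  exactly one of the actions \<open>?i\<close>, \<open>!i\<close>, \<open>@(\<kappa>, i)\<close>, so two \<open>\<epsilon>\<close>-bisimilar distributions of tuples
  stay \<open>\<epsilon>\<close>-bisimilar, and when the context reaches a value the probabilities of this event are the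
  weights of the two distributions, which differ by at most \<open>\<epsilon>\<close>. Probabilistic choices average such
  bounds. Cutting the run off after finitely many steps and passing to the limit bounds the
  difference of the expected observations by \<open>\<epsilon>\<close>.

  The linear hole of a context is filled with a term and not with a value, and may sit below an
  abstraction. Hence the context is first run by itself until the hole is in evaluation position;
  only then is the term evaluated, which yields the initial distribution over tuples.
\<close>

section \<open>Substitution and recursive types\<close>

text \<open>The obstacle is that an action evaluates a term completely, whereas bounding the number
  of reduction steps also cuts off the evaluations that happen inside an action. Truncated
  probabilities of closed instances are therefore not transported by actions. What is transported
  instead is some function \<open>f\<close> on tuples squeezed between the truncated and the full
  observation: pieces of the tuple are evaluated to the end, and at most one unit of fuel is charged
  for each step of the context or interaction with the tuple. The error does not accumulate, since
  actions preserve bisimilarity without loss and the two branches of a choice start from the same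
  pair of distributions.

  That a well-typed open context can be blocked only by a variable rests on canonical forms, hence
  on injectivity and distinctness of \<open>\<multimap>\<close> and \<open>Exp\<close> modulo type
  equality. This is not evident, because the uniqueness rule for fixed points can equate types
  without comparing their shapes.\<close>

abbreviation upr :: "(nat \<Rightarrow> nat) \<Rightarrow> nat \<Rightarrow> nat" where
  "upr f \<equiv> case_nat 0 (\<lambda>k. Suc (f k))"

section \<open>Algebra of renaming and substitution on terms\<close>

lemma ren_ren: "ren f (ren g M) = ren (\<lambda>k. f (g k)) M"
proof (induction M arbitrary: f g)
  case (Lam M)
  have "(\<lambda>k. upr f (upr g k)) = upr (\<lambda>k. f (g k))" by (auto split: nat.splits)
  then show ?case using Lam by simp
next
  case (LamB M)
  have "(\<lambda>k. upr f (upr g k)) = upr (\<lambda>k. f (g k))" by (auto split: nat.splits)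
  then show ?case using LamB by simp
qed auto

lemma subst_ren: "subst s (ren f M) = subst (\<lambda>k. s (f k)) M"
proof (induction M arbitrary: f s)
  case (Lam M)
  have "(\<lambda>k. up s (upr f k)) = up (\<lambda>k. s (f k))" by (auto simp: up_def split: nat.splits)
  then show ?case using Lam by simp
next
  case (LamB M)
  have "(\<lambda>k. up s (upr f k)) = up (\<lambda>k. s (f k))" by (auto simp: up_def split: nat.splits)
  then show ?case using LamB by simp
qed auto

lemma ren_up: "ren (upr f) (up s k) = up (\<lambda>k. ren f (s k)) k"
  by (auto simp: up_def ren_ren split: nat.splits)

lemma ren_subst: "ren f (subst s M) = subst (\<lambda>k. ren f (s k)) M"
  by (induction M arbitrary: f s) (auto simp: ren_up)

lemma subst_up: "subst (up s) (up t k) = up (\<lambda>k. subst s (t k)) k"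
  by (auto simp: up_def subst_ren ren_subst split: nat.splits)

lemma subst_subst: "subst s (subst t M) = subst (\<lambda>k. subst s (t k)) M"
  by (induction M arbitrary: s t) (auto simp: subst_up)

lemma up_Var: "up Var = Var"
  by (auto simp: up_def split: nat.splits)

lemma subst_Var_id: "subst Var M = M"
  by (induction M) (auto simp: up_Var)

text \<open>Beta reduction commutes with filling in the tuple, so a step of the open context becomes
  the corresponding step of every closed instance.\<close>

lemma subst_subst0: "subst s (subst0 P V) = subst0 (subst (up s) P) (subst s V)"
  unfolding subst0_def subst_subst
  by (rule arg_cong[of _ _ "\<lambda>t. subst t P"])
     (auto simp: up_def subst_ren subst_Var_id split: nat.splits)

section \<open>Substitution in type expressions and its compatibility with type equality\<close>

lemma rren_rren: "rren f (rren g a) = rren (\<lambda>k. f (g k)) a"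
proof -
  have *: "(\<lambda>k. upr f (upr g k)) = upr (\<lambda>k. f (g k))" for f g
    by (auto split: nat.splits)
  show ?thesis by (induction a arbitrary: f g) (auto simp: *)
qed

lemma rsubst_rren: "rsubst s (rren f a) = rsubst (\<lambda>k. s (f k)) a"
proof -
  have *: "(\<lambda>k. rup s (upr f k)) = rup (\<lambda>k. s (f k))" for s f
    by (auto simp: rup_def split: nat.splits)
  show ?thesis by (induction a arbitrary: f s) (auto simp: *)
qed

lemma rren_rup: "rren (upr f) (rup s k) = rup (\<lambda>k. rren f (s k)) k"
  by (auto simp: rup_def rren_rren split: nat.splits)

lemma rren_rsubst: "rren f (rsubst s a) = rsubst (\<lambda>k. rren f (s k)) a"
  by (induction a arbitrary: f s) (auto simp: rren_rup)

lemma rsubst_rup: "rsubst (rup s) (rup t k) = rup (\<lambda>k. rsubst s (t k)) k"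
  by (auto simp: rup_def rsubst_rren rren_rsubst split: nat.splits)

lemma rsubst_rsubst: "rsubst s (rsubst t a) = rsubst (\<lambda>k. rsubst s (t k)) a"
  by (induction a arbitrary: s t) (auto simp: rsubst_rup)

lemma rup_RVar: "rup RVar = RVar"
  by (auto simp: rup_def split: nat.splits)

lemma rsubst_RVar_id: "rsubst RVar a = a"
  by (induction a) (auto simp: rup_RVar)

lemma rsubst_rsubst0: "rsubst s (rsubst0 a c) = rsubst0 (rsubst (rup s) a) (rsubst s c)"
  unfolding rsubst0_def rsubst_rsubst
  by (rule arg_cong[of _ _ "\<lambda>t. rsubst t a"])
     (auto simp: rup_def rsubst_rren rsubst_RVar_id split: nat.splits)

text \<open>Lets closure of type equality under substitution cover the renaming inside
  \<open>rup\<close> as well.\<close>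

lemma rren_rsubst_RVar: "rren f a = rsubst (\<lambda>k. RVar (f k)) a"
  using rren_rsubst[of f RVar a] by (simp add: rsubst_RVar_id)

text \<open>Substitution commutes with unfolding, so each generating rule is closed under it. In the
  uniqueness rules the substituted premises exhibit both sides as fixed points of one substituted
  body.\<close>

lemma teq_rsubst: "a =\<^sub>T b \<Longrightarrow> rsubst s a =\<^sub>T rsubst s b"
proof (induction arbitrary: s rule: type_eq.induct)
  case (teq_unfold_Arr a b)
  show ?case
    using type_eq.teq_unfold_Arr[of "rsubst (rup s) a" "rsubst (rup s) b"]
    by (simp only: rsubst_rsubst0 rsubst.simps)
next
  case (teq_unfold_Exp a)
  show ?case
    using type_eq.teq_unfold_Exp[of "rsubst (rup s) a"]
    by (simp only: rsubst_rsubst0 rsubst.simps)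
next
  case (teq_unique_Arr c a b d)
  show ?case
    using teq_unique_Arr.IH[of s] unfolding rsubst_rsubst0 rsubst.simps
    by (rule type_eq.teq_unique_Arr)
next
  case (teq_unique_Exp c a d)
  show ?case
    using teq_unique_Exp.IH[of s] unfolding rsubst_rsubst0 rsubst.simps
    by (rule type_eq.teq_unique_Exp)
next
  case (teq_trans a b c)
  then show ?case using type_eq.teq_trans by blast
next
  case (teq_sym a b)
  then show ?case using type_eq.teq_sym by blast
qed (simp_all add: teq_refl teq_MuArr teq_MuExp teq_RArr teq_RExp)

text \<open>Under a binder both substitutions are shifted; the shift is itself a substitution and
  therefore preserves the pointwise equality.\<close>

lemma teq_rsubst_pointwise: "(\<And>k. s k =\<^sub>T t k) \<Longrightarrow> rsubst s a =\<^sub>T rsubst t a"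
proof (induction a arbitrary: s t)
  case (MuArr a b)
  have "rup s k =\<^sub>T rup t k" for k
    using MuArr.prems
    by (auto simp: rup_def rren_rsubst_RVar intro: teq_refl teq_rsubst split: nat.splits)
  with MuArr.IH show ?case by (auto intro: teq_MuArr)
next
  case (MuExp a)
  have "rup s k =\<^sub>T rup t k" for k
    using MuExp.prems
    by (auto simp: rup_def rren_rsubst_RVar intro: teq_refl teq_rsubst split: nat.splits)
  with MuExp.IH show ?case by (auto intro: teq_MuExp)
qed (simp_all add: teq_RArr teq_RExp)

lemma teq_rsubst0:
  assumes "a =\<^sub>T b" "c =\<^sub>T d"
  shows "rsubst0 a c =\<^sub>T rsubst0 b d"
proof -
  have "rsubst0 a c =\<^sub>T rsubst0 b c"
    unfolding rsubst0_def by (rule teq_rsubst[OF assms(1)])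
  moreover have "case_nat c RVar k =\<^sub>T case_nat d RVar k" for k
    using assms(2) by (cases k) (simp_all add: teq_refl)
  then have "rsubst0 b c =\<^sub>T rsubst0 b d"
    unfolding rsubst0_def by (rule teq_rsubst_pointwise)
  ultimately show ?thesis by (rule teq_trans)
qed

section \<open>Inversion of type equality\<close>

fun head_unfold :: "rty \<Rightarrow> rty" where
  "head_unfold (MuArr a b) = rsubst0 (RArr a b) (MuArr a b)"
| "head_unfold (MuExp a) = rsubst0 (RExp a) (MuExp a)"
| "head_unfold a = a"

text \<open>The body of a fixed point is an arrow or a bang, so one unfolding exposes the outermost
  constructor. Constructors are compared syntactically but their arguments only up to
  \<open>=\<^sub>T\<close>, which makes the relation an invariant of derivations.\<close>

fun head_eq :: "rty \<Rightarrow> rty \<Rightarrow> bool" where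
  "head_eq (RArr a b) (RArr c d) \<longleftrightarrow> a =\<^sub>T c \<and> b =\<^sub>T d"
| "head_eq (RExp a) (RExp c) \<longleftrightarrow> a =\<^sub>T c"
| "head_eq (RVar k) (RVar l) \<longleftrightarrow> k = l"
| "head_eq _ _ \<longleftrightarrow> False"

lemma head_eq_refl: "head_eq (head_unfold a) (head_unfold a)"
  by (cases a) (auto simp: rsubst0_def intro: teq_refl)

lemma head_eq_sym: "head_eq a b \<Longrightarrow> head_eq b a"
  by (induction a b rule: head_eq.induct) (simp_all, (blast intro: teq_sym)+)

lemma head_eq_trans: "head_eq a b \<Longrightarrow> head_eq b c \<Longrightarrow> head_eq a c"
  by (cases a; cases b; simp; cases c; simp) (blast intro: teq_trans)+

lemma rsubst0_RArr: "rsubst0 (RArr a b) c = RArr (rsubst0 a c) (rsubst0 b c)"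
  and rsubst0_RExp: "rsubst0 (RExp a) c = RExp (rsubst0 a c)"
  by (simp_all add: rsubst0_def)

text \<open>
  In the cases of the uniqueness rules, the equation that the rule derives is itself available, and
  the congruence property of substitution turns it into equality of the arguments of the heads.
\<close>

lemma type_eq_head: "a =\<^sub>T b \<Longrightarrow> head_eq (head_unfold a) (head_unfold b)"
proof (induction rule: type_eq.induct)
  case (teq_sym a b)
  then show ?case by (blast intro: head_eq_sym)
next
  case (teq_trans a b c)
  then show ?case by (blast intro: head_eq_trans)
next
  case (teq_unique_Arr c a b d)
  have "c =\<^sub>T d" using teq_unique_Arr.hyps by (rule type_eq.teq_unique_Arr)
  then have "head_eq (RArr (rsubst0 a c) (rsubst0 b c)) (RArr (rsubst0 a d) (rsubst0 b d))"
    by (simp add: teq_refl teq_rsubst0)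
  from head_eq_trans[OF head_eq_trans[OF _ this] head_eq_sym] teq_unique_Arr.IH
  show ?case by (simp add: rsubst0_RArr)
next
  case (teq_unique_Exp c a d)
  have "c =\<^sub>T d" using teq_unique_Exp.hyps by (rule type_eq.teq_unique_Exp)
  then have "head_eq (RExp (rsubst0 a c)) (RExp (rsubst0 a d))"
    by (simp add: teq_refl teq_rsubst0)
  from head_eq_trans[OF head_eq_trans[OF _ this] head_eq_sym] teq_unique_Exp.IH
  show ?case by (simp add: rsubst0_RExp)
next
  case (teq_unfold_Arr a b)
  show ?case by (simp add: rsubst0_RArr teq_refl)
next
  case (teq_unfold_Exp a)
  show ?case by (simp add: rsubst0_RExp teq_refl)
qed (simp_all add: head_eq_refl rsubst0_RArr rsubst0_RExp teq_rsubst0 teq_MuArr teq_MuExp)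

lemma RArr_teq_iff: "RArr a b =\<^sub>T RArr c d \<longleftrightarrow> a =\<^sub>T c \<and> b =\<^sub>T d"
  using type_eq_head[of "RArr a b" "RArr c d"] teq_RArr by auto

lemma RExp_teq_iff: "RExp a =\<^sub>T RExp c \<longleftrightarrow> a =\<^sub>T c"
  using type_eq_head[of "RExp a" "RExp c"] teq_RExp by auto

lemma RArr_teq_RExp: "\<not> RArr a b =\<^sub>T RExp c"
  using type_eq_head[of "RArr a b" "RExp c"] by auto

lemma Arr_inject: "\<sigma> \<multimap> \<tau> = \<sigma>' \<multimap> \<tau>' \<longleftrightarrow> \<sigma> = \<sigma>' \<and> \<tau> = \<tau>'"
  by transfer (rule RArr_teq_iff)

lemma Exp_inject: "Exp \<sigma> = Exp \<tau> \<longleftrightarrow> \<sigma> = \<tau>"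
  by transfer (rule RExp_teq_iff)

lemma Arr_neq_Exp: "\<sigma> \<multimap> \<tau> \<noteq> Exp \<gamma>" "Exp \<gamma> \<noteq> \<sigma> \<multimap> \<tau>"
  by (transfer, auto simp: RArr_teq_RExp dest: teq_sym)+

section \<open>Typing\<close>

lemma case_nat_const: "case_nat None (\<lambda>_. None) = Map.empty"
  by (auto split: nat.splits)

lemma map_eq_SomeI: "(\<And>v \<sigma>. m v = Some \<sigma> \<longleftrightarrow> n v = Some \<sigma>) \<Longrightarrow> m = n"
  by (rule ext) (metis not_Some_eq)

lemma map_add_Some_disjoint:
  "dom m \<inter> dom n = {} \<Longrightarrow> (m ++ n) v = Some \<sigma> \<longleftrightarrow> m v = Some \<sigma> \<or> n v = Some \<sigma>"
  by (auto simp: map_add_Some_iff)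

lemma has_type_disjoint: "has_type \<Gamma> \<Delta> M \<tau> \<Longrightarrow> dom \<Gamma> \<inter> dom \<Delta> = {}"
proof (induction rule: has_type.induct)
  case (T_Lam \<Gamma> \<sigma> \<Delta> M \<tau>)
  then have "\<forall>k. Suc k \<notin> dom (case_nat None \<Gamma>) \<inter> dom (case_nat (Some \<sigma>) \<Delta>)" by blast
  then show ?case by (auto simp: dom_def) (metis option.distinct(1))
next
  case (T_LamB \<sigma> \<Gamma> \<Delta> M \<tau>)
  then have "\<forall>k. Suc k \<notin> dom (case_nat (Some \<sigma>) \<Gamma>) \<inter> dom (case_nat None \<Delta>)" by blast
  then show ?case by (auto simp: dom_def) (metis option.distinct(1))
qed (auto split: if_splits)

text \<open>Linear variables have to stay distinct whereas nonlinear ones may be merged, hence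
  injectivity on \<open>dom \<Delta>\<close> alone. The new linear environment is given by its
  graph, which avoids an inverse of \<open>f\<close>.\<close>

lemma has_type_ren:
  assumes "has_type \<Gamma> \<Delta> M \<tau>"
    and "\<And>k \<sigma>. \<Gamma> k = Some \<sigma> \<Longrightarrow> \<Gamma>' (f k) = Some \<sigma>"
    and "\<And>k. k \<in> dom \<Delta> \<Longrightarrow> \<Gamma>' (f k) = None"
    and "inj_on f (dom \<Delta>)"
    and "\<And>v \<sigma>. \<Delta>' v = Some \<sigma> \<longleftrightarrow> (\<exists>k. f k = v \<and> \<Delta> k = Some \<sigma>)"
  shows "has_type \<Gamma>' \<Delta>' (ren f M) \<tau>"
  using assms
proof (induction arbitrary: f \<Gamma>' \<Delta>' rule: has_type.induct)
  case (T_varB \<Gamma> k \<sigma>)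
  have "\<Delta>' = Map.empty" by (rule map_eq_SomeI) (simp add: T_varB)
  with T_varB show ?case by (simp add: has_type.T_varB)
next
  case (T_var \<Gamma> k \<sigma>)
  have "\<Delta>' = [f k \<mapsto> \<sigma>]" by (rule map_eq_SomeI) (auto simp: T_var split: if_splits)
  moreover have "\<Gamma>' (f k) = None" using T_var.prems(2)[of k] by (simp add: dom_def)
  ultimately show ?case by (simp only: ren.simps has_type.T_var)
next
  case (T_Lam \<Gamma> \<sigma> \<Delta> M \<tau>)
  have "has_type (case_nat None \<Gamma>') (case_nat (Some \<sigma>) \<Delta>') (ren (upr f) M) \<tau>"
  proof (rule T_Lam.IH)
    show "inj_on (upr f) (dom (case_nat (Some \<sigma>) \<Delta>))"
      using T_Lam.prems(3) by (fastforce simp: inj_on_def split: nat.splits)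
  next
    fix k show "k \<in> dom (case_nat (Some \<sigma>) \<Delta>) \<Longrightarrow> case_nat None \<Gamma>' (upr f k) = None"
      using T_Lam.prems(2) by (simp add: dom_def split: nat.splits)
  next
    fix v \<rho>
    show "case_nat (Some \<sigma>) \<Delta>' v = Some \<rho> \<longleftrightarrow> (\<exists>k. upr f k = v \<and> case_nat (Some \<sigma>) \<Delta> k = Some \<rho>)"
      (is "_ = ?r")
    proof -
      have "?r \<longleftrightarrow> (v = 0 \<and> \<sigma> = \<rho>) \<or> (\<exists>k. Suc (f k) = v \<and> \<Delta> k = Some \<rho>)"
        by (rule iffI) (elim exE, rename_tac k, case_tac k, auto intro: exI[of _ 0] exI[of _ "Suc _"])
      then show ?thesis using T_Lam.prems(4) by (cases v) auto
    qed
  qed (use T_Lam.prems(1) in \<open>auto split: nat.splits\<close>)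
  then show ?case by (simp add: has_type.T_Lam)
next
  case (T_LamB \<sigma> \<Gamma> \<Delta> M \<tau>)
  have "has_type (case_nat (Some \<sigma>) \<Gamma>') (case_nat None \<Delta>') (ren (upr f) M) \<tau>"
  proof (rule T_LamB.IH)
    show "inj_on (upr f) (dom (case_nat None \<Delta>))"
      using T_LamB.prems(3) by (fastforce simp: inj_on_def split: nat.splits)
  next
    fix k show "k \<in> dom (case_nat None \<Delta>) \<Longrightarrow> case_nat (Some \<sigma>) \<Gamma>' (upr f k) = None"
      using T_LamB.prems(2) by (simp add: dom_def split: nat.splits)
  next
    fix v \<rho>
    show "case_nat None \<Delta>' v = Some \<rho> \<longleftrightarrow> (\<exists>k. upr f k = v \<and> case_nat None \<Delta> k = Some \<rho>)"
      (is "_ = ?r")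
    proof -
      have "?r \<longleftrightarrow> (\<exists>k. Suc (f k) = v \<and> \<Delta> k = Some \<rho>)"
        by (rule iffI) (elim exE, rename_tac k, case_tac k, auto intro: exI[of _ "Suc _"])
      then show ?thesis using T_LamB.prems(4) by (cases v) auto
    qed
  qed (use T_LamB.prems(1) in \<open>auto split: nat.splits\<close>)
  then show ?case by (simp add: has_type.T_LamB)
next
  case (T_App \<Gamma> \<Delta> M \<sigma> \<tau> \<Theta> N)
  note add = map_add_Some_disjoint[OF T_App.hyps(3)]
  \<comment> \<open>The renamed environment splits along the images of the two parts; injectivity
    makes these images disjoint.\<close>
  define D1 where "D1 = \<Delta>' |` (f ` dom \<Delta>)"
  define D2 where "D2 = \<Delta>' |` (f ` dom \<Theta>)"
  have inj: "f k = f l \<Longrightarrow> k \<in> dom \<Delta> \<union> dom \<Theta> \<Longrightarrow> l \<in> dom \<Delta> \<union> dom \<Theta> \<Longrightarrow> k = l" for k l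
    using T_App.prems(3) by (auto simp: inj_on_def)
  have d1: "D1 v = Some \<rho> \<longleftrightarrow> (\<exists>k. f k = v \<and> \<Delta> k = Some \<rho>)" for v \<rho>
  proof
    assume "D1 v = Some \<rho>"
    then obtain k where k: "k \<in> dom \<Delta>" "f k = v" and "\<Delta>' v = Some \<rho>"
      unfolding D1_def restrict_map_def by (metis image_iff option.distinct(1))
    from T_App.prems(4)[THEN iffD1, OF this(3)]
    obtain l where "f l = v" "(\<Delta> ++ \<Theta>) l = Some \<rho>" by (elim exE conjE)
    then have l: "f l = v" "\<Delta> l = Some \<rho> \<or> \<Theta> l = Some \<rho>" by (simp_all only: add)
    then have "k = l" using k by - (rule inj, auto)
    with k(1) l T_App.hyps(3) show "\<exists>k. f k = v \<and> \<Delta> k = Some \<rho>" by blast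
  next
    assume "\<exists>k. f k = v \<and> \<Delta> k = Some \<rho>"
    then show "D1 v = Some \<rho>"
      unfolding D1_def by (auto simp: restrict_map_def T_App.prems(4) add)
  qed
  have d2: "D2 v = Some \<rho> \<longleftrightarrow> (\<exists>k. f k = v \<and> \<Theta> k = Some \<rho>)" for v \<rho>
  proof
    assume "D2 v = Some \<rho>"
    then obtain k where k: "k \<in> dom \<Theta>" "f k = v" and "\<Delta>' v = Some \<rho>"
      unfolding D2_def restrict_map_def by (metis image_iff option.distinct(1))
    from T_App.prems(4)[THEN iffD1, OF this(3)]
    obtain l where "f l = v" "(\<Delta> ++ \<Theta>) l = Some \<rho>" by (elim exE conjE)
    then have l: "f l = v" "\<Delta> l = Some \<rho> \<or> \<Theta> l = Some \<rho>" by (simp_all only: add)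
    then have "k = l" using k by - (rule inj, auto)
    with k(1) l T_App.hyps(3) show "\<exists>k. f k = v \<and> \<Theta> k = Some \<rho>" by blast
  next
    assume "\<exists>k. f k = v \<and> \<Theta> k = Some \<rho>"
    then show "D2 v = Some \<rho>"
      unfolding D2_def by (auto simp: restrict_map_def T_App.prems(4) add)
  qed
  have disj: "dom D1 \<inter> dom D2 = {}"
  proof (rule equals0I)
    fix v assume "v \<in> dom D1 \<inter> dom D2"
    then obtain \<rho> \<rho>' where "D1 v = Some \<rho>" "D2 v = Some \<rho>'" by blast
    then obtain k l where kl: "k \<in> dom \<Delta>" "l \<in> dom \<Theta>" "f k = f l"
      unfolding d1 d2 by (metis domI)
    then have "k = l" by - (rule inj, auto)
    with kl T_App.hyps(3) show False by blast
  qed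
  have "\<Delta>' = D1 ++ D2"
    by (rule map_eq_SomeI) (auto simp: map_add_Some_disjoint[OF disj] d1 d2 T_App.prems(4) add)
  moreover have "has_type \<Gamma>' D1 (ren f M) (\<sigma> \<multimap> \<tau>)"
    by (rule T_App.IH(1)) (use T_App.prems in \<open>auto simp: d1 add intro: inj_on_subset\<close>)
  moreover have "has_type \<Gamma>' D2 (ren f N) \<sigma>"
    by (rule T_App.IH(2)) (use T_App.prems in \<open>auto simp: d2 add intro: inj_on_subset\<close>)
  ultimately show ?case using disj by (simp add: has_type.T_App)
next
  case (T_Bang \<Gamma> M \<sigma>)
  have "\<Delta>' = Map.empty" by (rule map_eq_SomeI) (simp add: T_Bang)
  with T_Bang show ?case by (simp add: has_type.T_Bang)
next
  case (T_Choice \<Gamma> \<Delta> M \<sigma> N)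
  then show ?case by (simp add: has_type.T_Choice)
qed

section \<open>Typed substitution for linear and nonlinear variables\<close>

lemma has_type_ren_Suc:
  assumes "has_type \<Gamma> \<Delta> M \<tau>"
  shows "has_type (case_nat x \<Gamma>) (case_nat None \<Delta>) (ren Suc M) \<tau>"
  by (rule has_type_ren[OF assms])
     (use has_type_disjoint[OF assms] in \<open>auto split: nat.splits\<close>)

text \<open>\<open>L k\<close> is the linear environment spent by the term put for the linear
  variable \<open>k\<close>. These environments are disjoint and together make up
  \<open>\<Delta>'\<close>; a term put for a nonlinear variable may be copied and so spends nothing.
  With empty \<open>L\<close> the lemma closes a term by a tuple, with other choices it types the
  beta reducts.\<close>

lemma has_type_subst:
  assumes "has_type \<Gamma> \<Delta> M \<tau>"
    and "\<And>k \<sigma>. \<Gamma> k = Some \<sigma> \<Longrightarrow> has_type \<Gamma>' Map.empty (s k) \<sigma>"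
    and "\<And>k \<sigma>. \<Delta> k = Some \<sigma> \<Longrightarrow> has_type \<Gamma>' (L k) (s k) \<sigma>"
    and "\<And>k l. k \<in> dom \<Delta> \<Longrightarrow> l \<in> dom \<Delta> \<Longrightarrow> k \<noteq> l \<Longrightarrow> dom (L k) \<inter> dom (L l) = {}"
    and "\<And>v \<sigma>. \<Delta>' v = Some \<sigma> \<longleftrightarrow> (\<exists>k\<in>dom \<Delta>. L k v = Some \<sigma>)"
  shows "has_type \<Gamma>' \<Delta>' (subst s M) \<tau>"
  using assms
proof (induction arbitrary: s L \<Gamma>' \<Delta>' rule: has_type.induct)
  case (T_varB \<Gamma> k \<sigma>)
  have "\<Delta>' = Map.empty" by (rule map_eq_SomeI) (simp add: T_varB)
  with T_varB show ?case by simp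
next
  case (T_var \<Gamma> k \<sigma>)
  have "\<Delta>' = L k" by (rule map_eq_SomeI) (auto simp: T_var split: if_splits)
  with T_var show ?case by simp
next
  case (T_Lam \<Gamma> \<sigma> \<Delta> M \<tau>)
  \<comment> \<open>The bound variable is replaced by itself and spends itself; the environments of
    the others are shifted past it.\<close>
  define L' where "L' = case_nat [0 \<mapsto> \<sigma>] (\<lambda>k. case_nat None (L k))"
  have "has_type (case_nat None \<Gamma>') (case_nat (Some \<sigma>) \<Delta>') (subst (up s) M) \<tau>"
  proof (rule T_Lam.IH[where L = L'])
    fix k \<rho> assume "case_nat None \<Gamma> k = Some \<rho>"
    then obtain l where "k = Suc l" "\<Gamma> l = Some \<rho>" by (cases k) auto
    then show "has_type (case_nat None \<Gamma>') Map.empty (up s k) \<rho>"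
      using has_type_ren_Suc[OF T_Lam.prems(1), of l \<rho> None]
      by (simp add: up_def case_nat_const)
  next
    fix k \<rho> assume "case_nat (Some \<sigma>) \<Delta> k = Some \<rho>"
    then show "has_type (case_nat None \<Gamma>') (L' k) (up s k) \<rho>"
      using has_type_ren_Suc[OF T_Lam.prems(2), of _ \<rho> None]
      by (cases k) (auto simp: up_def L'_def intro: has_type.T_var)
  next
    fix k l assume *: "k \<in> dom (case_nat (Some \<sigma>) \<Delta>)" "l \<in> dom (case_nat (Some \<sigma>) \<Delta>)" "k \<noteq> l"
    show "dom (L' k) \<inter> dom (L' l) = {}"
    proof (cases "k = 0 \<or> l = 0")
      case True
      then show ?thesis using *(3) by (auto simp: L'_def split: nat.splits if_splits)
    next
      case False
      then obtain k' l' where "k = Suc k'" "l = Suc l'" by (metis not0_implies_Suc)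
      moreover from this * have "dom (L k') \<inter> dom (L l') = {}" by (intro T_Lam.prems(3)) auto
      ultimately show ?thesis by (auto simp: L'_def dom_def disjoint_iff split: nat.splits)
    qed
  next
    fix v \<rho>
    have "(\<exists>k\<in>dom (case_nat (Some \<sigma>) \<Delta>). L' k v = Some \<rho>) \<longleftrightarrow>
      (v = 0 \<and> \<sigma> = \<rho>) \<or> (\<exists>k\<in>dom \<Delta>. \<exists>u. v = Suc u \<and> L k u = Some \<rho>)"
      (is "?l = ?r")
    proof
      assume ?l
      then show ?r by (elim bexE, rename_tac k, case_tac k) (auto simp: L'_def split: nat.splits if_splits)
    next
      assume ?r
      then show ?l
      proof
        assume "v = 0 \<and> \<sigma> = \<rho>"
        then show ?l by (intro bexI[of _ 0]) (auto simp: L'_def)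
      next
        assume "\<exists>k\<in>dom \<Delta>. \<exists>u. v = Suc u \<and> L k u = Some \<rho>"
        then obtain k u where "k \<in> dom \<Delta>" "v = Suc u" "L k u = Some \<rho>" by blast
        then show ?l by (intro bexI[of _ "Suc k"]) (auto simp: L'_def)
      qed
    qed
    then show "case_nat (Some \<sigma>) \<Delta>' v = Some \<rho> \<longleftrightarrow> (\<exists>k\<in>dom (case_nat (Some \<sigma>) \<Delta>). L' k v = Some \<rho>)"
      using T_Lam.prems(4) by (cases v) auto
  qed
  then show ?case by (simp add: has_type.T_Lam)
next
  case (T_LamB \<sigma> \<Gamma> \<Delta> M \<tau>)
  \<comment> \<open>The bound variable is nonlinear here, so index 0 carries no linear
    resource.\<close>
  define L' where "L' = case_nat Map.empty (\<lambda>k. case_nat None (L k))"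
  have "has_type (case_nat (Some \<sigma>) \<Gamma>') (case_nat None \<Delta>') (subst (up s) M) \<tau>"
  proof (rule T_LamB.IH[where L = L'])
    fix k \<rho> assume *: "case_nat (Some \<sigma>) \<Gamma> k = Some \<rho>"
    show "has_type (case_nat (Some \<sigma>) \<Gamma>') Map.empty (up s k) \<rho>"
    proof (cases k)
      case 0
      then show ?thesis using * by (auto simp: up_def intro: has_type.T_varB)
    next
      case (Suc l)
      then show ?thesis using * has_type_ren_Suc[OF T_LamB.prems(1), of l \<rho> "Some \<sigma>"]
        by (simp add: up_def case_nat_const)
    qed
  next
    fix k \<rho> assume "case_nat None \<Delta> k = Some \<rho>"
    then show "has_type (case_nat (Some \<sigma>) \<Gamma>') (L' k) (up s k) \<rho>"
      using has_type_ren_Suc[OF T_LamB.prems(2), of _ \<rho> "Some \<sigma>"]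
      by (cases k) (auto simp: up_def L'_def)
  next
    fix k l assume *: "k \<in> dom (case_nat None \<Delta>)" "l \<in> dom (case_nat None \<Delta>)" "k \<noteq> l"
    then obtain k' l' where "k = Suc k'" "l = Suc l'" by (cases k; cases l) auto
    moreover from this * have "dom (L k') \<inter> dom (L l') = {}" by (intro T_LamB.prems(3)) auto
    ultimately show "dom (L' k) \<inter> dom (L' l) = {}" by (auto simp: L'_def dom_def disjoint_iff split: nat.splits)
  next
    fix v \<rho>
    have "(\<exists>k\<in>dom (case_nat None \<Delta>). L' k v = Some \<rho>) \<longleftrightarrow>
      (\<exists>k\<in>dom \<Delta>. \<exists>u. v = Suc u \<and> L k u = Some \<rho>)"
      (is "?l = ?r")
    proof
      assume ?l
      then show ?r by (elim bexE, rename_tac k, case_tac k) (auto simp: L'_def split: nat.splits if_splits)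
    next
      assume ?r
      then obtain k u where "k \<in> dom \<Delta>" "v = Suc u" "L k u = Some \<rho>" by blast
      then show ?l by (intro bexI[of _ "Suc k"]) (auto simp: L'_def)
    qed
    then show "case_nat None \<Delta>' v = Some \<rho> \<longleftrightarrow> (\<exists>k\<in>dom (case_nat None \<Delta>). L' k v = Some \<rho>)"
      using T_LamB.prems(4) by (cases v) auto
  qed
  then show ?case by (simp add: has_type.T_LamB)
next
  case (T_App \<Gamma> \<Delta> M \<sigma> \<tau> \<Theta> N)
  note add = map_add_Some_disjoint[OF T_App.hyps(3)]
  \<comment> \<open>The part of \<open>\<Delta>'\<close> spent by the variables of the function.
    Disjointness of the \<open>L k\<close> separates it from the part spent by the argument.\<close>
  define D1 where "D1 = (\<lambda>v. if \<exists>k\<in>dom \<Delta>. v \<in> dom (L k) then \<Delta>' v else None)"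
  define D2 where "D2 = (\<lambda>v. if \<exists>k\<in>dom \<Theta>. v \<in> dom (L k) then \<Delta>' v else None)"
  have inj: "L k v = Some \<rho> \<Longrightarrow> L l v = Some \<rho>' \<Longrightarrow> k \<in> dom \<Delta> \<union> dom \<Theta> \<Longrightarrow> l \<in> dom \<Delta> \<union> dom \<Theta> \<Longrightarrow> k = l"
    for k l v \<rho> \<rho>'
    using T_App.prems(3)[of k l] by (auto simp: dom_def)
  have d1: "D1 v = Some \<rho> \<longleftrightarrow> (\<exists>k\<in>dom \<Delta>. L k v = Some \<rho>)" for v \<rho>
  proof
    assume "D1 v = Some \<rho>"
    then obtain k \<rho>' where k: "k \<in> dom \<Delta>" "L k v = Some \<rho>'" and "\<Delta>' v = Some \<rho>"
      unfolding D1_def by (metis domD option.distinct(1))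
    then obtain l where "l \<in> dom \<Delta> \<union> dom \<Theta>" "L l v = Some \<rho>"
      unfolding T_App.prems(4) by auto
    with k show "\<exists>k\<in>dom \<Delta>. L k v = Some \<rho>" using inj[of k v \<rho>' l \<rho>] by auto
  next
    assume "\<exists>k\<in>dom \<Delta>. L k v = Some \<rho>"
    then show "D1 v = Some \<rho>"
      unfolding D1_def by (auto simp: T_App.prems(4))
  qed
  have d2: "D2 v = Some \<rho> \<longleftrightarrow> (\<exists>k\<in>dom \<Theta>. L k v = Some \<rho>)" for v \<rho>
  proof
    assume "D2 v = Some \<rho>"
    then obtain k \<rho>' where k: "k \<in> dom \<Theta>" "L k v = Some \<rho>'" and "\<Delta>' v = Some \<rho>"
      unfolding D2_def by (metis domD option.distinct(1))
    then obtain l where "l \<in> dom \<Delta> \<union> dom \<Theta>" "L l v = Some \<rho>"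
      unfolding T_App.prems(4) by auto
    with k show "\<exists>k\<in>dom \<Theta>. L k v = Some \<rho>" using inj[of k v \<rho>' l \<rho>] by auto
  next
    assume "\<exists>k\<in>dom \<Theta>. L k v = Some \<rho>"
    then show "D2 v = Some \<rho>"
      unfolding D2_def by (auto simp: T_App.prems(4))
  qed
  have disj: "dom D1 \<inter> dom D2 = {}"
  proof (rule equals0I)
    fix v assume "v \<in> dom D1 \<inter> dom D2"
    then obtain \<rho> \<rho>' where "D1 v = Some \<rho>" "D2 v = Some \<rho>'" by blast
    then obtain k l where "k \<in> dom \<Delta>" "l \<in> dom \<Theta>" "L k v = Some \<rho>" "L l v = Some \<rho>'"
      unfolding d1 d2 by blast
    moreover from this have "k = l" by - (rule inj, auto)
    ultimately show False using T_App.hyps(3) by blast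
  qed
  have "\<Delta>' = D1 ++ D2"
    by (rule map_eq_SomeI) (auto simp: map_add_Some_disjoint[OF disj] d1 d2 T_App.prems(4))
  moreover have "has_type \<Gamma>' D1 (subst s M) (\<sigma> \<multimap> \<tau>)"
    by (rule T_App.IH(1)[where L = L]) (use T_App.prems in \<open>auto simp: d1 add\<close>)
  moreover have "has_type \<Gamma>' D2 (subst s N) \<sigma>"
    by (rule T_App.IH(2)[where L = L]) (use T_App.prems in \<open>auto simp: d2 add\<close>)
  ultimately show ?case using disj by (simp add: has_type.T_App)
next
  case (T_Bang \<Gamma> M \<sigma>)
  have "\<Delta>' = Map.empty" by (rule map_eq_SomeI) (simp add: T_Bang)
  with T_Bang show ?case by (simp add: has_type.T_Bang)
next
  case (T_Choice \<Gamma> \<Delta> M \<sigma> N)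
  have "has_type \<Gamma>' \<Delta>' (subst s M) \<sigma>" "has_type \<Gamma>' \<Delta>' (subst s N) \<sigma>"
    by (rule T_Choice.IH[where L = L]; use T_Choice.prems in auto)+
  then show ?case by (simp add: has_type.T_Choice)
qed

text \<open>A typed term mentions declared variables only. This lets a tuple and the interpretation
  of variables change together, as long as the surviving variables keep their meaning.\<close>

lemma subst_cong_typed:
  assumes "has_type \<Gamma> \<Delta> M \<tau>"
    and "\<And>k. k \<in> dom \<Gamma> \<Longrightarrow> s k = t k" and "\<And>k. k \<in> dom \<Delta> \<Longrightarrow> s k = t k"
  shows "subst s M = subst t M"
  using assms
proof (induction arbitrary: s t rule: has_type.induct)
  case (T_Lam \<Gamma> \<sigma> \<Delta> M \<tau>)
  have "subst (up s) M = subst (up t) M"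
    by (rule T_Lam.IH) (use T_Lam.prems in \<open>simp_all add: up_def dom_def split: nat.splits\<close>)
  then show ?case by simp
next
  case (T_LamB \<sigma> \<Gamma> \<Delta> M \<tau>)
  have "subst (up s) M = subst (up t) M"
    by (rule T_LamB.IH) (use T_LamB.prems in \<open>simp_all add: up_def dom_def split: nat.splits\<close>)
  then show ?case by simp
next
  case (T_App \<Gamma> \<Delta> M \<sigma> \<tau> \<Theta> N)
  have "subst s M = subst t M" by (rule T_App.IH) (use T_App.prems in simp_all)
  moreover have "subst s N = subst t N" by (rule T_App.IH) (use T_App.prems in simp_all)
  ultimately show ?case by simp
next
  case (T_Choice \<Gamma> \<Delta> M \<sigma> N)
  have "subst s M = subst t M" by (rule T_Choice.IH) (use T_Choice.prems in simp_all)
  moreover have "subst s N = subst t N" by (rule T_Choice.IH) (use T_Choice.prems in simp_all)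
  ultimately show ?case by simp
next
  case (T_Bang \<Gamma> M \<sigma>)
  have "subst s M = subst t M" by (rule T_Bang.IH) (use T_Bang.prems in simp_all)
  then show ?case by simp
qed (simp_all add: dom_def)

lemma has_type_subst0_linear:
  assumes P: "has_type (case_nat None \<Gamma>) (case_nat (Some \<sigma>) \<Delta>) P \<tau>"
    and V: "has_type \<Gamma> \<Theta> V \<sigma>" and disj: "dom \<Delta> \<inter> dom \<Theta> = {}"
  shows "has_type \<Gamma> (\<Delta> ++ \<Theta>) (subst0 P V) \<tau>"
  unfolding subst0_def
\<comment> \<open>Index 0 spends what \<open>V\<close> spends; every other variable moves down by
  one and spends itself.\<close>
proof (rule has_type_subst[OF P, where L = "case_nat \<Theta> (\<lambda>k. [k \<mapsto> the (\<Delta> k)])"])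
  fix k \<rho> assume *: "case_nat (Some \<sigma>) \<Delta> k = Some \<rho>"
  show "has_type \<Gamma> (case_nat \<Theta> (\<lambda>k. [k \<mapsto> the (\<Delta> k)]) k) (case_nat V Var k) \<rho>"
  proof (cases k)
    case 0 then show ?thesis using V * by auto
  next
    case (Suc l)
    then have "Suc l \<notin> dom (case_nat None \<Gamma>)" using has_type_disjoint[OF P] * by blast
    then have "\<Gamma> l = None" by (simp add: dom_def)
    with Suc * show ?thesis by (auto intro: T_var)
  qed
next
  fix v \<rho>
  have "(\<exists>k\<in>dom (case_nat (Some \<sigma>) \<Delta>). case_nat \<Theta> (\<lambda>k. [k \<mapsto> the (\<Delta> k)]) k v = Some \<rho>) \<longleftrightarrow>
     \<Theta> v = Some \<rho> \<or> \<Delta> v = Some \<rho>" (is "?l = ?r")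
  proof
    assume ?l
    then show ?r by (elim bexE, rename_tac k, case_tac k) (auto split: if_splits)
  next
    assume ?r
    then show ?l
      by (auto intro: bexI[of _ 0] bexI[of _ "Suc v"])
  qed
  then show "(\<Delta> ++ \<Theta>) v = Some \<rho> \<longleftrightarrow>
    (\<exists>k\<in>dom (case_nat (Some \<sigma>) \<Delta>). case_nat \<Theta> (\<lambda>k. [k \<mapsto> the (\<Delta> k)]) k v = Some \<rho>)"
    by (auto simp: map_add_Some_disjoint[OF disj])
qed (use disj in \<open>auto simp: dom_def disjoint_iff split: nat.splits intro: T_varB\<close>)

lemma has_type_subst0_exponential:
  assumes P: "has_type (case_nat (Some \<sigma>) \<Gamma>) (case_nat None \<Delta>) P \<tau>"
    and N: "has_type \<Gamma> Map.empty N \<sigma>"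
  shows "has_type \<Gamma> \<Delta> (subst0 P N) \<tau>"
  unfolding subst0_def
\<comment> \<open>Surviving variables move down by one. At index 0 the subtraction is truncated,
  which is harmless because that index is nonlinear and outside the linear domain.\<close>
proof (rule has_type_subst[OF P, where L = "\<lambda>k. [k - 1 \<mapsto> the (\<Delta> (k - 1))]"])
  fix k \<rho> assume *: "case_nat None \<Delta> k = Some \<rho>"
  then obtain l where l: "k = Suc l" "\<Delta> l = Some \<rho>" by (cases k) auto
  then have "Suc l \<notin> dom (case_nat (Some \<sigma>) \<Gamma>)" using has_type_disjoint[OF P] * by blast
  then have "\<Gamma> l = None" by (simp add: dom_def)
  with l show "has_type \<Gamma> [k - 1 \<mapsto> the (\<Delta> (k - 1))] (case_nat N Var k) \<rho>"
    by (auto intro: T_var)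
next
  fix v \<rho>
  show "\<Delta> v = Some \<rho> \<longleftrightarrow> (\<exists>k\<in>dom (case_nat None \<Delta>). [k - 1 \<mapsto> the (\<Delta> (k - 1))] v = Some \<rho>)"
    (is "?l = ?r")
  proof
    assume ?l
    then show ?r by (auto intro: bexI[of _ "Suc v"])
  next
    assume ?r
    then show ?l by (elim bexE, rename_tac k, case_tac k) (auto split: if_splits)
  qed
qed (use N in \<open>auto split: nat.splits if_splits intro: T_varB\<close>)

section \<open>Preservation of types under reduction and evaluation\<close>

inductive_cases has_type_VarE: "has_type \<Gamma> \<Delta> (Var k) \<tau>"
inductive_cases has_type_AppE: "has_type \<Gamma> \<Delta> (App M N) \<tau>"
inductive_cases has_type_LamE: "has_type \<Gamma> \<Delta> (Lam M) \<tau>"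
inductive_cases has_type_LamBE: "has_type \<Gamma> \<Delta> (LamB M) \<tau>"
inductive_cases has_type_BangE: "has_type \<Gamma> \<Delta> (Bang M) \<tau>"
inductive_cases has_type_ChoiceE: "has_type \<Gamma> \<Delta> (M \<oplus> N) \<tau>"

text \<open>Open terms are included because steps of the context are typed before the tuple is
  filled in. Injectivity of the type constructors matches the type of the abstraction with that of
  its argument; the substitution lemmas do the rest.\<close>

lemma subject_reduction:
  "step M Ns \<Longrightarrow> has_type \<Gamma> \<Delta> M \<tau> \<Longrightarrow> N \<in> set Ns \<Longrightarrow> has_type \<Gamma> \<Delta> N \<tau>"
proof (induction arbitrary: \<Delta> \<tau> N rule: step.induct)
  case (step_choice M N)
  then show ?case by (auto elim: has_type_ChoiceE)
next
  case (step_beta V M)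
  then show ?case
    by (auto elim!: has_type_AppE has_type_LamE simp: Arr_inject intro: has_type_subst0_linear)
next
  case (step_betaB M N)
  then show ?case
    by (auto elim!: has_type_AppE has_type_LamBE has_type_BangE simp: Arr_inject Exp_inject
        intro: has_type_subst0_exponential)
next
  case (step_fun M Ms V)
  from step_fun.prems(1) obtain D T \<sigma> where "\<Delta> = D ++ T" "has_type \<Gamma> D M (\<sigma> \<multimap> \<tau>)"
    "has_type \<Gamma> T V \<sigma>" "dom D \<inter> dom T = {}" by (rule has_type_AppE)
  with step_fun.prems(2) step_fun.IH show ?case by (auto intro!: T_App)
next
  case (step_arg N0 Ns M)
  from step_arg.prems(1) obtain D T \<sigma> where "\<Delta> = D ++ T" "has_type \<Gamma> D M (\<sigma> \<multimap> \<tau>)"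
    "has_type \<Gamma> T N0 \<sigma>" "dom D \<inter> dom T = {}" by (rule has_type_AppE)
  with step_arg.prems(2) step_arg.IH show ?case by (auto intro!: T_App)
qed

lemma evl_typed:
  "\<turnstile> M : \<tau> \<Longrightarrow> V \<in> set_spmf (evl n M) \<Longrightarrow> \<turnstile> V : \<tau> \<and> is_val V"
proof (induction n arbitrary: M)
  case (Suc n)
  show ?case
  proof (cases "\<exists>Ns. step M Ns")
    case True
    then obtain Ns where s: "step M Ns" ..
    from Suc.prems(2) step_nonempty[OF s] obtain i where "i < length Ns" "V \<in> set_spmf (evl n (Ns ! i))"
      unfolding evl_step[OF s] by (auto simp: set_spmf_bind_pmf lessThan_empty_iff)
    with Suc.IH[of "Ns ! i"] subject_reduction[OF s Suc.prems(1), of "Ns ! i"] show ?thesis by simp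
  next
    case False
    with Suc.prems show ?thesis by (auto split: if_splits)
  qed
qed simp

lemma set_spmf_sem: "set_spmf (sem M) = (\<Union>n. set_spmf (evl n M))"
  unfolding sem_evl by (subst set_lub_spmf[OF evl_chain]) simp

lemma sem_typed: "\<turnstile> M : \<tau> \<Longrightarrow> V \<in> set_spmf (sem M) \<Longrightarrow> \<turnstile> V : \<tau> \<and> is_val V"
  by (auto simp: set_spmf_sem dest: evl_typed)

section \<open>Evaluation in contexts\<close>

datatype ectx = Hole | AppL ectx tm | AppR tm ectx

primrec plug :: "ectx \<Rightarrow> tm \<Rightarrow> tm" where
  "plug Hole M = M"
| "plug (AppL E V) M = App (plug E M) V"
| "plug (AppR L E) M = App L (plug E M)"

text \<open>Evaluation contexts bind no variables, so substitution enters them without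
  shifting.\<close>

primrec esubst :: "(nat \<Rightarrow> tm) \<Rightarrow> ectx \<Rightarrow> ectx" where
  "esubst s Hole = Hole"
| "esubst s (AppL E V) = AppL (esubst s E) (subst s V)"
| "esubst s (AppR L E) = AppR (subst s L) (esubst s E)"

lemma subst_plug: "subst s (plug E M) = plug (esubst s E) (subst s M)"
  by (induction E) auto

primrec eval_ctx :: "ectx \<Rightarrow> bool" where
  "eval_ctx Hole \<longleftrightarrow> True"
| "eval_ctx (AppL E V) \<longleftrightarrow> eval_ctx E \<and> is_val V"
| "eval_ctx (AppR L E) \<longleftrightarrow> eval_ctx E"

lemma step_plug: "eval_ctx E \<Longrightarrow> step M Ms \<Longrightarrow> step (plug E M) (map (plug E) Ms)"
proof (induction E)
  case (AppL E V)
  then show ?case using step_fun[of "plug E M" "map (plug E) Ms" V] by (simp add: comp_def)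
next
  case (AppR L E)
  then show ?case using step_arg[of "plug E M" "map (plug E) Ms" L] by (simp add: comp_def)
qed (simp add: map_idI)

lemma plug_not_val: "\<not> is_val M \<Longrightarrow> \<not> is_val (plug E M)"
  by (induction E) auto

text \<open>As long as the hole does not hold a value, no rule can act outside it. A stuck term thus
  blocks the whole.\<close>

lemma step_plugD:
  "eval_ctx E \<Longrightarrow> step (plug E M) Ns \<Longrightarrow> \<not> is_val M \<Longrightarrow> \<exists>Ms. step M Ms"
proof (induction E arbitrary: Ns)
  case (AppL E V)
  from AppL.prems plug_not_val[OF AppL.prems(3), of E] have "\<exists>Ns. step (plug E M) Ns"
    by (auto elim: step.cases dest: step_not_val)
  with AppL show ?case by auto
next
  case (AppR L E)
  from AppR.prems plug_not_val[OF AppR.prems(3), of E] have "\<exists>Ns. step (plug E M) Ns"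
    by (auto elim: step.cases dest: step_not_val)
  with AppR show ?case by auto
qed auto

lemma bind_spmf_bind_pmf: "bind_spmf (bind_pmf p f) g = bind_pmf p (\<lambda>i. bind_spmf (f i) g)"
  by (simp add: bind_spmf_def bind_assoc_pmf)

text \<open>A step in the hole is a step of the whole and both pay one unit for it, so only
  \<open>m\<close> is left for the continuation. Both upper bounds below build on this
  count.\<close>

lemma evl_plug_step:
  assumes "eval_ctx E" "step M Ns"
    and IH: "\<And>N. ord_spmf (=) (evl m (plug E N)) (bind_spmf (evl m N) (\<lambda>V. evl m (plug E V)))"
  shows "ord_spmf (=) (evl (Suc m) (plug E M)) (bind_spmf (evl (Suc m) M) (\<lambda>V. evl m (plug E V)))"
proof -
  have "ord_spmf (=) (bind_pmf (pmf_of_set {..<length Ns}) (\<lambda>i. evl m (plug E (Ns ! i))))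
      (bind_pmf (pmf_of_set {..<length Ns}) (\<lambda>i. bind_spmf (evl m (Ns ! i)) (\<lambda>V. evl m (plug E V))))"
    by (rule mix_mono[OF assms(2)]) (rule IH)
  moreover have "bind_pmf (pmf_of_set {..<length (map (plug E) Ns)}) (\<lambda>i. evl m (map (plug E) Ns ! i)) =
    bind_pmf (pmf_of_set {..<length Ns}) (\<lambda>i. evl m (plug E (Ns ! i)))"
    using step_nonempty[OF assms(2)] by (intro bind_pmf_cong) (auto simp: lessThan_empty_iff)
  ultimately show ?thesis
    unfolding evl_step[OF assms(2)] evl_step[OF step_plug[OF assms(1,2)]] bind_spmf_bind_pmf by simp
qed

lemma evl_stuck: "\<not> is_val M \<Longrightarrow> \<nexists>Ns. step M Ns \<Longrightarrow> evl n M = return_pmf None"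
  by (cases n) auto

text \<open>The hole and the continuation are each granted the entire fuel; this is generous but
  loses nothing in the limit.\<close>

lemma evl_plug_le:
  assumes "eval_ctx E"
  shows "ord_spmf (=) (evl m (plug E M)) (bind_spmf (evl m M) (\<lambda>V. evl m (plug E V)))"
proof (induction m arbitrary: M)
  case (Suc m)
  consider "is_val M" | Ns where "step M Ns" | "\<not> is_val M" "\<nexists>Ns. step M Ns" by blast
  then show ?case
  proof cases
    case 2
    from evl_plug_step[OF assms 2 Suc.IH] show ?thesis
      by (rule spmf.leq_trans) (auto intro!: bind_spmf_mono' evl_mono1 ord_spmf_reflI simp del: evl.simps)
  next
    case 3
    with plug_not_val[OF 3(1), of E] step_plugD[OF assms _ 3(1)] have "evl (Suc m) (plug E M) = return_pmf None"
      by (intro evl_stuck) auto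
    then show ?thesis by simp
  qed simp
qed simp

text \<open>A term that is not a value needs at least one step, which leaves the continuation one
  unit less. This strict decrease drives the induction on fuel when a value of the tuple is
  applied.\<close>

lemma evl_plug_Suc_le:
  assumes "eval_ctx E" "\<not> is_val M"
  shows "ord_spmf (=) (evl (Suc m) (plug E M)) (bind_spmf (evl (Suc m) M) (\<lambda>V. evl m (plug E V)))"
proof (cases "\<exists>Ns. step M Ns")
  case True
  then show ?thesis using evl_plug_step[OF assms(1) _ evl_plug_le[OF assms(1)]] by blast
next
  case False
  with plug_not_val[OF assms(2), of E] step_plugD[OF assms(1) _ assms(2)]
  have "evl (Suc m) (plug E M) = return_pmf None"
    by (intro evl_stuck) auto
  then show ?thesis by simp
qed

text \<open>Fuel adds up in sequential evaluation; this gives the converse inequality in the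
  limit.\<close>

lemma evl_plug_ge:
  assumes "eval_ctx E"
  shows "ord_spmf (=) (bind_spmf (evl m M) (\<lambda>V. evl n (plug E V))) (evl (m + n) (plug E M))"
proof (induction m arbitrary: M)
  case (Suc m)
  consider "is_val M" | Ns where "step M Ns" | "\<not> is_val M" "\<nexists>Ns. step M Ns" by blast
  then show ?case
  proof cases
    case 1
    then show ?thesis using evl_mono[of n "Suc m + n" "plug E M"] by (simp del: evl.simps(2) add: evl.simps(2)[of m M])
  next
    case 2
    have "ord_spmf (=) 
      (bind_pmf (pmf_of_set {..<length Ns}) (\<lambda>i. bind_spmf (evl m (Ns ! i)) (\<lambda>V. evl n (plug E V))))
      (bind_pmf (pmf_of_set {..<length Ns}) (\<lambda>i. evl (m + n) (plug E (Ns ! i))))"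
      by (rule mix_mono[OF 2]) (rule Suc.IH)
    moreover have "bind_pmf (pmf_of_set {..<length (map (plug E) Ns)}) (\<lambda>i. evl (m + n) (map (plug E) Ns ! i)) =
      bind_pmf (pmf_of_set {..<length Ns}) (\<lambda>i. evl (m + n) (plug E (Ns ! i)))"
      using step_nonempty[OF 2] by (intro bind_pmf_cong) (auto simp: lessThan_empty_iff)
    ultimately show ?thesis
      unfolding add_Suc evl_step[OF 2] evl_step[OF step_plug[OF assms 2]] bind_spmf_bind_pmf by simp
  next
    case 3
    then show ?thesis using evl_stuck[OF 3] by simp
  qed
qed simp

section \<open>Observations as limits of truncated weights\<close>

lemma evl_le_sem: "ord_spmf (=) (evl n M) (sem M)"
  unfolding sem_evl by (rule lub_spmf_upper[OF evl_chain]) simp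

lemma ord_spmf_weight: "ord_spmf (=) p q \<Longrightarrow> weight_spmf p \<le> weight_spmf q"
  using ord_spmf_eqD_emeasure[of p q UNIV]
  by (simp add: weight_spmf_def space_measure_spmf measure_spmf.emeasure_eq_measure)

lemma Obs_le_1: "Obs M \<le> 1" and Obs_nonneg: "0 \<le> Obs M"
  by (simp_all add: Obs_def weight_spmf_le_1)

lemma weight_evl_le_Obs: "weight_spmf (evl n M) \<le> Obs M"
  unfolding Obs_def by (rule ord_spmf_weight[OF evl_le_sem])

lemma weight_evl_tendsto_Obs: "(\<lambda>n. weight_spmf (evl n M)) \<longlonglongrightarrow> Obs M"
proof -
  have "Obs M = (SUP n. weight_spmf (evl n M))"
    unfolding Obs_def sem_evl by (subst weight_lub_spmf[OF evl_chain]) (simp_all add: image_comp)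
  moreover have "(\<lambda>n. weight_spmf (evl n M)) \<longlonglongrightarrow> (SUP n. weight_spmf (evl n M))"
    by (rule LIMSEQ_incseq_SUP)
       (auto intro!: bdd_aboveI[of _ 1] incseq_SucI ord_spmf_weight evl_mono1 simp: weight_spmf_le_1 simp del: evl.simps)
  ultimately show ?thesis by simp
qed

lemma weight_mix:
  assumes "n \<noteq> 0"
  shows "weight_spmf (bind_pmf (pmf_of_set {..<n}) f) = (\<Sum>i<n. weight_spmf (f i)) / real n"
  using assms
  by (simp add: weight_spmf_conv_pmf_None pmf_bind integral_pmf_of_set lessThan_empty_iff
      sum_subtractf diff_divide_distrib)

lemma weight_evl_step:
  "step M Ns \<Longrightarrow> weight_spmf (evl (Suc n) M) = (\<Sum>i<length Ns. weight_spmf (evl n (Ns ! i))) / length Ns"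
  using step_nonempty by (simp only: evl_step) (auto simp: weight_mix)

lemma Obs_step:
  assumes "step M Ns"
  shows "Obs M = (\<Sum>i<length Ns. Obs (Ns ! i)) / length Ns"
proof (rule LIMSEQ_unique)
  show "(\<lambda>n. weight_spmf (evl (Suc n) M)) \<longlonglongrightarrow> Obs M"
    using weight_evl_tendsto_Obs by (rule LIMSEQ_Suc)
  show "(\<lambda>n. weight_spmf (evl (Suc n) M)) \<longlonglongrightarrow> (\<Sum>i<length Ns. Obs (Ns ! i)) / length Ns"
    unfolding weight_evl_step[OF assms]
    by (intro tendsto_divide tendsto_sum tendsto_const weight_evl_tendsto_Obs)
       (simp add: step_nonempty[OF assms])
qed

lemma Obs_val: "is_val V \<Longrightarrow> Obs V = 1"
  using weight_evl_le_Obs[of 1 V] Obs_le_1[of V] by simp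

text \<open>\<open>bind_spmf\<close> is continuous in both arguments, so the limits over the fuel of
  the continuation and over that of the hole can be taken one after the other. Every finite stage
  lies below the run with fuel \<open>m + n\<close>.\<close>

lemma bind_sem_plug_le:
  assumes "eval_ctx E"
  shows "ord_spmf (=) (bind_spmf (sem M) (\<lambda>V. sem (plug E V))) (sem (plug E M))"
proof -
  have chain: "Complete_Partial_Order.chain (\<le>) (UNIV :: nat set)"
    by (rule chainI) auto
  have mono: "monotone (\<le>) (ord_spmf (=)) (\<lambda>n. evl n M)" for M
    by (rule monotoneI) (rule evl_mono)
  have inner: "ord_spmf (=) (bind_spmf (evl m M) (\<lambda>V. sem (plug E V))) (sem (plug E M))" for m
  proof -
    have "bind_spmf (evl m M) (\<lambda>V. sem (plug E V)) =
      lub_spmf (range (\<lambda>n. bind_spmf (evl m M) (\<lambda>V. evl n (plug E V))))"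
      unfolding sem_evl by (rule bind_lub_spmf2[OF chain mono])
    also have "ord_spmf (=) \<dots> (sem (plug E M))"
    proof (rule lub_spmf_least)
      show "Complete_Partial_Order.chain (ord_spmf (=)) (range (\<lambda>n. bind_spmf (evl m M) (\<lambda>V. evl n (plug E V))))"
        by (rule chain_imageI[OF chain]) (auto intro!: bind_spmf_mono' evl_mono ord_spmf_reflI)
    next
      fix p assume "p \<in> range (\<lambda>n. bind_spmf (evl m M) (\<lambda>V. evl n (plug E V)))"
      then show "ord_spmf (=) p (sem (plug E M))"
        using spmf.leq_trans[OF evl_plug_ge[OF assms] evl_le_sem] by auto
    qed
    finally show ?thesis .
  qed
  have "bind_spmf (sem M) (\<lambda>V. sem (plug E V)) =
    lub_spmf ((\<lambda>p. bind_spmf p (\<lambda>V. sem (plug E V))) ` range (\<lambda>n. evl n M))"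
    unfolding sem_evl[of M] by (rule bind_lub_spmf[OF evl_chain])
  also have "ord_spmf (=) \<dots> (sem (plug E M))"
  proof (rule lub_spmf_least)
    show "Complete_Partial_Order.chain (ord_spmf (=))
      ((\<lambda>p. bind_spmf p (\<lambda>V. sem (plug E V))) ` range (\<lambda>n. evl n M))"
      by (rule chain_imageI[OF evl_chain]) (auto intro!: bind_spmf_mono' ord_spmf_reflI)
  qed (use inner in auto)
  finally show ?thesis .
qed

lemma integral_Obs_plug_le:
  "eval_ctx E \<Longrightarrow> (\<integral>V. Obs (plug E V) \<partial>measure_spmf (sem M)) \<le> Obs (plug E M)"
  using ord_spmf_weight[OF bind_sem_plug_le] by (simp add: weight_bind_spmf Obs_def o_def)

text \<open>The hole is evaluated to the end, as an action does, while the continuation stays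
  truncated. In this form a truncated run can be compared with an action.\<close>

lemma weight_evl_plug_le:
  assumes "eval_ctx E"
  shows "weight_spmf (evl m (plug E M)) \<le> (\<integral>V. weight_spmf (evl m (plug E V)) \<partial>measure_spmf (sem M))"
proof -
  have "ord_spmf (=) (evl m (plug E M)) (bind_spmf (sem M) (\<lambda>V. evl m (plug E V)))"
    using evl_plug_le[OF assms]
    by (rule spmf.leq_trans) (auto intro!: bind_spmf_mono' evl_le_sem ord_spmf_reflI)
  from ord_spmf_weight[OF this] show ?thesis by (simp add: weight_bind_spmf o_def)
qed

lemma weight_evl_plug_Suc_le:
  assumes "eval_ctx E" "\<not> is_val M"
  shows "weight_spmf (evl (Suc m) (plug E M)) \<le> (\<integral>V. weight_spmf (evl m (plug E V)) \<partial>measure_spmf (sem M))"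
proof -
  have "ord_spmf (=) (evl (Suc m) (plug E M)) (bind_spmf (sem M) (\<lambda>V. evl m (plug E V)))"
    using evl_plug_Suc_le[OF assms]
    by (rule spmf.leq_trans) (auto intro!: bind_spmf_mono' evl_le_sem ord_spmf_reflI simp del: evl.simps)
  from ord_spmf_weight[OF this] show ?thesis by (simp add: weight_bind_spmf o_def)
qed

lemma integrable_bounded_spmf:
  fixes f :: "'a \<Rightarrow> real"
  assumes "\<And>x. 0 \<le> f x" "\<And>x. f x \<le> 1"
  shows "integrable (measure_spmf D) f"
  by (rule measure_spmf.integrable_const_bound[where B = 1]) (auto simp: assms)

text \<open>The equality serves contexts with a linear hole, where the observation of the filled
  context is identified with an expectation over initial tuples.\<close>

lemma Obs_plug:
  assumes "eval_ctx E"
  shows "Obs (plug E M) = (\<integral>V. Obs (plug E V) \<partial>measure_spmf (sem M))"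
proof (rule antisym)
  show "Obs (plug E M) \<le> (\<integral>V. Obs (plug E V) \<partial>measure_spmf (sem M))"
  proof (rule LIMSEQ_le_const2[OF weight_evl_tendsto_Obs], intro exI allI impI)
    fix n
    show "weight_spmf (evl n (plug E M)) \<le> (\<integral>V. Obs (plug E V) \<partial>measure_spmf (sem M))"
      by (rule order.trans[OF weight_evl_plug_le[OF assms]], rule integral_mono)
         (auto intro!: integrable_bounded_spmf simp: weight_spmf_le_1 Obs_nonneg Obs_le_1 weight_evl_le_Obs)
  qed
qed (rule integral_Obs_plug_le[OF assms])

section \<open>Typed evaluation contexts\<close>

inductive ctx_type :: "(nat \<rightharpoonup> ty) \<Rightarrow> (nat \<rightharpoonup> ty) \<Rightarrow> ectx \<Rightarrow> ty \<Rightarrow> ty \<Rightarrow> bool" for \<Gamma> where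
  ctx_Hole: "ctx_type \<Gamma> Map.empty Hole \<sigma> \<sigma>"
| ctx_AppL: "ctx_type \<Gamma> \<Delta> E \<sigma> (\<rho> \<multimap> \<tau>) \<Longrightarrow> has_type \<Gamma> \<Theta> V \<rho> \<Longrightarrow> dom \<Delta> \<inter> dom \<Theta> = {} \<Longrightarrow>
    ctx_type \<Gamma> (\<Delta> ++ \<Theta>) (AppL E V) \<sigma> \<tau>"
| ctx_AppR: "has_type \<Gamma> \<Delta> L (\<rho> \<multimap> \<tau>) \<Longrightarrow> ctx_type \<Gamma> \<Theta> E \<sigma> \<rho> \<Longrightarrow> dom \<Delta> \<inter> dom \<Theta> = {} \<Longrightarrow>
    ctx_type \<Gamma> (\<Delta> ++ \<Theta>) (AppR L E) \<sigma> \<tau>"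

lemma map_add_swap: "dom n \<inter> dom p = {} \<Longrightarrow> m ++ n ++ p = m ++ p ++ n"
  by (metis map_add_assoc map_add_comm)

text \<open>The linear environment of the context leaves out the hole, so the term in the hole can
  be exchanged for its reduct or for a fresh variable.\<close>

lemma has_type_plug:
  "ctx_type \<Gamma> \<Delta> E \<sigma> \<tau> \<Longrightarrow> has_type \<Gamma> \<Theta> M \<sigma> \<Longrightarrow> dom \<Delta> \<inter> dom \<Theta> = {} \<Longrightarrow>
    has_type \<Gamma> (\<Delta> ++ \<Theta>) (plug E M) \<tau>"
proof (induction rule: ctx_type.induct)
  case (ctx_AppL \<Delta> E \<sigma> \<rho> \<tau> \<Theta>' V)
  have "has_type \<Gamma> (\<Delta> ++ \<Theta>) (plug E M) (\<rho> \<multimap> \<tau>)"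
    using ctx_AppL.prems by (intro ctx_AppL.IH) auto
  from T_App[OF this ctx_AppL.hyps(2)] have "has_type \<Gamma> (\<Delta> ++ \<Theta> ++ \<Theta>') (App (plug E M) V) \<tau>"
    using ctx_AppL.hyps(3) ctx_AppL.prems(2) by (simp add: Int_Un_distrib Int_Un_distrib2 Int_commute)
  moreover have "\<Delta> ++ \<Theta> ++ \<Theta>' = \<Delta> ++ \<Theta>' ++ \<Theta>" using ctx_AppL.prems by (intro map_add_swap) auto
  ultimately show ?case by simp
next
  case (ctx_AppR \<Delta> L \<rho> \<tau> \<Theta>' E \<sigma>)
  have "has_type \<Gamma> (\<Theta>' ++ \<Theta>) (plug E M) \<rho>"
    using ctx_AppR.prems by (intro ctx_AppR.IH) auto
  from T_App[OF ctx_AppR.hyps(1) this] have "has_type \<Gamma> (\<Delta> ++ (\<Theta>' ++ \<Theta>)) (App L (plug E M)) \<tau>"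
    using ctx_AppR.hyps(3) ctx_AppR.prems(2) by (simp add: Int_Un_distrib Int_Un_distrib2 Int_commute)
  then show ?case by simp
qed simp

lemma upr_id: "upr (\<lambda>k. k) = (\<lambda>k. k)"
  by (auto split: nat.splits)

lemma ren_id: "ren (\<lambda>k. k) M = M"
  by (induction M) (simp_all add: upr_id)

text \<open>Renaming by the identity already allows a larger nonlinear environment. A query calls
  for this, since it adds a nonlinear variable.\<close>

lemma has_type_weaken:
  assumes "has_type \<Gamma> \<Delta> M \<tau>" "\<Gamma> \<subseteq>\<^sub>m \<Gamma>'" "dom \<Gamma>' \<inter> dom \<Delta> = {}"
  shows "has_type \<Gamma>' \<Delta> M \<tau>"
proof -
  have "has_type \<Gamma>' \<Delta> (ren (\<lambda>k. k) M) \<tau>"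
  proof (rule has_type_ren[OF assms(1)])
    show "\<Gamma>' k = Some \<sigma>" if "\<Gamma> k = Some \<sigma>" for k \<sigma>
      using assms(2) that by (auto simp: map_le_def dom_def)
    show "\<Gamma>' k = None" if "k \<in> dom \<Delta>" for k
      using assms(3) that by blast
  qed auto
  then show ?thesis by (simp add: ren_id)
qed

lemma ctx_type_weaken:
  "ctx_type \<Gamma> \<Delta> E \<sigma> \<tau> \<Longrightarrow> \<Gamma> \<subseteq>\<^sub>m \<Gamma>' \<Longrightarrow> dom \<Gamma>' \<inter> dom \<Delta> = {} \<Longrightarrow> ctx_type \<Gamma>' \<Delta> E \<sigma> \<tau>"
proof (induction rule: ctx_type.induct)
  case (ctx_AppL \<Delta> E \<sigma> \<rho> \<tau> \<Theta> V)
  have "has_type \<Gamma>' \<Theta> V \<rho>"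
    by (rule has_type_weaken[OF ctx_AppL.hyps(2)]) (use ctx_AppL.prems in auto)
  moreover have "ctx_type \<Gamma>' \<Delta> E \<sigma> (\<rho> \<multimap> \<tau>)"
    using ctx_AppL.prems by (intro ctx_AppL.IH) auto
  ultimately show ?case using ctx_AppL.hyps(3) by (blast intro: ctx_type.ctx_AppL)
next
  case (ctx_AppR \<Delta> L \<rho> \<tau> \<Theta> E \<sigma>)
  have "has_type \<Gamma>' \<Delta> L (\<rho> \<multimap> \<tau>)"
    by (rule has_type_weaken[OF ctx_AppR.hyps(1)]) (use ctx_AppR.prems in auto)
  moreover have "ctx_type \<Gamma>' \<Theta> E \<sigma> \<rho>"
    using ctx_AppR.prems by (intro ctx_AppR.IH) auto
  ultimately show ?case using ctx_AppR.hyps(3) by (blast intro: ctx_type.ctx_AppR)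
qed (rule ctx_type.ctx_Hole)

lemma esubst_cong_typed:
  assumes "ctx_type \<Gamma> \<Delta> E \<sigma> \<tau>"
    and "\<And>k. k \<in> dom \<Gamma> \<Longrightarrow> s k = t k" and "\<And>k. k \<in> dom \<Delta> \<Longrightarrow> s k = t k"
  shows "esubst s E = esubst t E"
  using assms
proof (induction rule: ctx_type.induct)
  case (ctx_AppL \<Delta> E \<sigma> \<rho> \<tau> \<Theta> V)
  have "subst s V = subst t V"
    by (rule subst_cong_typed[OF ctx_AppL.hyps(2)]) (use ctx_AppL.prems in simp_all)
  moreover have "esubst s E = esubst t E" using ctx_AppL by simp
  ultimately show ?case by simp
next
  case (ctx_AppR \<Delta> L \<rho> \<tau> \<Theta> E \<sigma>)
  have "subst s L = subst t L"
    by (rule subst_cong_typed[OF ctx_AppR.hyps(1)]) (use ctx_AppR.prems in simp_all)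
  moreover have "esubst s E = esubst t E" using ctx_AppR by simp
  ultimately show ?case by simp
qed simp

text \<open>
  In open terms, the variables outside \<open>G\<close> stand for values, whereas those in \<open>G\<close> stand for terms
  that have yet to be evaluated.
\<close>

definition oval :: "nat set \<Rightarrow> tm \<Rightarrow> bool" where
  "oval G V \<longleftrightarrow> is_val V \<or> (\<exists>k. k \<notin> G \<and> V = Var k)"

primrec oeval_ctx :: "nat set \<Rightarrow> ectx \<Rightarrow> bool" where
  "oeval_ctx G Hole \<longleftrightarrow> True"
| "oeval_ctx G (AppL E V) \<longleftrightarrow> oeval_ctx G E \<and> oval G V"
| "oeval_ctx G (AppR L E) \<longleftrightarrow> oeval_ctx G E"

text \<open>The first three rules are steps the context takes by itself. In a run over tuples the
  last three wait for the tuple: \<open>redex_query\<close> for \<open>AQuery\<close>,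
  \<open>redex_apply\<close> for \<open>AApp\<close>, \<open>redex_var\<close> for
  \<open>ABang\<close>.\<close>

inductive redex :: "nat set \<Rightarrow> tm \<Rightarrow> bool" for G where
  redex_choice: "redex G (M \<oplus> N)"
| redex_beta: "oval G V \<Longrightarrow> redex G (App (Lam P) V)"
| redex_betaB: "redex G (App (LamB P) (Bang N))"
| redex_query: "y \<notin> G \<Longrightarrow> redex G (App (LamB P) (Var y))"
| redex_apply: "y \<notin> G \<Longrightarrow> oval G V \<Longrightarrow> redex G (App (Var y) V)"
| redex_var: "x \<in> G \<Longrightarrow> redex G (Var x)"

lemma is_val_subst: "is_val V \<Longrightarrow> is_val (subst s V)"
  by (cases V) auto

lemma oval_subst:
  assumes "has_type \<Gamma> \<Delta> V \<sigma>" "oval G V" "dom \<Gamma> \<subseteq> G" "\<And>k. k \<in> dom \<Delta> \<Longrightarrow> k \<notin> G \<Longrightarrow> is_val (s k)"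
  shows "is_val (subst s V)"
  using assms(2) unfolding oval_def
proof
  assume "\<exists>k. k \<notin> G \<and> V = Var k"
  then obtain k where k: "k \<notin> G" "V = Var k" by blast
  with assms(1) have "k \<in> dom \<Gamma> \<or> k \<in> dom \<Delta>" by (auto elim: has_type_VarE)
  with k(1) assms(3) have "k \<in> dom \<Delta>" by blast
  with k assms(4) show ?thesis by simp
qed (rule is_val_subst)

lemma eval_ctx_esubst:
  assumes "ctx_type \<Gamma> \<Delta> E \<sigma> \<tau>" "oeval_ctx G E" "dom \<Gamma> \<subseteq> G"
    "\<And>k. k \<in> dom \<Delta> \<Longrightarrow> k \<notin> G \<Longrightarrow> is_val (s k)"
  shows "eval_ctx (esubst s E)"
  using assms
proof (induction rule: ctx_type.induct)
  case (ctx_AppL \<Delta> E \<sigma> \<rho> \<tau> \<Theta> V)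
  have "is_val (subst s V)"
  proof (rule oval_subst[OF ctx_AppL.hyps(2)])
    show "is_val (s k)" if "k \<in> dom \<Theta>" "k \<notin> G" for k
      using ctx_AppL.prems(3)[of k] that by simp
  qed (use ctx_AppL.prems in auto)
  with ctx_AppL show ?case by simp
qed simp_all

text \<open>Progress for open terms. The argument is searched before the function, as in the
  reduction, and distinctness of arrow and bang types excludes the other stuck shapes. The split of
  the linear environment is recorded so that the redex can be replaced later.\<close>

lemma decompose:
  assumes "has_type \<Gamma> \<Delta> C \<tau>"
  shows "oval G C \<or> (\<exists>E r \<Delta>\<^sub>1 \<Delta>\<^sub>2 \<sigma>. C = plug E r \<and> oeval_ctx G E \<and> redex G r \<and> ctx_type \<Gamma> \<Delta>\<^sub>1 E \<sigma> \<tau> \<and>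
    has_type \<Gamma> \<Delta>\<^sub>2 r \<sigma> \<and> dom \<Delta>\<^sub>1 \<inter> dom \<Delta>\<^sub>2 = {} \<and> \<Delta> = \<Delta>\<^sub>1 ++ \<Delta>\<^sub>2)"
    (is "_ \<or> ?dec \<Gamma> \<Delta> C \<tau>")
proof -
  have top: "?dec \<Gamma> \<Delta> C \<tau>" if "redex G C" "has_type \<Gamma> \<Delta> C \<tau>" for \<Gamma> \<Delta> C \<tau>
    by (rule exI[of _ Hole], rule exI[of _ C], rule exI[of _ Map.empty], rule exI[of _ \<Delta>])
       (use that in \<open>auto intro: ctx_Hole\<close>)
  from assms show ?thesis
  proof (induction rule: has_type.induct)
    case (T_varB \<Gamma> k \<sigma>)
    then show ?case using top[OF redex_var has_type.T_varB] by (cases "k \<in> G") (auto simp: oval_def)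
  next
    case (T_var \<Gamma> k \<sigma>)
    then show ?case using top[OF redex_var has_type.T_var] by (cases "k \<in> G") (auto simp: oval_def)
  next
    case (T_App \<Gamma> \<Delta> M \<sigma> \<tau> \<Theta> N)
    note typed = has_type.T_App[OF T_App.hyps]
    from T_App.IH(2) show ?case
    proof
      assume N: "oval G N"
      from T_App.IH(1) show ?thesis
      proof
        assume M: "oval G M"
        have "redex G (App M N)"
        proof (cases M)
          case (Var y)
          with M N show ?thesis by (auto simp: oval_def intro: redex_apply)
        next
          case (Lam P)
          with N show ?thesis by (auto intro: redex_beta)
        next
          case (LamB P)
          \<comment> \<open>The argument has a bang type, so an open value in its place is some
            \<open>Bang\<close> or a variable.\<close>
          with T_App.hyps(1) obtain \<gamma> where \<gamma>: "\<sigma> = Exp \<gamma>" by (auto elim!: has_type_LamBE simp: Arr_inject)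
          show ?thesis
          proof (cases N)
            case (Lam Q)
            with T_App.hyps(2) \<gamma> show ?thesis by (auto elim!: has_type_LamE simp: Arr_neq_Exp)
          next
            case (LamB Q)
            with T_App.hyps(2) \<gamma> show ?thesis by (auto elim!: has_type_LamBE simp: Arr_neq_Exp)
          qed (use N LamB in \<open>auto simp: oval_def intro: redex_betaB redex_query\<close>)
        next
          case (Bang P)
          with T_App.hyps(1) show ?thesis by (auto elim!: has_type_BangE simp: Arr_neq_Exp)
        qed (use M in \<open>auto simp: oval_def\<close>)
        then show ?thesis using top typed by blast
      next
        assume "?dec \<Gamma> \<Delta> M (\<sigma> \<multimap> \<tau>)"
        then obtain E r \<Delta>\<^sub>1 \<Delta>\<^sub>2 \<rho> where *: "M = plug E r" "oeval_ctx G E" "redex G r"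
          "ctx_type \<Gamma> \<Delta>\<^sub>1 E \<rho> (\<sigma> \<multimap> \<tau>)" "has_type \<Gamma> \<Delta>\<^sub>2 r \<rho>" "dom \<Delta>\<^sub>1 \<inter> dom \<Delta>\<^sub>2 = {}" "\<Delta> = \<Delta>\<^sub>1 ++ \<Delta>\<^sub>2"
          by blast
        have "ctx_type \<Gamma> (\<Delta>\<^sub>1 ++ \<Theta>) (AppL E N) \<rho> \<tau>"
          by (rule ctx_AppL[OF *(4) T_App.hyps(2)]) (use T_App.hyps(3) *(7) in auto)
        moreover have "\<Delta> ++ \<Theta> = (\<Delta>\<^sub>1 ++ \<Theta>) ++ \<Delta>\<^sub>2"
          unfolding *(7) by (rule map_add_swap) (use T_App.hyps(3) *(7) in auto)
        moreover have "dom (\<Delta>\<^sub>1 ++ \<Theta>) \<inter> dom \<Delta>\<^sub>2 = {}" using T_App.hyps(3) *(6,7) by auto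
        moreover have "App M N = plug (AppL E N) r" "oeval_ctx G (AppL E N)" using * N by simp_all
        ultimately show ?thesis using *(3,5) by blast
      qed
    next
      assume "?dec \<Gamma> \<Theta> N \<sigma>"
      then obtain E r \<Delta>\<^sub>1 \<Delta>\<^sub>2 \<rho> where *: "N = plug E r" "oeval_ctx G E" "redex G r"
        "ctx_type \<Gamma> \<Delta>\<^sub>1 E \<rho> \<sigma>" "has_type \<Gamma> \<Delta>\<^sub>2 r \<rho>" "dom \<Delta>\<^sub>1 \<inter> dom \<Delta>\<^sub>2 = {}" "\<Theta> = \<Delta>\<^sub>1 ++ \<Delta>\<^sub>2"
        by blast
      have "ctx_type \<Gamma> (\<Delta> ++ \<Delta>\<^sub>1) (AppR M E) \<rho> \<tau>"
        by (rule ctx_AppR[OF T_App.hyps(1) *(4)]) (use T_App.hyps(3) *(7) in auto)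
      moreover have "\<Delta> ++ \<Theta> = (\<Delta> ++ \<Delta>\<^sub>1) ++ \<Delta>\<^sub>2" by (simp add: *(7))
      moreover have "dom (\<Delta> ++ \<Delta>\<^sub>1) \<inter> dom \<Delta>\<^sub>2 = {}" using T_App.hyps(3) *(6,7) by auto
      moreover have "App M N = plug (AppR M E) r" "oeval_ctx G (AppR M E)" using * by simp_all
      ultimately show ?thesis using *(3,5) by blast
    qed
  next
    case (T_Choice \<Gamma> \<Delta> M \<sigma> N)
    then show ?case using top[OF redex_choice has_type.T_Choice] by blast
  qed (auto simp: oval_def)
qed

text \<open>
  Evaluating a variable with \<open>!i\<close> need not take a step of the reduction, because the term it stands
  for may be a value already; \<open>var_count\<close> is what decreases then.
\<close>

primrec var_count :: "nat set \<Rightarrow> tm \<Rightarrow> nat" where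
  "var_count G (Var k) = (if k \<in> G then 1 else 0)"
| "var_count G (App M N) = var_count G M + var_count G N"
| "var_count G (Lam M) = 0"
| "var_count G (LamB M) = 0"
| "var_count G (Bang M) = 0"
| "var_count G (M \<oplus> N) = 0"

lemma var_count_plug:
  "x \<in> G \<Longrightarrow> z \<notin> G \<Longrightarrow> var_count G (plug E (Var z)) < var_count G (plug E (Var x))"
  by (induction E) auto

text \<open>The rank of \<open>j\<close> in \<open>S\<close>: for \<open>j\<close> in
  \<open>S\<close>, the index of entry \<open>j\<close> after \<open>nths\<close> has dropped the
  positions outside \<open>S\<close>.\<close>

definition pos :: "nat set \<Rightarrow> nat \<Rightarrow> nat" where
  "pos S j = card {i. i < j \<and> i \<in> S}"

lemma nth_nths_pos:
  assumes "j < length xs" "j \<in> S"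
  shows "pos S j < length (nths xs S)" "nths xs S ! pos S j = xs ! j"
proof -
  have "length (nths (take j xs) S) = pos S j"
    using assms by (simp add: length_nths pos_def min_def)
  moreover have "nths xs S = nths (take j xs) S @ nths (xs ! j # drop (Suc j) xs) {i. i + j \<in> S}"
    using nths_append[of "take j xs" "xs ! j # drop (Suc j) xs" S] assms
    by (simp add: id_take_nth_drop[symmetric] min_def)
  ultimately show "pos S j < length (nths xs S)" "nths xs S ! pos S j = xs ! j"
    using assms by (simp_all add: nths_Cons nth_append)
qed

lemma inj_on_pos: "inj_on (pos S) S"
proof (rule linorder_inj_onI)
  fix i j assume "i < j" "i \<in> S"
  then have "{k. k < i \<and> k \<in> S} \<subset> {k. k < j \<and> k \<in> S}" by auto
  then have "pos S i < pos S j" unfolding pos_def by (intro psubset_card_mono) auto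
  then show "pos S i \<noteq> pos S j" by simp
qed auto

lemma list_all2_nths: "list_all2 P xs ys \<Longrightarrow> list_all2 P (nths xs S) (nths ys S)"
  by (induction arbitrary: S rule: list_all2_induct) (auto simp: nths_Cons)

section \<open>Typing of tuples under actions\<close>

lemma inst_typed:
  assumes "is_ajudg (I, J, \<sigma>s, \<tau>s, N, \<gamma>)" "tuple_type (Ms, Ws) (\<sigma>s, \<tau>s)"
  shows "\<turnstile> inst (I, J, \<sigma>s, \<tau>s, N, \<gamma>) (Ms, Ws) : \<gamma>"
proof -
  from assms(1) have I: "I \<subseteq> {..<length \<sigma>s}" and J: "J \<subseteq> {..<length \<tau>s}"
    and N: "has_type (\<lambda>k. if k \<in> I then Some (\<sigma>s ! k) else None)
       (\<lambda>k. if length \<sigma>s \<le> k \<and> k - length \<sigma>s \<in> J then Some (\<tau>s ! (k - length \<sigma>s)) else None) N \<gamma>"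
    by auto
  have Ms: "\<turnstile> Ms ! k : \<sigma>s ! k" if "k < length \<sigma>s" for k
    using assms(2) that by (auto simp: tuple_type_def list_all2_conv_all_nth)
  have Ws: "\<turnstile> Ws ! k : \<tau>s ! k" if "k < length \<tau>s" for k
    using assms(2) that by (auto simp: tuple_type_def list_all2_conv_all_nth)
  show ?thesis
    unfolding inst.simps
    by (rule has_type_subst[OF N, where L = "\<lambda>_. Map.empty"])
       (use I J in \<open>force split: if_splits intro: Ms Ws\<close>)+
qed

text \<open>Canonical forms at bang type; they rule out the default branch of
  \<open>act_succ\<close> for an enabled \<open>AQuery\<close>.\<close>

lemma closed_Exp_val:
  assumes "\<turnstile> W : Exp \<gamma>" "is_val W"
  obtains N where "W = Bang N" "\<turnstile> N : \<gamma>"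
proof (cases W)
  case (Lam P)
  with assms(1) show ?thesis by (auto elim!: has_type_LamE simp: Arr_neq_Exp)
next
  case (LamB P)
  with assms(1) show ?thesis by (auto elim!: has_type_LamBE simp: Arr_neq_Exp)
next
  case (Bang N)
  with assms(1) that show ?thesis by (auto elim!: has_type_BangE simp: Exp_inject)
qed (use assms in auto)

text \<open>Keeps states closed under transitions. In integrals over successors it also makes bounds
  known for typed tuples hold almost everywhere.\<close>

lemma act_succ_typed:
  assumes "act_type A a B" "tuple_type K A" "K' \<in> set_spmf (act_succ K a)"
  shows "tuple_type K' B"
  using assms
proof (induction rule: act_type.induct)
  case (1 i \<tau>s \<gamma> \<sigma>s)
  obtain Ms Ws where K: "K = (Ms, Ws)" by fastforce
  from 1 K have i: "i < length Ws" "\<turnstile> Ws ! i : Exp \<gamma>" "is_val (Ws ! i)"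
    by (auto simp: tuple_type_def list_all2_conv_all_nth dest: nth_mem)
  from closed_Exp_val[OF i(2,3)] obtain N where N: "Ws ! i = Bang N" "\<turnstile> N : \<gamma>" .
  with 1 K show ?case
    by (auto simp: tuple_type_def list_all2_appendI list_all2_nths dest: in_set_nthsD)
next
  case (2 i \<sigma>s \<tau>s)
  obtain Ms Ws where K: "K = (Ms, Ws)" by fastforce
  with 2 have "\<turnstile> Ms ! i : \<sigma>s ! i" by (auto simp: tuple_type_def list_all2_conv_all_nth)
  from sem_typed[OF this] 2 K show ?case
    by (auto simp: tuple_type_def list_all2_appendI)
next
  case (3 I J \<sigma>s \<tau>s N \<gamma> i \<eta>)
  obtain Ms Ws where K: "K = (Ms, Ws)" by fastforce
  have N: "\<turnstile> inst (I, J, \<sigma>s, \<tau>s, N, \<gamma>) (Ms, Ws) : \<gamma>"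
    using 3 K by (intro inst_typed) auto
  moreover have "\<turnstile> Ws ! i : \<gamma> \<multimap> \<eta>" using 3 K by (auto simp: tuple_type_def list_all2_conv_all_nth)
  ultimately have "\<turnstile> App (Ws ! i) (inst (I, J, \<sigma>s, \<tau>s, N, \<gamma>) (Ms, Ws)) : \<eta>"
    using T_App[of Map.empty Map.empty _ _ _ Map.empty] by (simp del: inst.simps)
  from sem_typed[OF this] 3 K show ?case
    by (auto simp: tuple_type_def list_all2_appendI list_all2_nths simp del: inst.simps dest: in_set_nthsD)
qed

text \<open>So the infimum in \<open>state_dist\<close> is not taken over the empty set, where it is unspecified.\<close>

lemma total_relation_bisim:
  "eps_bisim 1 {((D, A), (D', A)) | D D' A. (D, A) \<in> states \<and> (D', A) \<in> states}" (is "eps_bisim 1 ?R")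
  unfolding eps_bisim_def
proof (intro conjI allI impI)
  show "refl_on states ?R" by (auto simp: refl_on_def)
  show "sym ?R" by (auto simp: sym_def)
next
  fix t s a u assume ts: "(t, s) \<in> ?R" and "wtrans t a u"
  from this(2) show "\<exists>v. wtrans s a v \<and> (u, v) \<in> ?R"
  proof cases
    case (trans_type D A)
    then show ?thesis using ts by (auto intro: wtrans.trans_type)
  next
    case (trans_act A b B D)
    from ts trans_act obtain D' where s: "s = (D', A)" "(D, A) \<in> states" "(D', A) \<in> states" by auto
    have "(bind_spmf D (\<lambda>K. act_succ K b), B) \<in> states" if "(D, A) \<in> states" for D
      using that act_succ_typed[OF trans_act(4)] by (fastforce simp: states_def set_bind_spmf)
    with s have "(u, (bind_spmf D' (\<lambda>K. act_succ K b), B)) \<in> ?R" using trans_act by (cases B) auto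
    moreover have "wtrans s a (bind_spmf D' (\<lambda>K. act_succ K b), B)"
      using trans_act s by (auto intro: wtrans.trans_act)
    ultimately show ?thesis by blast
  qed
next
  fix t s
  have "0 \<le> weight t" "weight t \<le> 1" "0 \<le> weight s" "weight s \<le> 1"
    by (auto simp: weight_def weight_spmf_le_1)
  then show "\<bar>weight t - weight s\<bar> \<le> 1" by linarith
qed auto

lemma tm_state_states: "\<turnstile> M : \<sigma> \<Longrightarrow> tm_state \<sigma> M \<in> states"
  by (auto simp: tm_state_def states_def tuple_type_def dest: sem_typed)

section \<open>Runs of open terms on tuples\<close>

lemma integral_bind_spmf:
  fixes f :: "'b \<Rightarrow> real"
  assumes "\<And>x. 0 \<le> f x" "\<And>x. f x \<le> 1"
  shows "(\<integral>y. f y \<partial>measure_spmf (bind_spmf D g)) = (\<integral>x. (\<integral>y. f y \<partial>measure_spmf (g x)) \<partial>measure_spmf D)"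
proof -
  \<comment> \<open>\<open>f y\<close> is written as a weight, which reduces the claim to associativity of \<open>bind_spmf\<close>.\<close>
  define h where "h y = scale_spmf (f y) (return_spmf ())" for y
  have h: "weight_spmf (h y) = f y" for y
    unfolding h_def weight_scale_spmf using assms(1)[of y] assms(2)[of y] by auto
  have w: "(\<integral>y. f y \<partial>measure_spmf p) = weight_spmf (bind_spmf p h)" for p
    unfolding weight_bind_spmf by (simp add: o_def h)
  have "(\<integral>y. f y \<partial>measure_spmf (bind_spmf D g)) = weight_spmf (bind_spmf D (\<lambda>x. bind_spmf (g x) h))"
    unfolding w by simp
  also have "\<dots> = (\<integral>x. weight_spmf (bind_spmf (g x) h) \<partial>measure_spmf D)"
    by (simp only: weight_bind_spmf[of D] o_def)
  finally show ?thesis unfolding w .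
qed

lemma integral_return_spmf: "(\<integral>y. f y \<partial>measure_spmf (return_spmf x)) = (f x :: real)"
  by (simp add: measure_spmf_return_spmf integral_return)

lemma integral_map_spmf: "(\<integral>y. f y \<partial>measure_spmf (map_spmf g p)) = (\<integral>x. (f (g x) :: real) \<partial>measure_spmf p)"
  by (simp add: measure_map_spmf_conv_distr integral_distr)

lemma integral_spmf_bounds:
  fixes f :: "'a \<Rightarrow> real"
  assumes "\<And>x. 0 \<le> f x" "\<And>x. f x \<le> 1"
  shows "0 \<le> (\<integral>x. f x \<partial>measure_spmf D)" "(\<integral>x. f x \<partial>measure_spmf D) \<le> 1"
proof -
  show "0 \<le> (\<integral>x. f x \<partial>measure_spmf D)" using assms by simp
  have "(\<integral>x. f x \<partial>measure_spmf D) \<le> (\<integral>x. 1 \<partial>measure_spmf D)"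
    by (rule integral_mono) (auto intro!: integrable_bounded_spmf assms)
  also have "\<dots> \<le> 1" by (simp add: weight_spmf_le_1)
  finally show "(\<integral>x. f x \<partial>measure_spmf D) \<le> 1" .
qed

lemma integral_spmf_mono:
  fixes f g :: "'a \<Rightarrow> real"
  assumes "\<And>x. 0 \<le> f x" "\<And>x. f x \<le> 1" "\<And>x. 0 \<le> g x" "\<And>x. g x \<le> 1"
    and "\<And>x. x \<in> set_spmf D \<Longrightarrow> f x \<le> g x"
  shows "(\<integral>x. f x \<partial>measure_spmf D) \<le> (\<integral>x. g x \<partial>measure_spmf D)"
  by (rule integral_mono_AE) (auto intro!: integrable_bounded_spmf assms simp: AE_measure_spmf_iff)

lemma act_type_det: "act_type A a B \<Longrightarrow> act_type A a B' \<Longrightarrow> B = B'"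
  by (auto elim!: act_type.cases simp: Exp_inject Arr_inject)

text \<open>The label fixes the target type by injectivity of the type constructors, and transitions
  are deterministic, so the matching transition can only be the same action on
  \<open>D'\<close>.\<close>

lemma eps_bisim_act:
  assumes "eps_bisim \<epsilon> R" "((D, A), (D', A)) \<in> R" "act_type A a B"
  shows "((bind_spmf D (\<lambda>K. act_succ K a), B), (bind_spmf D' (\<lambda>K. act_succ K a), B)) \<in> R"
proof -
  have "wtrans (D, A) (LAct a) (bind_spmf D (\<lambda>K. act_succ K a), B)"
    using assms(3) by (rule trans_act)
  then obtain v where "wtrans (D', A) (LAct a) v" "((bind_spmf D (\<lambda>K. act_succ K a), B), v) \<in> R"
    using assms(1,2) unfolding eps_bisim_def by blast
  moreover from this(1) have "v = (bind_spmf D' (\<lambda>K. act_succ K a), B)"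
    by cases (use assms(3) act_type_det in auto)
  ultimately show ?thesis by simp
qed

text \<open>
  The approximant \<open>f\<close> of the observations of \<open>F\<close> is one function for all tuples of type \<open>A\<close>, so it
  can be integrated along an action.
\<close>

definition approximable :: "real \<Rightarrow> state rel \<Rightarrow> nat \<Rightarrow> tuple_ty \<Rightarrow> (tuple \<Rightarrow> tm) \<Rightarrow> bool" where
  "approximable \<epsilon> R m A F \<longleftrightarrow> (\<exists>f. (\<forall>K. 0 \<le> f K \<and> f K \<le> 1) \<and>
     (\<forall>K. tuple_type K A \<longrightarrow> weight_spmf (evl m (F K)) \<le> f K \<and> f K \<le> Obs (F K)) \<and>
     (\<forall>D D'. ((D, A), (D', A)) \<in> R \<longrightarrow>
        \<bar>(\<integral>K. f K \<partial>measure_spmf D) - (\<integral>K. f K \<partial>measure_spmf D')\<bar> \<le> \<epsilon>))"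

lemma approximableI:
  assumes "\<And>K. 0 \<le> f K" "\<And>K. f K \<le> 1"
    and "\<And>K. tuple_type K A \<Longrightarrow> weight_spmf (evl m (F K)) \<le> f K"
    and "\<And>K. tuple_type K A \<Longrightarrow> f K \<le> Obs (F K)"
    and "\<And>D D'. ((D, A), (D', A)) \<in> R \<Longrightarrow>
        \<bar>(\<integral>K. f K \<partial>measure_spmf D) - (\<integral>K. f K \<partial>measure_spmf D')\<bar> \<le> \<epsilon>"
  shows "approximable \<epsilon> R m A F"
  unfolding approximable_def using assms by blast

lemma approximableE:
  assumes "approximable \<epsilon> R m A F"
  obtains f where "\<And>K. 0 \<le> f K" "\<And>K. f K \<le> 1"
    and "\<And>K. tuple_type K A \<Longrightarrow> weight_spmf (evl m (F K)) \<le> f K"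
    and "\<And>K. tuple_type K A \<Longrightarrow> f K \<le> Obs (F K)"
    and "\<And>D D'. ((D, A), (D', A)) \<in> R \<Longrightarrow>
        \<bar>(\<integral>K. f K \<partial>measure_spmf D) - (\<integral>K. f K \<partial>measure_spmf D')\<bar> \<le> \<epsilon>"
  using assms unfolding approximable_def by blast

lemma approximable_0: "0 \<le> \<epsilon> \<Longrightarrow> approximable \<epsilon> R 0 A F"
  by (rule approximableI[where f = "\<lambda>_. 0"]) (auto simp: Obs_nonneg)

text \<open>Values have observation 1, so the constant 1 is squeezed as required. Its integrals are
  weights, and the weight condition of the bisimulation supplies \<open>\<epsilon>\<close>.\<close>

lemma approximable_val:
  assumes "eps_bisim \<epsilon> R" "\<And>K. tuple_type K A \<Longrightarrow> is_val (F K)"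
  shows "approximable \<epsilon> R m A F"
proof (rule approximableI[where f = "\<lambda>_. 1"])
  fix D D' assume "((D, A), (D', A)) \<in> R"
  then have "\<bar>weight (D, A) - weight (D', A)\<bar> \<le> \<epsilon>"
    using assms(1) unfolding eps_bisim_def by blast
  then show "\<bar>(\<integral>K. 1 \<partial>measure_spmf D) - (\<integral>K. 1 \<partial>measure_spmf D')\<bar> \<le> \<epsilon>"
    by (simp add: weight_def)
qed (use assms(2) Obs_val in \<open>auto simp: weight_spmf_le_1\<close>)

lemma average_diff_le:
  "\<bar>a - c\<bar> \<le> \<epsilon> \<Longrightarrow> \<bar>b - d\<bar> \<le> \<epsilon> \<Longrightarrow> \<bar>(a + b) / 2 - (c + d) / 2\<bar> \<le> (\<epsilon> :: real)"
  unfolding abs_le_iff by (auto simp: field_simps)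

text \<open>Both branches see the same two distributions; hence the average of their approximants
  obeys the average of two bounds, which is again \<open>\<epsilon>\<close>.\<close>

lemma approximable_choice:
  assumes step: "\<And>K. tuple_type K A \<Longrightarrow> step (F K) [G K, H K]"
    and "approximable \<epsilon> R m A G" "approximable \<epsilon> R m A H"
  shows "approximable \<epsilon> R (Suc m) A F"
proof -
  from assms(2) obtain g where g: "\<And>K. 0 \<le> g K" "\<And>K. g K \<le> 1"
    "\<And>K. tuple_type K A \<Longrightarrow> weight_spmf (evl m (G K)) \<le> g K" "\<And>K. tuple_type K A \<Longrightarrow> g K \<le> Obs (G K)"
    "\<And>D D'. ((D, A), (D', A)) \<in> R \<Longrightarrow> \<bar>(\<integral>K. g K \<partial>measure_spmf D) - (\<integral>K. g K \<partial>measure_spmf D')\<bar> \<le> \<epsilon>"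
    by (rule approximableE) blast
  from assms(3) obtain h where h: "\<And>K. 0 \<le> h K" "\<And>K. h K \<le> 1"
    "\<And>K. tuple_type K A \<Longrightarrow> weight_spmf (evl m (H K)) \<le> h K" "\<And>K. tuple_type K A \<Longrightarrow> h K \<le> Obs (H K)"
    "\<And>D D'. ((D, A), (D', A)) \<in> R \<Longrightarrow> \<bar>(\<integral>K. h K \<partial>measure_spmf D) - (\<integral>K. h K \<partial>measure_spmf D')\<bar> \<le> \<epsilon>"
    by (rule approximableE) blast
  have I: "(\<integral>K. (g K + h K) / 2 \<partial>measure_spmf D) = ((\<integral>K. g K \<partial>measure_spmf D) + (\<integral>K. h K \<partial>measure_spmf D)) / 2" for D
    by (simp add: integrable_bounded_spmf g h)
  show ?thesis
  proof (rule approximableI[where f = "\<lambda>K. (g K + h K) / 2"])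
    fix K assume K: "tuple_type K A"
    show "weight_spmf (evl (Suc m) (F K)) \<le> (g K + h K) / 2"
      unfolding weight_evl_step[OF step[OF K]] using g(3)[OF K] h(3)[OF K] by (simp add: lessThan_Suc)
    show "(g K + h K) / 2 \<le> Obs (F K)"
      unfolding Obs_step[OF step[OF K]] using g(4)[OF K] h(4)[OF K] by (simp add: lessThan_Suc)
  next
    fix D D' assume "((D, A), (D', A)) \<in> R"
    from g(5)[OF this] h(5)[OF this]
    show "\<bar>(\<integral>K. (g K + h K) / 2 \<partial>measure_spmf D) - (\<integral>K. (g K + h K) / 2 \<partial>measure_spmf D')\<bar> \<le> \<epsilon>"
      unfolding I by (rule average_diff_le)
  next
    fix K show "0 \<le> (g K + h K) / 2" "(g K + h K) / 2 \<le> 1"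
      using g(1,2)[of K] h(1,2)[of K] by auto
  qed
qed

lemma approximable_step:
  assumes step: "\<And>K. tuple_type K A \<Longrightarrow> step (F K) [G K]" and "approximable \<epsilon> R m A G"
  shows "approximable \<epsilon> R (Suc m) A F"
proof -
  have "weight_spmf (evl (Suc m) (F K)) = weight_spmf (evl m (G K))" "Obs (F K) = Obs (G K)"
    if "tuple_type K A" for K
    unfolding weight_evl_step[OF step[OF that]] Obs_step[OF step[OF that]] by (simp_all add: lessThan_Suc)
  with assms(2) show ?thesis by (simp add: approximable_def del: evl.simps)
qed

text \<open>The approximant before an action is the expectation of the one after it. Its integral
  over \<open>D\<close> is the integral of the later approximant over the successor of
  \<open>D\<close>, and successors of related states are related.\<close>

lemma approximable_act:
  assumes bisim: "eps_bisim \<epsilon> R" and act: "act_type A a B" and app: "approximable \<epsilon> R m' B F'"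
    and le: "\<And>K. tuple_type K A \<Longrightarrow>
      weight_spmf (evl m (F K)) \<le> (\<integral>K'. weight_spmf (evl m' (F' K')) \<partial>measure_spmf (act_succ K a))"
    and ge: "\<And>K. tuple_type K A \<Longrightarrow> (\<integral>K'. Obs (F' K') \<partial>measure_spmf (act_succ K a)) \<le> Obs (F K)"
  shows "approximable \<epsilon> R m A F"
proof -
  from app obtain f where f: "\<And>K. 0 \<le> f K" "\<And>K. f K \<le> 1"
    "\<And>K. tuple_type K B \<Longrightarrow> weight_spmf (evl m' (F' K)) \<le> f K" "\<And>K. tuple_type K B \<Longrightarrow> f K \<le> Obs (F' K)"
    "\<And>D D'. ((D, B), (D', B)) \<in> R \<Longrightarrow> \<bar>(\<integral>K. f K \<partial>measure_spmf D) - (\<integral>K. f K \<partial>measure_spmf D')\<bar> \<le> \<epsilon>"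
    by (rule approximableE) blast
  show ?thesis
  proof (rule approximableI[where f = "\<lambda>K. \<integral>K'. f K' \<partial>measure_spmf (act_succ K a)"])
    fix K
    show "0 \<le> (\<integral>K'. f K' \<partial>measure_spmf (act_succ K a))" "(\<integral>K'. f K' \<partial>measure_spmf (act_succ K a)) \<le> 1"
      by (intro integral_spmf_bounds f)+
    assume K: "tuple_type K A"
    show "weight_spmf (evl m (F K)) \<le> (\<integral>K'. f K' \<partial>measure_spmf (act_succ K a))"
      by (rule order.trans[OF le[OF K]], rule integral_spmf_mono)
         (auto intro: f act_succ_typed[OF act K] simp: weight_spmf_le_1)
    show "(\<integral>K'. f K' \<partial>measure_spmf (act_succ K a)) \<le> Obs (F K)"
      by (rule order.trans[OF _ ge[OF K]], rule integral_spmf_mono)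
         (auto intro: f act_succ_typed[OF act K] simp: Obs_nonneg Obs_le_1)
  next
    fix D D' assume "((D, A), (D', A)) \<in> R"
    from f(5)[OF eps_bisim_act[OF bisim this act]]
    show "\<bar>(\<integral>K. (\<integral>K'. f K' \<partial>measure_spmf (act_succ K a)) \<partial>measure_spmf D) -
      (\<integral>K. (\<integral>K'. f K' \<partial>measure_spmf (act_succ K a)) \<partial>measure_spmf D')\<bar> \<le> \<epsilon>"
      by (simp add: integral_bind_spmf f)
  qed
qed

text \<open>
  The variables of an open term are interpreted by positions of a tuple: \<open>X\<close> sends nonlinear
  variables to positions in the term part, \<open>Y\<close> sends linear ones to positions in the value part.
\<close>

definition tyenv :: "ty list \<Rightarrow> (nat \<rightharpoonup> nat) \<Rightarrow> nat \<rightharpoonup> ty" where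
  "tyenv ts X = (\<lambda>k. map_option ((!) ts) (X k))"

text \<open>\<open>Y\<close> is injective because a value of the tuple may be spent only once,
  whereas several nonlinear variables may share a term. Injectivity bounds \<open>dom Y\<close>;
  finiteness of \<open>dom X\<close> is asked separately, to have fresh variables.\<close>

definition binds :: "tuple_ty \<Rightarrow> (nat \<rightharpoonup> nat) \<Rightarrow> (nat \<rightharpoonup> nat) \<Rightarrow> bool" where
  "binds A X Y \<longleftrightarrow> finite (dom X) \<and> dom X \<inter> dom Y = {} \<and> (\<forall>k i. X k = Some i \<longrightarrow> i < length (fst A)) \<and>
     (\<forall>k j. Y k = Some j \<longrightarrow> j < length (snd A)) \<and> inj_on Y (dom Y)"

definition tuple_subst :: "(nat \<rightharpoonup> nat) \<Rightarrow> (nat \<rightharpoonup> nat) \<Rightarrow> tuple \<Rightarrow> nat \<Rightarrow> tm" where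
  "tuple_subst X Y K k = (case X k of Some i \<Rightarrow> fst K ! i | None \<Rightarrow>
     (case Y k of Some j \<Rightarrow> snd K ! j | None \<Rightarrow> Var k))"

section \<open>Interpretations of variables while tuple positions shift\<close>

lemma dom_tyenv [simp]: "dom (tyenv ts X) = dom X"
  by (auto simp: tyenv_def dom_def)

lemma tyenv_split:
  assumes "tyenv ts Y = \<Delta>\<^sub>1 ++ \<Delta>\<^sub>2" "dom \<Delta>\<^sub>1 \<inter> dom \<Delta>\<^sub>2 = {}"
  shows "\<Delta>\<^sub>1 = tyenv ts (Y |` dom \<Delta>\<^sub>1)" "\<Delta>\<^sub>2 = tyenv ts (Y |` dom \<Delta>\<^sub>2)" "dom Y = dom \<Delta>\<^sub>1 \<union> dom \<Delta>\<^sub>2"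
proof -
  have *: "(\<Delta>\<^sub>1 ++ \<Delta>\<^sub>2) k = map_option ((!) ts) (Y k)" for k
    using assms(1) by (metis tyenv_def)
  have "dom (tyenv ts Y) = dom (\<Delta>\<^sub>1 ++ \<Delta>\<^sub>2)" by (simp only: assms(1))
  then show "dom Y = dom \<Delta>\<^sub>1 \<union> dom \<Delta>\<^sub>2" by auto
  show "\<Delta>\<^sub>2 = tyenv ts (Y |` dom \<Delta>\<^sub>2)"
  proof
    fix k
    show "\<Delta>\<^sub>2 k = tyenv ts (Y |` dom \<Delta>\<^sub>2) k"
      using *[of k] by (cases "k \<in> dom \<Delta>\<^sub>2") (auto simp: tyenv_def restrict_map_def map_add_dom_app_simps)
  qed
  show "\<Delta>\<^sub>1 = tyenv ts (Y |` dom \<Delta>\<^sub>1)"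
  proof
    fix k
    show "\<Delta>\<^sub>1 k = tyenv ts (Y |` dom \<Delta>\<^sub>1) k"
    proof (cases "k \<in> dom \<Delta>\<^sub>1")
      case True
      then have "k \<notin> dom \<Delta>\<^sub>2" using assms(2) by blast
      then show ?thesis using *[of k] True by (simp add: tyenv_def map_add_dom_app_simps)
    qed (auto simp: tyenv_def restrict_map_def)
  qed
qed

text \<open>When an action keeps the value positions in \<open>S\<close>, the variables in
  \<open>Q\<close> follow their values to the new positions.\<close>

definition relocate :: "nat set \<Rightarrow> nat set \<Rightarrow> (nat \<rightharpoonup> nat) \<Rightarrow> nat \<rightharpoonup> nat" where
  "relocate S Q Y = (\<lambda>k. map_option (pos S) ((Y |` Q) k))"

lemma relocate_Some: "k \<in> Q \<Longrightarrow> Y k = Some j \<Longrightarrow> relocate S Q Y k = Some (pos S j)"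
  by (simp add: relocate_def)

lemma relocate_SomeD: "relocate S Q Y k = Some i \<Longrightarrow> \<exists>j. k \<in> Q \<and> Y k = Some j \<and> i = pos S j"
  by (auto simp: relocate_def restrict_map_def split: if_splits)

lemma dom_relocate: "Q \<subseteq> dom Y \<Longrightarrow> dom (relocate S Q Y) = Q"
  by (auto simp: relocate_def dom_def restrict_map_def)

lemma tyenv_relocate:
  assumes "binds (\<sigma>s, \<tau>s) X Y" "\<And>k j. k \<in> Q \<Longrightarrow> Y k = Some j \<Longrightarrow> j \<in> S"
  shows "tyenv (nths \<tau>s S @ ts) (relocate S Q Y) = tyenv \<tau>s (Y |` Q)"
proof
  fix k
  show "tyenv (nths \<tau>s S @ ts) (relocate S Q Y) k = tyenv \<tau>s (Y |` Q) k"
  proof (cases "(Y |` Q) k")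
    case (Some j)
    then have "k \<in> Q" "Y k = Some j" by (auto simp: restrict_map_def split: if_splits)
    with assms have "j < length \<tau>s" "j \<in> S" by (auto simp: binds_def)
    from nth_nths_pos[OF this] Some show ?thesis by (simp add: tyenv_def relocate_def nth_append)
  qed (simp add: tyenv_def relocate_def)
qed

lemma binds_relocate:
  assumes "binds (\<sigma>s, \<tau>s) X Y" "Q \<subseteq> dom Y" "\<And>k j. k \<in> Q \<Longrightarrow> Y k = Some j \<Longrightarrow> j \<in> S"
  shows "inj_on (relocate S Q Y) (dom (relocate S Q Y))"
    and "relocate S Q Y k = Some i \<Longrightarrow> i < length (nths \<tau>s S)"
proof -
  show "inj_on (relocate S Q Y) (dom (relocate S Q Y))"
    unfolding dom_relocate[OF assms(2)]
  proof (rule inj_onI)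
    fix k l assume kl: "k \<in> Q" "l \<in> Q" "relocate S Q Y k = relocate S Q Y l"
    then obtain i j where ij: "Y k = Some i" "Y l = Some j" using assms(2) by blast
    with kl have "pos S i = pos S j" by (simp add: relocate_Some)
    moreover have "i \<in> S" "j \<in> S" using ij kl assms(3) by blast+
    ultimately have "i = j" using inj_on_pos by (auto dest: inj_onD)
    with ij have "Y k = Y l" by simp
    moreover have "k \<in> dom Y" "l \<in> dom Y" using ij by auto
    ultimately show "k = l" using assms(1) unfolding binds_def by (auto dest: inj_onD)
  qed
  assume "relocate S Q Y k = Some i"
  from relocate_SomeD[OF this] obtain j where "k \<in> Q" "Y k = Some j" "i = pos S j" by blast
  moreover from this assms(1,3) have "j < length \<tau>s" "j \<in> S" by (auto simp: binds_def)
  ultimately show "i < length (nths \<tau>s S)" using nth_nths_pos(1) by blast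
qed

text \<open>Positions in \<open>nths Ws S\<close> shift exactly as \<open>relocate\<close>
  prescribes, and new entries come after them, so a surviving variable still denotes the same
  value.\<close>

lemma tuple_subst_relocate:
  assumes "binds (\<sigma>s, \<tau>s) X Y" "k \<in> Q" "Q \<subseteq> dom Y" "\<And>j. Y k = Some j \<Longrightarrow> j \<in> S"
    and "length Ws = length \<tau>s" "X' k = None" "Y' k = relocate S Q Y k"
  shows "tuple_subst X' Y' (Ms', nths Ws S @ Vs) k = tuple_subst X Y (Ms, Ws) k"
proof -
  from assms(2,3) obtain j where j: "Y k = Some j" by blast
  then have "j < length Ws" "j \<in> S" using assms(1,4,5) by (auto simp: binds_def)
  note nth_nths_pos[OF this]
  moreover have "X k = None" using assms(1) j by (auto simp: binds_def)
  ultimately show ?thesis using assms(2,6,7) j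
    by (simp add: tuple_subst_def relocate_Some nth_append)
qed

lemma is_val_tuple_subst:
  assumes "binds A X Y" "tuple_type K A" "k \<in> dom Y"
  shows "is_val (tuple_subst X Y K k)"
proof -
  from assms(3) obtain j where j: "Y k = Some j" by blast
  moreover have "X k = None" using assms(1) j by (auto simp: binds_def)
  moreover have "j < length (snd K)"
    using assms(1,2) j by (auto simp: binds_def tuple_type_def list_all2_lengthD)
  ultimately show ?thesis using assms(2) by (auto simp: tuple_subst_def tuple_type_def)
qed

lemma binds_fresh:
  assumes "binds A X Y"
  obtains z where "z \<notin> dom X" "z \<notin> dom Y"
proof -
  have "Y ` dom Y \<subseteq> Some ` {..<length (snd A)}"
    using assms by (auto simp: binds_def)
  then have "finite (Y ` dom Y)" by (rule finite_subset) simp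
  then have "finite (dom Y)" using assms unfolding binds_def by (blast dest: finite_imageD)
  then have "finite (dom X \<union> dom Y)" using assms by (simp add: binds_def)
  from ex_new_if_finite[OF infinite_UNIV_nat this] that show ?thesis by blast
qed

lemma subst_subst0_env: "subst s (subst0 P V) = subst (case_nat (subst s V) s) P"
  unfolding subst0_def subst_subst
  by (rule arg_cong[of _ _ "\<lambda>t. subst t P"]) (auto split: nat.splits)

lemma subst0_subst_up: "subst0 (subst (up s) P) N = subst (case_nat N s) P"
  unfolding subst0_def subst_subst
  by (rule arg_cong[of _ _ "\<lambda>t. subst t P"])
     (auto simp: up_def subst_ren subst_Var_id split: nat.splits)

lemma tuple_type_lengths:
  "tuple_type K (\<sigma>s, \<tau>s) \<Longrightarrow> length (fst K) = length \<sigma>s \<and> length (snd K) = length \<tau>s"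
  by (auto simp: tuple_type_def list_all2_lengthD)

lemma length_nths_cong: "length xs = length ys \<Longrightarrow> length (nths xs S) = length (nths ys S)"
  by (simp add: length_nths)

lemma tyenv_eq_Some: "tyenv ts X k = Some \<sigma> \<longleftrightarrow> (\<exists>i. X k = Some i \<and> \<sigma> = ts ! i)"
  by (auto simp: tyenv_def)

section \<open>Interactions of the context with the tuple as actions\<close>

lemma eval_ctx_tuple_subst:
  assumes "binds A X Y" "tuple_type K A" "ctx_type (tyenv (fst A) X) \<Delta> E \<sigma> \<tau>" "oeval_ctx (dom X) E" "dom \<Delta> \<subseteq> dom Y"
  shows "eval_ctx (esubst (tuple_subst X Y K) E)"
proof (rule eval_ctx_esubst[OF assms(3,4)])
  fix k assume "k \<in> dom \<Delta>"
  with assms(5) have "k \<in> dom Y" by blast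
  then show "is_val (tuple_subst X Y K k)" by (rule is_val_tuple_subst[OF assms(1,2)])
qed simp

text \<open>Common part of \<open>ABang\<close> and \<open>AApp\<close>: both evaluate a term
  \<open>T K\<close> in the hole, keep the values at positions \<open>S\<close> and append the
  result, which a fresh variable \<open>z\<close> then denotes in the context. The two fuels are
  separate parameters because applying a value costs a unit and evaluating a variable need
  not.\<close>

lemma approximable_value_act:
  assumes bisim: "eps_bisim \<epsilon> R" and binds: "binds (\<sigma>s, \<tau>s) X Y"
    and E: "ctx_type (tyenv \<sigma>s X) \<Delta> E \<sigma> \<tau>" and ov: "oeval_ctx (dom X) E"
    and \<Delta>: "\<Delta> = tyenv \<tau>s (Y |` dom \<Delta>)" "dom \<Delta> \<subseteq> dom Y"
    and S: "\<And>k j. k \<in> dom \<Delta> \<Longrightarrow> Y k = Some j \<Longrightarrow> j \<in> S"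
    and act: "act_type (\<sigma>s, \<tau>s) a (\<sigma>s, nths \<tau>s S @ [\<sigma>])"
    and succ: "\<And>K. tuple_type K (\<sigma>s, \<tau>s) \<Longrightarrow>
      act_succ K a = map_spmf (\<lambda>V. (fst K, nths (snd K) S @ [V])) (sem (T K))"
    and fuel: "\<And>K E'. tuple_type K (\<sigma>s, \<tau>s) \<Longrightarrow> eval_ctx E' \<Longrightarrow>
      weight_spmf (evl m (plug E' (T K))) \<le> (\<integral>V. weight_spmf (evl m' (plug E' V)) \<partial>measure_spmf (sem (T K)))"
    and IH: "\<And>z Y'. z \<notin> dom X \<Longrightarrow> binds (\<sigma>s, nths \<tau>s S @ [\<sigma>]) X Y' \<Longrightarrow>
      has_type (tyenv \<sigma>s X) (tyenv (nths \<tau>s S @ [\<sigma>]) Y') (plug E (Var z)) \<tau> \<Longrightarrow>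
      approximable \<epsilon> R m' (\<sigma>s, nths \<tau>s S @ [\<sigma>]) (\<lambda>K. subst (tuple_subst X Y' K) (plug E (Var z)))"
  shows "approximable \<epsilon> R m (\<sigma>s, \<tau>s) (\<lambda>K. plug (esubst (tuple_subst X Y K) E) (T K))"
proof -
  obtain z where z: "z \<notin> dom X" "z \<notin> dom Y" using binds by (rule binds_fresh)
  define Y0 where "Y0 = relocate S (dom \<Delta>) Y"
  \<comment> \<open>The new value is appended, so its position is the length of the retained
    part.\<close>
  define Y' where "Y' = Y0(z \<mapsto> length (nths \<tau>s S))"
  have dY0: "dom Y0 = dom \<Delta>" unfolding Y0_def by (rule dom_relocate[OF \<Delta>(2)])
  have zD: "z \<notin> dom \<Delta>" using z(2) \<Delta>(2) by blast
  have Y0_inj: "inj_on Y0 (dom Y0)"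
    unfolding Y0_def using binds \<Delta>(2) S by (rule binds_relocate)
  have Y0_less: "i < length (nths \<tau>s S)" if "Y0 k = Some i" for k i
    using binds \<Delta>(2) S that unfolding Y0_def by (rule binds_relocate)
  have Y'_k: "Y' k = Y0 k" if "k \<in> dom \<Delta>" for k
    using that zD by (auto simp: Y'_def)
  have "inj_on Y' (dom Y')"
  proof (rule inj_onI)
    fix k l assume kl: "k \<in> dom Y'" "l \<in> dom Y'" "Y' k = Y' l"
    show "k = l"
      using kl Y0_less[of k] Y0_less[of l] inj_onD[OF Y0_inj, of k l]
      by (auto simp: Y'_def split: if_splits)
  qed
  moreover have "dom X \<inter> dom Y' = {}" using binds z(1) \<Delta>(2) by (auto simp: binds_def Y'_def dY0)
  moreover have "j < length (nths \<tau>s S @ [\<sigma>])" if "Y' k = Some j" for k j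
    using that Y0_less[of k j] by (auto simp: Y'_def split: if_splits)
  ultimately have binds': "binds (\<sigma>s, nths \<tau>s S @ [\<sigma>]) X Y'"
    using binds by (auto simp: binds_def)
  have env: "tyenv (nths \<tau>s S @ [\<sigma>]) Y' = \<Delta> ++ [z \<mapsto> \<sigma>]"
  proof
    fix k
    have "tyenv (nths \<tau>s S @ [\<sigma>]) Y0 k = \<Delta> k"
      unfolding Y0_def by (subst tyenv_relocate[OF binds], erule (1) S) (simp only: \<Delta>(1)[symmetric])
    then show "tyenv (nths \<tau>s S @ [\<sigma>]) Y' k = (\<Delta> ++ [z \<mapsto> \<sigma>]) k"
      by (auto simp: tyenv_def Y'_def)
  qed
  have "tyenv \<sigma>s X z = None" using z(1) by (auto simp: tyenv_def)
  then have "has_type (tyenv \<sigma>s X) (\<Delta> ++ [z \<mapsto> \<sigma>]) (plug E (Var z)) \<tau>"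
    using zD by (intro has_type_plug[OF E] T_var) auto
  then have app: "approximable \<epsilon> R m' (\<sigma>s, nths \<tau>s S @ [\<sigma>]) (\<lambda>K. subst (tuple_subst X Y' K) (plug E (Var z)))"
    using IH[OF z(1) binds'] by (simp add: env)
  have inst: "subst (tuple_subst X Y' (fst K, nths (snd K) S @ [V])) (plug E (Var z)) =
      plug (esubst (tuple_subst X Y K) E) V" if K: "tuple_type K (\<sigma>s, \<tau>s)" for K V
  proof -
    have len: "length (snd K) = length \<tau>s" using tuple_type_lengths[OF K] by simp
    have "esubst (tuple_subst X Y' (fst K, nths (snd K) S @ [V])) E = esubst (tuple_subst X Y K) E"
    proof (rule esubst_cong_typed[OF E])
      fix k assume "k \<in> dom (tyenv \<sigma>s X)"
      then show "tuple_subst X Y' (fst K, nths (snd K) S @ [V]) k = tuple_subst X Y K k"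
        by (auto simp: tuple_subst_def)
    next
      fix k assume k: "k \<in> dom \<Delta>"
      then have "X k = None" using \<Delta>(2) binds by (auto simp: binds_def)
      then have "tuple_subst X Y' (fst K, nths (snd K) S @ [V]) k = tuple_subst X Y (fst K, snd K) k"
        by (intro tuple_subst_relocate[OF binds k \<Delta>(2)] S[OF k] len) (simp_all add: Y'_k[OF k] Y0_def)
      then show "tuple_subst X Y' (fst K, nths (snd K) S @ [V]) k = tuple_subst X Y K k" by simp
    qed
    moreover have "tuple_subst X Y' (fst K, nths (snd K) S @ [V]) z = V"
      using z(1) length_nths_cong[OF len, of S] by (auto simp: tuple_subst_def Y'_def nth_append split: option.splits)
    ultimately show ?thesis by (simp add: subst_plug)
  qed
  have ctx: "eval_ctx (esubst (tuple_subst X Y K) E)" if "tuple_type K (\<sigma>s, \<tau>s)" for K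
    by (rule eval_ctx_tuple_subst[OF binds that _ ov]) (use E \<Delta>(2) in auto)
  show ?thesis
  proof (rule approximable_act[OF bisim act app])
    fix K assume K: "tuple_type K (\<sigma>s, \<tau>s)"
    show "weight_spmf (evl m (plug (esubst (tuple_subst X Y K) E) (T K)))
      \<le> (\<integral>K'. weight_spmf (evl m' (subst (tuple_subst X Y' K') (plug E (Var z)))) \<partial>measure_spmf (act_succ K a))"
      using fuel[OF K ctx[OF K]] by (simp only: succ[OF K] integral_map_spmf inst[OF K])
    show "(\<integral>K'. Obs (subst (tuple_subst X Y' K') (plug E (Var z))) \<partial>measure_spmf (act_succ K a))
      \<le> Obs (plug (esubst (tuple_subst X Y K) E) (T K))"
      using integral_Obs_plug_le[OF ctx[OF K], of "T K"] by (simp only: succ[OF K] integral_map_spmf inst[OF K])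
  qed
qed

text \<open>Opening a banged value evaluates nothing: the action has a single successor, and its new
  entry joins the term part. The bound variable of \<open>P\<close> becomes a fresh nonlinear
  variable \<open>z\<close>, so the unpacked term is shared by all its occurrences.\<close>

lemma approximable_query:
  assumes bisim: "eps_bisim \<epsilon> R" and binds: "binds (\<sigma>s, \<tau>s) X Y"
    and E: "ctx_type (tyenv \<sigma>s X) \<Delta>\<^sub>1 E \<sigma> \<tau>" and ov: "oeval_ctx (dom X) E"
    and split: "tyenv \<tau>s Y = \<Delta>\<^sub>1 ++ \<Delta>\<^sub>2" "dom \<Delta>\<^sub>1 \<inter> dom \<Delta>\<^sub>2 = {}"
    and r: "has_type (tyenv \<sigma>s X) \<Delta>\<^sub>2 (App (LamB P) (Var y)) \<sigma>" and y: "y \<notin> dom X"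
    and IH: "\<And>A C X Y \<tau>. binds A X Y \<Longrightarrow> has_type (tyenv (fst A) X) (tyenv (snd A) Y) C \<tau> \<Longrightarrow>
      approximable \<epsilon> R m A (\<lambda>K. subst (tuple_subst X Y K) C)"
  shows "approximable \<epsilon> R (Suc m) (\<sigma>s, \<tau>s) (\<lambda>K. subst (tuple_subst X Y K) (plug E (App (LamB P) (Var y))))"
proof -
  from r obtain D T \<rho> where DT: "\<Delta>\<^sub>2 = D ++ T" "has_type (tyenv \<sigma>s X) D (LamB P) (\<rho> \<multimap> \<sigma>)"
    "has_type (tyenv \<sigma>s X) T (Var y) \<rho>" "dom D \<inter> dom T = {}" by (rule has_type_AppE)
  from DT(2) obtain \<gamma> where \<rho>: "\<rho> = Exp \<gamma>"
    and P: "has_type (case_nat (Some \<gamma>) (tyenv \<sigma>s X)) (case_nat None D) P \<sigma>"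
    by (auto elim!: has_type_LamBE simp: Arr_inject)
  have T: "T = [y \<mapsto> Exp \<gamma>]"
    using DT(3) y by (auto elim!: has_type_VarE simp: \<rho> tyenv_eq_Some)
  define Q where "Q = dom \<Delta>\<^sub>1 \<union> dom D"
  have disj: "dom \<Delta>\<^sub>1 \<inter> dom D = {}" "y \<notin> Q" using split(2) DT T by (auto simp: Q_def)
  have env: "tyenv \<tau>s Y = (\<Delta>\<^sub>1 ++ D) ++ [y \<mapsto> Exp \<gamma>]" using split(1) DT(1) T by simp
  have dis: "dom (\<Delta>\<^sub>1 ++ D) \<inter> dom [y \<mapsto> Exp \<gamma>] = {}" using disj(2) by (auto simp: Q_def)
  have dQ: "dom (\<Delta>\<^sub>1 ++ D) = Q" by (auto simp: Q_def)
  note sp = tyenv_split[OF env dis, unfolded dQ]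
  have QY: "Q \<subseteq> dom Y" using sp(3) by auto
  have "tyenv \<tau>s Y y = Some (Exp \<gamma>)" unfolding env by simp
  then obtain i where i: "Y y = Some i" "\<tau>s ! i = Exp \<gamma>" by (auto simp: tyenv_eq_Some)
  have il: "i < length \<tau>s" using binds i(1) by (auto simp: binds_def)
  define S where "S = - {i}"
  \<comment> \<open>By linearity \<open>y\<close> is not in \<open>Q\<close>, and \<open>Y\<close>
    is injective, so no surviving variable loses its position.\<close>
  have S: "j \<in> S" if "k \<in> Q" "Y k = Some j" for k j
    using binds that i(1) disj(2) unfolding binds_def S_def inj_on_def by (metis ComplI domI singletonD)
  obtain z where z: "z \<notin> dom X" "z \<notin> dom Y" using binds by (rule binds_fresh)
  have zQ: "z \<notin> Q" using z(2) QY by blast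
  \<comment> \<open>The action appends the unpacked term at the end of the term part, at position
    \<open>length \<sigma>s\<close>.\<close>
  define X' where "X' = X(z \<mapsto> length \<sigma>s)"
  define Y' where "Y' = relocate S Q Y"
  have dY': "dom Y' = Q" unfolding Y'_def by (rule dom_relocate[OF QY])
  have Y'_inj: "inj_on Y' (dom Y')"
    unfolding Y'_def using binds QY S by (rule binds_relocate)
  have Y'_less: "i < length (nths \<tau>s S)" if "Y' k = Some i" for k i
    using binds QY S that unfolding Y'_def by (rule binds_relocate)
  have "binds (\<sigma>s @ [\<gamma>], nths \<tau>s S) X' Y'"
    unfolding binds_def fst_conv snd_conv
  proof (intro conjI allI impI)
    show "dom X' \<inter> dom Y' = {}"
      unfolding dY' using binds zQ QY by (auto simp: X'_def binds_def)
    show "i < length (\<sigma>s @ [\<gamma>])" if "X' k = Some i" for k i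
      using that binds by (auto simp: X'_def binds_def less_Suc_eq split: if_splits)
    show "i < length (nths \<tau>s S)" if "Y' k = Some i" for k i
      using that by (rule Y'_less)
  qed (use binds Y'_inj in \<open>auto simp: X'_def binds_def\<close>)
  moreover have eX: "tyenv (\<sigma>s @ [\<gamma>]) X' = (tyenv \<sigma>s X)(z \<mapsto> \<gamma>)"
  proof
    fix k
    show "tyenv (\<sigma>s @ [\<gamma>]) X' k = ((tyenv \<sigma>s X)(z \<mapsto> \<gamma>)) k"
      using binds by (cases "X k") (auto simp: tyenv_def X'_def binds_def nth_append)
  qed
  moreover have eY: "tyenv (nths \<tau>s S) Y' = \<Delta>\<^sub>1 ++ D"
  proof -
    have "tyenv (nths \<tau>s S @ []) Y' = tyenv \<tau>s (Y |` Q)"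
      unfolding Y'_def using binds S by (rule tyenv_relocate)
    then show ?thesis using sp(1) by simp
  qed
  moreover have "has_type ((tyenv \<sigma>s X)(z \<mapsto> \<gamma>)) (\<Delta>\<^sub>1 ++ D) (plug E (subst0 P (Var z))) \<tau>"
  proof (rule has_type_plug)
    have le: "tyenv \<sigma>s X \<subseteq>\<^sub>m (tyenv \<sigma>s X)(z \<mapsto> \<gamma>)" using z(1) by (auto simp: map_le_def)
    have XQ: "dom X \<inter> Q = {}" using binds QY by (auto simp: binds_def)
    show "ctx_type ((tyenv \<sigma>s X)(z \<mapsto> \<gamma>)) \<Delta>\<^sub>1 E \<sigma> \<tau>"
      by (rule ctx_type_weaken[OF E le]) (use XQ zQ in \<open>auto simp: Q_def\<close>)
    show "has_type ((tyenv \<sigma>s X)(z \<mapsto> \<gamma>)) D (subst0 P (Var z)) \<sigma>"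
    proof (rule has_type_subst0_exponential)
      show "has_type (case_nat (Some \<gamma>) ((tyenv \<sigma>s X)(z \<mapsto> \<gamma>))) (case_nat None D) P \<sigma>"
      proof (rule has_type_weaken[OF P])
        show "case_nat (Some \<gamma>) (tyenv \<sigma>s X) \<subseteq>\<^sub>m case_nat (Some \<gamma>) ((tyenv \<sigma>s X)(z \<mapsto> \<gamma>))"
          using z(1) by (auto simp: map_le_def tyenv_eq_Some split: nat.splits)
        have "k \<notin> dom (case_nat (Some \<gamma>) ((tyenv \<sigma>s X)(z \<mapsto> \<gamma>))) \<inter> dom (case_nat None D)" for k
        proof (cases k)
          case (Suc l)
          have "l \<in> dom X \<or> l = z \<Longrightarrow> l \<notin> dom D" using XQ zQ by (auto simp: Q_def)
          moreover have "k \<in> dom (case_nat (Some \<gamma>) ((tyenv \<sigma>s X)(z \<mapsto> \<gamma>))) \<longleftrightarrow> l \<in> dom X \<or> l = z"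
            using Suc by (auto simp: dom_def tyenv_def)
          moreover have "k \<in> dom (case_nat None D) \<longleftrightarrow> l \<in> dom D" using Suc by (simp add: dom_def)
          ultimately show ?thesis by blast
        qed auto
        then show "dom (case_nat (Some \<gamma>) ((tyenv \<sigma>s X)(z \<mapsto> \<gamma>))) \<inter> dom (case_nat None D) = {}" by blast
      qed
      show "has_type ((tyenv \<sigma>s X)(z \<mapsto> \<gamma>)) Map.empty (Var z) \<gamma>" by (rule T_varB) simp
    qed
  qed (rule disj(1))
  ultimately have app: "approximable \<epsilon> R m (\<sigma>s @ [\<gamma>], nths \<tau>s S)
      (\<lambda>K. subst (tuple_subst X' Y' K) (plug E (subst0 P (Var z))))"
    by (intro IH) (simp_all only: fst_conv snd_conv)
  have act: "act_type (\<sigma>s, \<tau>s) (AQuery i) (\<sigma>s @ [\<gamma>], nths \<tau>s S)"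
    unfolding S_def using il i(2) by (rule act_type.intros)
  have ctx: "eval_ctx (esubst (tuple_subst X Y K) E)" if "tuple_type K (\<sigma>s, \<tau>s)" for K
    by (rule eval_ctx_tuple_subst[OF binds that _ ov]) (use E QY in \<open>auto simp: Q_def\<close>)
  have step: "\<exists>K'. act_succ K (AQuery i) = return_spmf K' \<and>
      step (subst (tuple_subst X Y K) (plug E (App (LamB P) (Var y))))
        [subst (tuple_subst X' Y' K') (plug E (subst0 P (Var z)))]" if K: "tuple_type K (\<sigma>s, \<tau>s)" for K
  proof -
    obtain Ms Ws where MW: "K = (Ms, Ws)" by fastforce
    have len: "length Ms = length \<sigma>s" "length Ws = length \<tau>s" using tuple_type_lengths[OF K] MW by auto
    have "\<turnstile> Ws ! i : Exp \<gamma>" "is_val (Ws ! i)"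
      using K il i(2) len unfolding MW by (auto simp: tuple_type_def list_all2_conv_all_nth dest: nth_mem)
    then obtain N where N: "Ws ! i = Bang N" by (rule closed_Exp_val)
    define K' where "K' = (Ms @ [N], nths Ws S)"
    have s1: "tuple_subst X' Y' K' k = tuple_subst X Y K k" if "k \<in> dom X" for k
      using that z(1) binds len unfolding K'_def MW
      by (auto simp: tuple_subst_def X'_def binds_def nth_append)
    have s2: "tuple_subst X' Y' K' k = tuple_subst X Y K k" if k: "k \<in> Q" for k
    proof -
      have "X' k = None" using k QY zQ binds by (auto simp: X'_def binds_def)
      then have "tuple_subst X' Y' (Ms @ [N], nths Ws S @ []) k = tuple_subst X Y (Ms, Ws) k"
        by (intro tuple_subst_relocate[OF binds k QY] S[OF k] len) (simp_all add: Y'_def)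
      then show ?thesis by (simp add: K'_def MW)
    qed
    have s3: "tuple_subst X' Y' K' z = N" by (simp add: tuple_subst_def X'_def K'_def len[symmetric])
    have s4: "tuple_subst X Y K y = Bang N"
      using y i(1) N by (auto simp: tuple_subst_def MW split: option.splits)
    have e: "esubst (tuple_subst X' Y' K') E = esubst (tuple_subst X Y K) E"
      by (rule esubst_cong_typed[OF E]) (simp_all add: s1 s2 Q_def)
    have p: "subst (case_nat N (tuple_subst X' Y' K')) P = subst (case_nat N (tuple_subst X Y K)) P"
    proof (rule subst_cong_typed[OF P])
      fix k assume "k \<in> dom (case_nat (Some \<gamma>) (tyenv \<sigma>s X))"
      then show "case_nat N (tuple_subst X' Y' K') k = case_nat N (tuple_subst X Y K) k"
        by (auto split: nat.splits simp: tyenv_eq_Some intro!: s1)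
    next
      fix k assume "k \<in> dom (case_nat None D)"
      then show "case_nat N (tuple_subst X' Y' K') k = case_nat N (tuple_subst X Y K) k"
        by (auto split: nat.splits simp: Q_def intro!: s2)
    qed
    have "step (plug (esubst (tuple_subst X Y K) E) (App (LamB (subst (up (tuple_subst X Y K)) P)) (Bang N)))
      (map (plug (esubst (tuple_subst X Y K) E)) [subst0 (subst (up (tuple_subst X Y K)) P) N])"
      by (rule step_plug[OF ctx[OF K] step_betaB])
    \<comment> \<open>Both reducts are \<open>P\<close> under one simultaneous substitution that
      sends index 0 to \<open>N\<close>: for the beta step by definition, for the new context
      because \<open>z\<close> denotes \<open>N\<close> in the new tuple.\<close>
    then have "step (subst (tuple_subst X Y K) (plug E (App (LamB P) (Var y))))
        [subst (tuple_subst X' Y' K') (plug E (subst0 P (Var z)))]"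
      by (simp add: subst_plug s4 e subst_subst0_env s3 p subst0_subst_up)
    moreover have "act_succ K (AQuery i) = return_spmf K'"
      by (simp add: MW N K'_def S_def)
    ultimately show ?thesis by blast
  qed
  show ?thesis
  proof (rule approximable_act[OF bisim act app])
    fix K assume "tuple_type K (\<sigma>s, \<tau>s)"
    from step[OF this] obtain K' where K': "act_succ K (AQuery i) = return_spmf K'"
      and st: "step (subst (tuple_subst X Y K) (plug E (App (LamB P) (Var y))))
        [subst (tuple_subst X' Y' K') (plug E (subst0 P (Var z)))]" by blast
    show "weight_spmf (evl (Suc m) (subst (tuple_subst X Y K) (plug E (App (LamB P) (Var y)))))
      \<le> (\<integral>K'. weight_spmf (evl m (subst (tuple_subst X' Y' K') (plug E (subst0 P (Var z))))) \<partial>measure_spmf (act_succ K (AQuery i)))"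
      unfolding K' integral_return_spmf weight_evl_step[OF st] by (simp add: lessThan_Suc)
    show "(\<integral>K'. Obs (subst (tuple_subst X' Y' K') (plug E (subst0 P (Var z)))) \<partial>measure_spmf (act_succ K (AQuery i)))
      \<le> Obs (subst (tuple_subst X Y K) (plug E (App (LamB P) (Var y))))"
      unfolding K' integral_return_spmf Obs_step[OF st] by (simp add: lessThan_Suc)
  qed
qed

lemma value_ajudg:
  assumes binds: "binds (\<sigma>s, \<tau>s) X Y" and V: "has_type (tyenv \<sigma>s X) T V \<gamma>" "oval (dom X) V"
    and T: "T = tyenv \<tau>s (Y |` dom T)" "dom T \<subseteq> dom Y"
  defines "J \<equiv> {j. \<exists>k\<in>dom T. Y k = Some j}"
  obtains N where "is_val_ajudg ({..<length \<sigma>s}, J, \<sigma>s, \<tau>s, N, \<gamma>)"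
    "\<And>K. inst ({..<length \<sigma>s}, J, \<sigma>s, \<tau>s, N, \<gamma>) K = subst (tuple_subst X Y K) V"
proof
  \<comment> \<open>Variables move to their positions, those of the value part after the
    \<open>length \<sigma>s\<close> positions of the term part.\<close>
  define f where "f k = (case X k of Some i \<Rightarrow> i | None \<Rightarrow> length \<sigma>s + the (Y k))" for k
  have fX: "f k = i" "i < length \<sigma>s" if "X k = Some i" for k i
    using that binds by (auto simp: f_def binds_def)
  have fT: "\<exists>j. Y k = Some j \<and> X k = None \<and> f k = length \<sigma>s + j \<and> j \<in> J \<and> j < length \<tau>s"
    if "k \<in> dom T" for k
  proof -
    from that T(2) obtain j where j: "Y k = Some j" by blast
    moreover have "X k = None" using binds j by (auto simp: binds_def)
    ultimately show ?thesis using that binds by (auto simp: f_def J_def binds_def)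
  qed
  have T_Some: "T k = Some \<rho> \<longleftrightarrow> k \<in> dom T \<and> (\<exists>j. Y k = Some j \<and> \<rho> = \<tau>s ! j)" for k \<rho>
    by (subst T(1)) (auto simp: tyenv_def restrict_map_def split: if_splits)
  have "has_type (\<lambda>k. if k \<in> {..<length \<sigma>s} then Some (\<sigma>s ! k) else None)
       (\<lambda>k. if length \<sigma>s \<le> k \<and> k - length \<sigma>s \<in> J then Some (\<tau>s ! (k - length \<sigma>s)) else None)
       (ren f V) \<gamma>"
  proof (rule has_type_ren[OF V(1)])
    show "(if f k \<in> {..<length \<sigma>s} then Some (\<sigma>s ! f k) else None) = Some \<rho>" if "tyenv \<sigma>s X k = Some \<rho>" for k \<rho>
      using that fX by (auto simp: tyenv_eq_Some)
    show "(if f k \<in> {..<length \<sigma>s} then Some (\<sigma>s ! f k) else None) = None" if "k \<in> dom T" for k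
      using fT[OF that] by auto
    show "inj_on f (dom T)"
    proof (rule inj_onI)
      fix k l assume kl: "k \<in> dom T" "l \<in> dom T" "f k = f l"
      then have "Y k = Y l" using fT[OF kl(1)] fT[OF kl(2)] by auto
      moreover have "k \<in> dom Y" "l \<in> dom Y" using kl T(2) by blast+
      ultimately show "k = l" using binds unfolding binds_def by (auto dest: inj_onD)
    qed
    fix v \<rho>
    show "(if length \<sigma>s \<le> v \<and> v - length \<sigma>s \<in> J then Some (\<tau>s ! (v - length \<sigma>s)) else None) = Some \<rho> \<longleftrightarrow>
      (\<exists>k. f k = v \<and> T k = Some \<rho>)" (is "?l = ?r")
    proof
      assume ?l
      then have v: "length \<sigma>s \<le> v" "v - length \<sigma>s \<in> J" "\<rho> = \<tau>s ! (v - length \<sigma>s)" by (auto split: if_splits)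
      then obtain k where k: "k \<in> dom T" "Y k = Some (v - length \<sigma>s)" unfolding J_def by blast
      with fT[OF k(1)] v(1) have "f k = v" by auto
      moreover have "T k = Some \<rho>" using k v(3) T_Some by blast
      ultimately show ?r by blast
    next
      assume ?r
      then obtain k where k: "f k = v" "T k = Some \<rho>" by blast
      then have "k \<in> dom T" by blast
      from fT[OF this] k T_Some show ?l by auto
    qed
  qed
  moreover have "J \<subseteq> {..<length \<tau>s}" using fT by (auto simp: J_def) (metis domI option.inject)
  ultimately have "is_ajudg ({..<length \<sigma>s}, J, \<sigma>s, \<tau>s, ren f V, \<gamma>)" by simp
  moreover have "(\<exists>j\<in>J. ren f V = Var (length \<sigma>s + j)) \<or> is_val (ren f V)"
    using V(2) unfolding oval_def
  proof
    assume "is_val V"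
    then have "is_val (ren f V)" by (cases V) auto
    then show ?thesis ..
  next
    assume "\<exists>k. k \<notin> dom X \<and> V = Var k"
    then obtain k where k: "k \<notin> dom X" "V = Var k" by blast
    with V(1) have "k \<in> dom T" by (auto elim!: has_type_VarE simp: tyenv_eq_Some)
    from fT[OF this] k(2) show ?thesis by auto
  qed
  ultimately show "is_val_ajudg ({..<length \<sigma>s}, J, \<sigma>s, \<tau>s, ren f V, \<gamma>)" by simp
  fix K :: tuple
  obtain Ms Ws where K: "K = (Ms, Ws)" by fastforce
  show "inst ({..<length \<sigma>s}, J, \<sigma>s, \<tau>s, ren f V, \<gamma>) K = subst (tuple_subst X Y K) V"
    unfolding K inst.simps subst_ren
  proof (rule subst_cong_typed[OF V(1)], goal_cases)
    case (1 k)
    then obtain i where i: "X k = Some i" by auto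
    with fX[OF i] show ?case by (simp add: tuple_subst_def)
  next
    case (2 k)
    from fT[OF 2] show ?case by (auto simp: tuple_subst_def)
  qed
qed

text \<open>The approximant is built backwards from the end of the truncated run. Interpretations
  and types are arbitrary in the induction because every action changes them.\<close>

lemma approximable_term:
  assumes bisim: "eps_bisim \<epsilon> R" and \<epsilon>: "0 \<le> \<epsilon>"
  shows "binds A X Y \<Longrightarrow> has_type (tyenv (fst A) X) (tyenv (snd A) Y) C \<tau> \<Longrightarrow>
    approximable \<epsilon> R m A (\<lambda>K. subst (tuple_subst X Y K) C)"
proof (induction m arbitrary: A X Y C \<tau>)
  case 0
  show ?case using \<epsilon> by (rule approximable_0)
next
  case (Suc m)
  from Suc.prems show ?case
  proof (induction "var_count (dom X) C" arbitrary: A X Y C \<tau> rule: less_induct)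
    case less
    obtain \<sigma>s \<tau>s where A: "A = (\<sigma>s, \<tau>s)" by fastforce
    note binds = less.prems(1)[unfolded A] and typed = less.prems(2)[unfolded A fst_conv snd_conv]
    from decompose[OF typed, of "dom X"] show ?case unfolding A
    proof
      assume ov: "oval (dom X) C"
      show "approximable \<epsilon> R (Suc m) (\<sigma>s, \<tau>s) (\<lambda>K. subst (tuple_subst X Y K) C)"
      proof (rule approximable_val[OF bisim])
        fix K assume "tuple_type K (\<sigma>s, \<tau>s)"
        then show "is_val (subst (tuple_subst X Y K) C)"
          by (intro oval_subst[OF typed ov]) (auto intro!: is_val_tuple_subst[OF binds])
      qed
    next
      assume "\<exists>E r \<Delta>\<^sub>1 \<Delta>\<^sub>2 \<sigma>. C = plug E r \<and> oeval_ctx (dom X) E \<and> redex (dom X) r \<and>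
        ctx_type (tyenv \<sigma>s X) \<Delta>\<^sub>1 E \<sigma> \<tau> \<and> has_type (tyenv \<sigma>s X) \<Delta>\<^sub>2 r \<sigma> \<and>
        dom \<Delta>\<^sub>1 \<inter> dom \<Delta>\<^sub>2 = {} \<and> tyenv \<tau>s Y = \<Delta>\<^sub>1 ++ \<Delta>\<^sub>2"
      then obtain E r \<Delta>\<^sub>1 \<Delta>\<^sub>2 \<sigma> where C: "C = plug E r" and ov: "oeval_ctx (dom X) E" and "redex (dom X) r"
        and E: "ctx_type (tyenv \<sigma>s X) \<Delta>\<^sub>1 E \<sigma> \<tau>" and r: "has_type (tyenv \<sigma>s X) \<Delta>\<^sub>2 r \<sigma>"
        and split: "tyenv \<tau>s Y = \<Delta>\<^sub>1 ++ \<Delta>\<^sub>2" "dom \<Delta>\<^sub>1 \<inter> dom \<Delta>\<^sub>2 = {}" by blast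
      note sp = tyenv_split[OF split]
      have D1: "dom \<Delta>\<^sub>1 \<subseteq> dom Y" using sp(3) by blast
      let ?s = "tuple_subst X Y"
      have ctx: "eval_ctx (esubst (?s K) E)" if "tuple_type K (\<sigma>s, \<tau>s)" for K
        by (rule eval_ctx_tuple_subst[OF binds that _ ov]) (use E D1 in auto)
      have reduct: "approximable \<epsilon> R m (\<sigma>s, \<tau>s) (\<lambda>K. subst (?s K) (plug E r'))"
        if "has_type (tyenv \<sigma>s X) \<Delta>\<^sub>2 r' \<sigma>" for r'
      proof (rule Suc.IH[OF binds])
        show "has_type (tyenv (fst (\<sigma>s, \<tau>s)) X) (tyenv (snd (\<sigma>s, \<tau>s)) Y) (plug E r') \<tau>"
          using has_type_plug[OF E that split(2)] split(1) by simp
      qed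
      have val: "is_val (subst (?s K) V)"
        if "tuple_type K (\<sigma>s, \<tau>s)" "has_type (tyenv \<sigma>s X) T V \<rho>" "oval (dom X) V" "dom T \<subseteq> dom \<Delta>\<^sub>2" for K T V \<rho>
      proof (rule oval_subst[OF that(2,3)])
        fix k assume "k \<in> dom T"
        with that(4) sp(3) have "k \<in> dom Y" by blast
        then show "is_val (?s K k)" by (rule is_val_tuple_subst[OF binds that(1)])
      qed simp
      from \<open>redex (dom X) r\<close>
      show "approximable \<epsilon> R (Suc m) (\<sigma>s, \<tau>s) (\<lambda>K. subst (?s K) C)"
        unfolding C
      proof cases
        case (redex_choice M N)
        from r have MN: "has_type (tyenv \<sigma>s X) \<Delta>\<^sub>2 M \<sigma>" "has_type (tyenv \<sigma>s X) \<Delta>\<^sub>2 N \<sigma>"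
          unfolding redex_choice by (auto elim: has_type_ChoiceE)
        show "approximable \<epsilon> R (Suc m) (\<sigma>s, \<tau>s) (\<lambda>K. subst (?s K) (plug E r))"
        proof (rule approximable_choice[OF _ reduct[OF MN(1)] reduct[OF MN(2)]])
          fix K assume "tuple_type K (\<sigma>s, \<tau>s)"
          from step_plug[OF ctx[OF this] step_choice]
          show "step (subst (?s K) (plug E r)) [subst (?s K) (plug E M), subst (?s K) (plug E N)]"
            by (simp add: redex_choice subst_plug)
        qed
      next
        case (redex_beta V P)
        from r obtain D T \<rho> where DT: "\<Delta>\<^sub>2 = D ++ T" "has_type (tyenv \<sigma>s X) D (Lam P) (\<rho> \<multimap> \<sigma>)"
          "has_type (tyenv \<sigma>s X) T V \<rho>" "dom D \<inter> dom T = {}"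
          unfolding redex_beta by (rule has_type_AppE)
        \<comment> \<open>\<open>V\<close> may be a variable, in which case the open term takes no
          step; the reduct is therefore typed by the substitution lemma instead of by type
          preservation.\<close>
        have r': "has_type (tyenv \<sigma>s X) \<Delta>\<^sub>2 (subst0 P V) \<sigma>"
          using DT by (auto elim!: has_type_LamE simp: Arr_inject intro: has_type_subst0_linear)
        show "approximable \<epsilon> R (Suc m) (\<sigma>s, \<tau>s) (\<lambda>K. subst (?s K) (plug E r))"
        proof (rule approximable_step[OF _ reduct[OF r']])
          fix K assume K: "tuple_type K (\<sigma>s, \<tau>s)"
          have "is_val (subst (?s K) V)" by (rule val[OF K DT(3) redex_beta(2)]) (simp add: DT(1))
          from step_plug[OF ctx[OF K] step_beta[OF this]]
          show "step (subst (?s K) (plug E r)) [subst (?s K) (plug E (subst0 P V))]"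
            by (simp add: redex_beta subst_plug subst_subst0)
        qed
      next
        case (redex_betaB P N)
        have r': "has_type (tyenv \<sigma>s X) \<Delta>\<^sub>2 (subst0 P N) \<sigma>"
          by (rule subject_reduction[OF step_betaB r[unfolded redex_betaB]]) simp
        show "approximable \<epsilon> R (Suc m) (\<sigma>s, \<tau>s) (\<lambda>K. subst (?s K) (plug E r))"
        proof (rule approximable_step[OF _ reduct[OF r']])
          fix K assume K: "tuple_type K (\<sigma>s, \<tau>s)"
          from step_plug[OF ctx[OF K] step_betaB]
          show "step (subst (?s K) (plug E r)) [subst (?s K) (plug E (subst0 P N))]"
            by (simp add: redex_betaB subst_plug subst_subst0)
        qed
      next
        case (redex_query y P)
        show "approximable \<epsilon> R (Suc m) (\<sigma>s, \<tau>s) (\<lambda>K. subst (?s K) (plug E r))"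
          unfolding redex_query
          using bisim binds E ov split r[unfolded redex_query] redex_query(2) Suc.IH
          by (rule approximable_query)
      next
        case (redex_apply y V)
        from r obtain D T \<rho> where DT: "\<Delta>\<^sub>2 = D ++ T" "has_type (tyenv \<sigma>s X) D (Var y) (\<rho> \<multimap> \<sigma>)"
          "has_type (tyenv \<sigma>s X) T V \<rho>" "dom D \<inter> dom T = {}"
          unfolding redex_apply by (rule has_type_AppE)
        have D: "D = [y \<mapsto> \<rho> \<multimap> \<sigma>]"
          using DT(2) redex_apply(2) by (auto elim!: has_type_VarE simp: tyenv_eq_Some)
        have yT: "y \<notin> dom T" using DT(4) D by auto
        have \<Delta>2: "\<Delta>\<^sub>2 = T ++ [y \<mapsto> \<rho> \<multimap> \<sigma>]" using DT(1,4) D by (simp add: map_add_comm)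
        have "tyenv \<tau>s Y y = Some (\<rho> \<multimap> \<sigma>)" unfolding split(1) \<Delta>2 by simp
        then obtain i where i: "Y y = Some i" "\<tau>s ! i = \<rho> \<multimap> \<sigma>" by (auto simp: tyenv_eq_Some)
        have il: "i < length \<tau>s" using binds i(1) by (auto simp: binds_def)
        have "tyenv \<tau>s Y = (\<Delta>\<^sub>1 ++ D) ++ T" using split(1) DT(1) by simp
        moreover have "dom (\<Delta>\<^sub>1 ++ D) \<inter> dom T = {}" using split(2) DT(1,4) by auto
        ultimately have T: "T = tyenv \<tau>s (Y |` dom T)" "dom T \<subseteq> dom Y"
          using tyenv_split[of \<tau>s Y "\<Delta>\<^sub>1 ++ D" T] by blast+
        define J where "J = {j. \<exists>k\<in>dom T. Y k = Some j}"
        obtain N where N: "is_val_ajudg ({..<length \<sigma>s}, J, \<sigma>s, \<tau>s, N, \<rho>)"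
          "\<And>K. inst ({..<length \<sigma>s}, J, \<sigma>s, \<tau>s, N, \<rho>) K = subst (?s K) V"
          using value_ajudg[OF binds DT(3) redex_apply(3) T] unfolding J_def by blast
        have inj: "k = l" if "Y k = Some j" "Y l = Some j" for k l j
          using binds that unfolding binds_def inj_on_def by (metis domI)
        \<comment> \<open>The function variable cannot occur in its own argument by linearity, which
          is the side condition of the action.\<close>
        have iJ: "i \<notin> J" using inj[OF i(1)] yT by (auto simp: J_def)
        define \<kappa> where "\<kappa> = ({..<length \<sigma>s}, J, \<sigma>s, \<tau>s, N, \<rho>)"
        have act: "act_type (\<sigma>s, \<tau>s) (AApp \<kappa> i) (\<sigma>s, nths \<tau>s (- (J \<union> {i})) @ [\<sigma>])"
          unfolding \<kappa>_def using N(1) il i(2) iJ by (rule act_type.intros)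
        have "approximable \<epsilon> R (Suc m) (\<sigma>s, \<tau>s) (\<lambda>K. plug (esubst (?s K) E) (App (?s K y) (subst (?s K) V)))"
        proof (rule approximable_value_act[OF bisim binds E ov sp(1) D1 _ act])
          fix k j assume k: "k \<in> dom \<Delta>\<^sub>1" "Y k = Some j"
          then have ky: "k \<notin> dom T" "k \<noteq> y" using split(2) \<Delta>2 by auto
          have "j \<notin> J" unfolding J_def using inj[OF k(2)] ky(1) by blast
          moreover have "j \<noteq> i" using inj[OF k(2)] i(1) ky(2) by blast
          ultimately show "j \<in> - (J \<union> {i})" by blast
        next
          fix K :: tuple
          have "?s K y = snd K ! i"
            using redex_apply(2) i(1) by (auto simp: tuple_subst_def split: option.splits)
          then show "act_succ K (AApp \<kappa> i) =
            map_spmf (\<lambda>V. (fst K, nths (snd K) (- (J \<union> {i})) @ [V])) (sem (App (?s K y) (subst (?s K) V)))"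
            using N(2)[of K] by (cases K) (simp add: \<kappa>_def del: inst.simps)
        next
          \<comment> \<open>An application is no value, so the fuel drops to \<open>m\<close> and
            the outer induction hypothesis becomes available.\<close>
          fix K E' assume "eval_ctx E'"
          then show "weight_spmf (evl (Suc m) (plug E' (App (?s K y) (subst (?s K) V))))
            \<le> (\<integral>V'. weight_spmf (evl m (plug E' V')) \<partial>measure_spmf (sem (App (?s K y) (subst (?s K) V))))"
            by (rule weight_evl_plug_Suc_le) simp
        next
          fix z Y' assume "binds (\<sigma>s, nths \<tau>s (- (J \<union> {i})) @ [\<sigma>]) X Y'"
            "has_type (tyenv \<sigma>s X) (tyenv (nths \<tau>s (- (J \<union> {i})) @ [\<sigma>]) Y') (plug E (Var z)) \<tau>"
          then show "approximable \<epsilon> R m (\<sigma>s, nths \<tau>s (- (J \<union> {i})) @ [\<sigma>])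
              (\<lambda>K. subst (tuple_subst X Y' K) (plug E (Var z)))"
            by (intro Suc.IH) simp_all
        qed
        then show "approximable \<epsilon> R (Suc m) (\<sigma>s, \<tau>s) (\<lambda>K. subst (?s K) (plug E r))"
          by (simp add: redex_apply subst_plug)
      next
        case (redex_var x)
        from redex_var(2) obtain i where i: "X x = Some i" by blast
        have il: "i < length \<sigma>s" using binds i by (auto simp: binds_def)
        have \<sigma>: "\<sigma> = \<sigma>s ! i" using r i unfolding redex_var by (auto elim!: has_type_VarE simp: tyenv_eq_Some tyenv_def)
        \<comment> \<open>Evaluating a term removes no value, so \<open>S = UNIV\<close> fits this
          action to the common lemma.\<close>
        have act: "act_type (\<sigma>s, \<tau>s) (ABang i) (\<sigma>s, nths \<tau>s UNIV @ [\<sigma>])"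
          using act_type.intros(2)[OF il, of \<tau>s] by (simp add: \<sigma> nths_all)
        have "approximable \<epsilon> R (Suc m) (\<sigma>s, \<tau>s) (\<lambda>K. plug (esubst (?s K) E) (?s K x))"
        proof (rule approximable_value_act[OF bisim binds E ov sp(1) D1 _ act])
          fix K :: tuple
          show "act_succ K (ABang i) = map_spmf (\<lambda>V. (fst K, nths (snd K) UNIV @ [V])) (sem (?s K x))"
            using i by (cases K) (simp add: tuple_subst_def nths_all)
        next
          fix K E' assume "eval_ctx E'"
          then show "weight_spmf (evl (Suc m) (plug E' (?s K x)))
            \<le> (\<integral>V. weight_spmf (evl (Suc m) (plug E' V)) \<partial>measure_spmf (sem (?s K x)))"
            by (rule weight_evl_plug_le)
        next
          \<comment> \<open>The fuel stays the same; the inner induction applies because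
            \<open>z\<close> lies outside \<open>dom X\<close>.\<close>
          fix z Y' assume z: "z \<notin> dom X" and "binds (\<sigma>s, nths \<tau>s UNIV @ [\<sigma>]) X Y'"
            "has_type (tyenv \<sigma>s X) (tyenv (nths \<tau>s UNIV @ [\<sigma>]) Y') (plug E (Var z)) \<tau>"
          then show "approximable \<epsilon> R (Suc m) (\<sigma>s, nths \<tau>s UNIV @ [\<sigma>])
              (\<lambda>K. subst (tuple_subst X Y' K) (plug E (Var z)))"
            using var_count_plug[OF redex_var(2) z, of E]
            by (intro less.hyps) (simp_all add: C redex_var)
        qed simp
        then show "approximable \<epsilon> R (Suc m) (\<sigma>s, \<tau>s) (\<lambda>K. subst (?s K) (plug E r))"
          by (simp add: redex_var subst_plug)
      qed
    qed
  qed
qed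

text \<open>Approximants for growing fuel are squeezed towards the observation. Dominated
  convergence, with bound 1, carries over the bound \<open>\<epsilon>\<close>, which does not depend
  on the fuel.\<close>

lemma bisim_expected_Obs:
  assumes bisim: "eps_bisim \<epsilon> R" and \<epsilon>: "0 \<le> \<epsilon>" and R: "((D, A), (D', A)) \<in> R"
    and C: "binds A X Y" "has_type (tyenv (fst A) X) (tyenv (snd A) Y) C \<tau>"
  shows "\<bar>(\<integral>K. Obs (subst (tuple_subst X Y K) C) \<partial>measure_spmf D) -
    (\<integral>K. Obs (subst (tuple_subst X Y K) C) \<partial>measure_spmf D')\<bar> \<le> \<epsilon>"
proof -
  let ?F = "\<lambda>K. subst (tuple_subst X Y K) C"
  have "\<exists>f. (\<forall>K. 0 \<le> f K \<and> f K \<le> 1) \<and>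
     (\<forall>K. tuple_type K A \<longrightarrow> weight_spmf (evl m (?F K)) \<le> f K \<and> f K \<le> Obs (?F K)) \<and>
     \<bar>(\<integral>K. f K \<partial>measure_spmf D) - (\<integral>K. f K \<partial>measure_spmf D')\<bar> \<le> \<epsilon>" for m
    using approximable_term[OF bisim \<epsilon> C, of m] R unfolding approximable_def by blast
  then obtain f where f: "\<And>m K. 0 \<le> f m K \<and> f m K \<le> 1"
    "\<And>m K. tuple_type K A \<Longrightarrow> weight_spmf (evl m (?F K)) \<le> f m K \<and> f m K \<le> Obs (?F K)"
    "\<And>m. \<bar>(\<integral>K. f m K \<partial>measure_spmf D) - (\<integral>K. f m K \<partial>measure_spmf D')\<bar> \<le> \<epsilon>"
    by metis
  have lim: "(\<lambda>m. f m K) \<longlonglongrightarrow> Obs (?F K)" if "tuple_type K A" for K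
    by (rule tendsto_sandwich[OF _ _ weight_evl_tendsto_Obs tendsto_const]) (use f(2)[OF that] in auto)
  have I: "(\<lambda>m. \<integral>K. f m K \<partial>measure_spmf D) \<longlonglongrightarrow> (\<integral>K. Obs (?F K) \<partial>measure_spmf D)"
    if "(D, A) \<in> states" for D
  proof (rule integral_dominated_convergence[where w = "\<lambda>_. 1"])
    \<comment> \<open>Convergence is known for typed tuples only, and these carry all the mass of a
      state.\<close>
    show "AE K in measure_spmf D. (\<lambda>m. f m K) \<longlonglongrightarrow> Obs (?F K)"
      using that lim by (auto simp: states_def)
  qed (use f(1) in auto)
  have "(D, A) \<in> states" "(D', A) \<in> states" using bisim R unfolding eps_bisim_def by blast+
  then have "(\<lambda>m. \<bar>(\<integral>K. f m K \<partial>measure_spmf D) - (\<integral>K. f m K \<partial>measure_spmf D')\<bar>) \<longlonglongrightarrow>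
    \<bar>(\<integral>K. Obs (?F K) \<partial>measure_spmf D) - (\<integral>K. Obs (?F K) \<partial>measure_spmf D')\<bar>"
    by (intro tendsto_rabs tendsto_diff I)
  then show ?thesis by (rule LIMSEQ_le_const2) (use f(3) in blast)
qed

section \<open>Contexts with a linear hole\<close>

lemma has_type_Var_dom: "has_type \<Gamma> \<Delta> (Var k) \<tau> \<Longrightarrow> k \<in> dom \<Gamma> \<union> dom \<Delta>"
  by (auto elim: has_type_VarE)

text \<open>Until the hole is reached both fillings take the same steps. Truncating only the left
  side gives a bound inductive in the fuel: \<open>Obs_step\<close> follows each step on the right
  exactly, and at the hole the truncation is given up.\<close>

lemma weight_evl_subst0_le:
  assumes bisim: "eps_bisim \<epsilon> R" and \<epsilon>: "0 \<le> \<epsilon>" and R: "(tm_state \<sigma> M, tm_state \<sigma> N) \<in> R"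
  shows "has_type Map.empty [0 \<mapsto> \<sigma>] C \<tau> \<Longrightarrow> weight_spmf (evl m (subst0 C M)) \<le> Obs (subst0 C N) + \<epsilon>"
proof (induction m arbitrary: C)
  case 0
  show ?case using \<epsilon> Obs_nonneg[of "subst0 C N"] by simp
next
  case (Suc m)
  \<comment> \<open>With \<open>G = {0}\<close> the linear hole counts as an unevaluated term and
    becomes a redex in evaluation position. No other variable is declared, which makes the cases
    \<open>redex_query\<close> and \<open>redex_apply\<close> void.\<close>
  from decompose[OF Suc.prems, of "{0}"] show ?case
  proof
    assume "oval {0} C"
    moreover have False if "k \<notin> {0}" "C = Var k" for k
    proof -
      from has_type_Var_dom[OF Suc.prems[unfolded that(2)]] that(1) show False
        by (auto split: if_splits)
    qed
    ultimately have "is_val C" unfolding oval_def by blast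
    then have "Obs (subst0 C N) = 1" unfolding subst0_def by (intro Obs_val is_val_subst)
    then show ?thesis using \<epsilon> weight_spmf_le_1[of "evl (Suc m) (subst0 C M)"] by linarith
  next
    assume "\<exists>E r \<Delta>\<^sub>1 \<Delta>\<^sub>2 \<rho>. C = plug E r \<and> oeval_ctx {0} E \<and> redex {0} r \<and> ctx_type Map.empty \<Delta>\<^sub>1 E \<rho> \<tau> \<and>
      has_type Map.empty \<Delta>\<^sub>2 r \<rho> \<and> dom \<Delta>\<^sub>1 \<inter> dom \<Delta>\<^sub>2 = {} \<and> [0 \<mapsto> \<sigma>] = \<Delta>\<^sub>1 ++ \<Delta>\<^sub>2"
    then obtain E r \<Delta>\<^sub>1 \<Delta>\<^sub>2 \<rho> where C: "C = plug E r" and ov: "oeval_ctx {0} E" and "redex {0} r"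
      and E: "ctx_type Map.empty \<Delta>\<^sub>1 E \<rho> \<tau>" and r: "has_type Map.empty \<Delta>\<^sub>2 r \<rho>"
      and split: "[0 \<mapsto> \<sigma>] = \<Delta>\<^sub>1 ++ \<Delta>\<^sub>2" "dom \<Delta>\<^sub>1 \<inter> dom \<Delta>\<^sub>2 = {}" by blast
    have "dom (\<Delta>\<^sub>1 ++ \<Delta>\<^sub>2) \<subseteq> {0}" unfolding split(1)[symmetric] by (auto split: if_splits)
    then have dom: "dom \<Delta>\<^sub>1 \<subseteq> {0}" "dom \<Delta>\<^sub>2 \<subseteq> {0}" by auto
    let ?s = "\<lambda>L. case_nat L Var"
    have ctx: "eval_ctx (esubst s E)" for s
      by (rule eval_ctx_esubst[OF E ov]) (use dom in auto)
    have IH: "weight_spmf (evl m (subst (?s M) (plug E r'))) \<le> Obs (subst (?s N) (plug E r')) + \<epsilon>"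
      if "has_type Map.empty \<Delta>\<^sub>2 r' \<rho>" for r'
      using Suc.IH[of "plug E r'"] has_type_plug[OF E that split(2)] split(1) by (simp add: subst0_def)
    from \<open>redex {0} r\<close> show ?thesis
      unfolding C subst0_def
    proof cases
      case (redex_choice P Q)
      from r have PQ: "has_type Map.empty \<Delta>\<^sub>2 P \<rho>" "has_type Map.empty \<Delta>\<^sub>2 Q \<rho>"
        unfolding redex_choice by (auto elim: has_type_ChoiceE)
      have st: "step (subst s (plug E r)) [subst s (plug E P), subst s (plug E Q)]" for s
        using step_plug[OF ctx[of s] step_choice, of "subst s P" "subst s Q"] by (simp add: redex_choice subst_plug)
      show "weight_spmf (evl (Suc m) (subst (?s M) (plug E r))) \<le> Obs (subst (?s N) (plug E r)) + \<epsilon>"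
        unfolding weight_evl_step[OF st] Obs_step[OF st] using IH[OF PQ(1)] IH[OF PQ(2)]
        by (simp add: lessThan_Suc field_simps)
    next
      case (redex_beta V P)
      from r obtain D T \<sigma>' where DT: "\<Delta>\<^sub>2 = D ++ T" "has_type Map.empty D (Lam P) (\<sigma>' \<multimap> \<rho>)"
        "has_type Map.empty T V \<sigma>'" "dom D \<inter> dom T = {}"
        unfolding redex_beta by (rule has_type_AppE)
      have r': "has_type Map.empty \<Delta>\<^sub>2 (subst0 P V) \<rho>"
        using DT by (auto elim!: has_type_LamE simp: Arr_inject intro: has_type_subst0_linear)
      have "is_val (subst s V)" for s
        by (rule oval_subst[OF DT(3) redex_beta(2)]) (use dom(2) DT(1) in auto)
      from step_plug[OF ctx step_beta[OF this]]
      have st: "step (subst s (plug E r)) [subst s (plug E (subst0 P V))]" for s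
        by (simp add: redex_beta subst_plug subst_subst0)
      show "weight_spmf (evl (Suc m) (subst (?s M) (plug E r))) \<le> Obs (subst (?s N) (plug E r)) + \<epsilon>"
        unfolding weight_evl_step[OF st] Obs_step[OF st] using IH[OF r'] by (simp add: lessThan_Suc)
    next
      case (redex_betaB P Q)
      have r': "has_type Map.empty \<Delta>\<^sub>2 (subst0 P Q) \<rho>"
        by (rule subject_reduction[OF step_betaB r[unfolded redex_betaB]]) simp
      from step_plug[OF ctx step_betaB]
      have st: "step (subst s (plug E r)) [subst s (plug E (subst0 P Q))]" for s
        by (simp add: redex_betaB subst_plug subst_subst0)
      show "weight_spmf (evl (Suc m) (subst (?s M) (plug E r))) \<le> Obs (subst (?s N) (plug E r)) + \<epsilon>"
        unfolding weight_evl_step[OF st] Obs_step[OF st] using IH[OF r'] by (simp add: lessThan_Suc)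
    next
      case (redex_query y P)
      from r have "y \<in> dom \<Delta>\<^sub>2" unfolding redex_query by (auto elim!: has_type_AppE dest!: has_type_Var_dom)
      with dom(2) redex_query(2) show "weight_spmf (evl (Suc m) (subst (?s M) (plug E r))) \<le> Obs (subst (?s N) (plug E r)) + \<epsilon>"
        by blast
    next
      case (redex_apply y V)
      from r have "y \<in> dom \<Delta>\<^sub>2" unfolding redex_apply by (auto elim!: has_type_AppE dest!: has_type_Var_dom)
      with dom(2) redex_apply(2) show "weight_spmf (evl (Suc m) (subst (?s M) (plug E r))) \<le> Obs (subst (?s N) (plug E r)) + \<epsilon>"
        by blast
    next
      case (redex_var x)
      then have x: "x = 0" by simp
      have \<Delta>2: "\<Delta>\<^sub>2 = [0 \<mapsto> \<rho>]" using r unfolding redex_var x by (auto elim!: has_type_VarE)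
      have "0 \<in> dom \<Delta>\<^sub>2" by (simp add: \<Delta>2 dom_def)
      with dom(1) split(2) have "dom \<Delta>\<^sub>1 = {}" by blast
      then have \<Delta>1: "\<Delta>\<^sub>1 = Map.empty" by (simp only: dom_eq_empty_conv)
      \<comment> \<open>By linearity the redex has spent the hole, so the surrounding context is the
        same whatever is filled in.\<close>
      define E' where "E' = esubst Var E"
      have E': "esubst s E = E'" for s
        unfolding E'_def by (rule esubst_cong_typed[OF E]) (simp_all add: \<Delta>1)
      have plug: "Obs (subst (?s L) (plug E r)) = (\<integral>V. Obs (plug E' V) \<partial>measure_spmf (sem L))" for L
        using Obs_plug[OF ctx[of Var, folded E'_def], of L] by (simp add: redex_var x subst_plug E')
      \<comment> \<open>Now index 0 changes its role: it denotes the value to which the filled-in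
        term evaluates, read at the only position of the initial tuple.\<close>
      have expect: "(\<integral>K. Obs (subst (tuple_subst Map.empty [0 \<mapsto> 0] K) C) \<partial>measure_spmf (fst (tm_state \<sigma> L))) =
        (\<integral>V. Obs (plug E' V) \<partial>measure_spmf (sem L))" for L
        by (simp add: tm_state_def integral_map_spmf C redex_var x subst_plug E' tuple_subst_def)
      have binds: "binds ([], [\<sigma>]) Map.empty [0 \<mapsto> 0]" by (auto simp: binds_def)
      have "tyenv [] Map.empty = Map.empty" "tyenv [\<sigma>] [0 \<mapsto> 0] = [0 \<mapsto> \<sigma>]"
        by (auto simp: tyenv_def)
      with Suc.prems have typed: "has_type (tyenv [] Map.empty) (tyenv [\<sigma>] [0 \<mapsto> 0]) C \<tau>"
        by (simp only:)
      have "((fst (tm_state \<sigma> M), ([], [\<sigma>])), (fst (tm_state \<sigma> N), ([], [\<sigma>]))) \<in> R"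
        using R by (simp add: tm_state_def)
      from bisim_expected_Obs[OF bisim \<epsilon> this binds, unfolded fst_conv snd_conv, OF typed]
      have "\<bar>(\<integral>V. Obs (plug E' V) \<partial>measure_spmf (sem M)) - (\<integral>V. Obs (plug E' V) \<partial>measure_spmf (sem N))\<bar> \<le> \<epsilon>"
        unfolding expect .
      then show "weight_spmf (evl (Suc m) (subst (?s M) (plug E r))) \<le> Obs (subst (?s N) (plug E r)) + \<epsilon>"
        using weight_evl_le_Obs[of "Suc m" "subst (?s M) (plug E r)"] unfolding plug by linarith
    qed
  qed
qed

text \<open>Symmetry of \<open>R\<close> allows the one-sided bound to be used with \<open>M\<close>
  and \<open>N\<close> exchanged.\<close>

lemma Obs_subst0_diff_le:
  assumes bisim: "eps_bisim \<epsilon> R" and \<epsilon>: "0 \<le> \<epsilon>" and R: "(tm_state \<sigma> M, tm_state \<sigma> N) \<in> R"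
    and C: "has_type Map.empty [0 \<mapsto> \<sigma>] C \<tau>"
  shows "\<bar>Obs (subst0 C M) - Obs (subst0 C N)\<bar> \<le> \<epsilon>"
proof -
  have le: "Obs (subst0 C M) \<le> Obs (subst0 C N) + \<epsilon>" if "(tm_state \<sigma> M, tm_state \<sigma> N) \<in> R" for M N
    by (rule LIMSEQ_le_const2[OF weight_evl_tendsto_Obs])
       (use weight_evl_subst0_le[OF bisim \<epsilon> that C] in blast)
  have "(tm_state \<sigma> N, tm_state \<sigma> M) \<in> R" using bisim R by (auto simp: eps_bisim_def dest: symD)
  from le[OF R] le[OF this] show ?thesis by linarith
qed

theorem theorem4:
  fixes \<sigma> :: ty and M N :: tm
  assumes "\<turnstile> M : \<sigma>" and "\<turnstile> N : \<sigma>"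
  shows "ctx_dist \<sigma> M N \<le> tuple_dist \<sigma> M N"
  unfolding tuple_dist_def state_dist_def
proof (rule cInf_greatest)
  \<comment> \<open>The relation between all states of equal type puts 1 among the candidates for
    the infimum.\<close>
  have "(tm_state \<sigma> M, tm_state \<sigma> N) \<in> {((D, A), (D', A)) | D D' A. (D, A) \<in> states \<and> (D', A) \<in> states}"
    using tm_state_states[OF assms(1)] tm_state_states[OF assms(2)] by (auto simp: tm_state_def)
  then have "(tm_state \<sigma> M, tm_state \<sigma> N) \<in> eps_bisimilarity 1"
    unfolding eps_bisimilarity_def using total_relation_bisim by blast
  then show "{\<epsilon>. 0 \<le> \<epsilon> \<and> \<epsilon> \<le> 1 \<and> (tm_state \<sigma> M, tm_state \<sigma> N) \<in> eps_bisimilarity \<epsilon>} \<noteq> {}"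
    by force
next
  fix \<epsilon> assume "\<epsilon> \<in> {\<epsilon>. 0 \<le> \<epsilon> \<and> \<epsilon> \<le> 1 \<and> (tm_state \<sigma> M, tm_state \<sigma> N) \<in> eps_bisimilarity \<epsilon>}"
  then obtain R where R: "0 \<le> \<epsilon>" "eps_bisim \<epsilon> R" "(tm_state \<sigma> M, tm_state \<sigma> N) \<in> R"
    unfolding eps_bisimilarity_def by blast
  show "ctx_dist \<sigma> M N \<le> \<epsilon>"
    unfolding ctx_dist_def
  proof (rule cSup_least)
    \<comment> \<open>The bare hole is a context, so the supremum is taken over a nonempty
      set.\<close>
    have "has_type Map.empty [0 \<mapsto> \<sigma>] (Var 0) \<sigma>" by (rule T_var) simp
    then show "{\<bar>Obs (subst0 C M) - Obs (subst0 C N)\<bar> | C \<tau>. has_type Map.empty [0 \<mapsto> \<sigma>] C \<tau>} \<noteq> {}" by blast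
  qed (use Obs_subst0_diff_le[OF R(2,1,3)] in blast)
qed

end
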